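(* Let $B$ be a ring, let $A$ be a ring of rank $n$ over $B$, and let $C$ be a $B$-algebra. Then there is a natural isomorphism $$G(A/B)\otimes_B C\;\simeq\; G\bigl((A\otimes_B C)/C\bigr)$$ of $C$-algebras.
   Context: All rings are commutative with unity. A ring of rank $n$ over $B$ is a $B$-algebra that is free of rank $n$ as a $B$-module. Let $A$ be a ring of rank $n$ over $B$. For $a\in A$ let $P_a(x)=x^n-s_1(a)x^{n-1}+s_2(a)x^{n-2}-\cdots+(-1)^n s_n(a)$ be the characteristic polynomial of the $B$-linear map $A\to A$ given by multiplication by $a$; this defines $s_j(a)\in B$ for $1\le j\le n$. All tensor powers are over $B$. For $a\in A$ and $1\le i\le n$ let $a^{(i)}=1\otimes\cdots\otimes a\otimes\cdots\otimes 1\in A^{\otimes n}$, with $a$ in the $i$-th tensor factor. Let $I(A,B)\subset A^{\otimes n}$ be the ideal generated by all elements $$s_j(a)-\sum_{1\le i_1<\cdots<i_j\le n}a^{(i_1)}a^{(i_2)}\cdots a^{(i_j)},\qquad a\in A,\ 1\le j\le n.$$ The $S_n$-closure of $A$ over $B$ is the $B$-algebra $G(A/B)=A^{\otimes n}/I(A,B)$. *)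

theory Defs
  imports
    "HOL-Algebra.Module"
    "HOL-Algebra.QuotRing"
    "HOL-Algebra.UnivPoly"
    "HOL-Algebra.Product_Groups"
    "HOL-Combinatorics.Permutations"
begin

section \<open>Algebras and their quotients\<close>

definition algebra_hom ::
  "('b, 'k) ring_scheme \<Rightarrow> ('b, 'm, 'p) module_scheme \<Rightarrow> ('b, 'n, 'q) module_scheme \<Rightarrow> ('m \<Rightarrow> 'n) set"
  where "algebra_hom R M N =
    {h \<in> ring_hom M N. \<forall>r\<in>carrier R. \<forall>x\<in>carrier M. h (r \<odot>\<^bsub>M\<^esub> x) = r \<odot>\<^bsub>N\<^esub> h x}"

definition algebra_iso ::
  "('b, 'k) ring_scheme \<Rightarrow> ('b, 'm, 'p) module_scheme \<Rightarrow> ('b, 'n, 'q) module_scheme \<Rightarrow> ('m \<Rightarrow> 'n) set"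
  where "algebra_iso R M N = {h \<in> algebra_hom R M N. bij_betw h (carrier M) (carrier N)}"

definition quot_algebra :: "('b, 'm, 'p) module_scheme \<Rightarrow> 'm set \<Rightarrow> ('b, 'm set) module"
  where "quot_algebra M I =
    \<lparr>carrier = carrier (M Quot I), monoid.mult = monoid.mult (M Quot I), one = one (M Quot I),
     zero = zero (M Quot I), add = ring.add (M Quot I),
     smult = (\<lambda>r X. \<Union>x\<in>X. I +>\<^bsub>M\<^esub> (r \<odot>\<^bsub>M\<^esub> x))\<rparr>"

text \<open>The map induced by \<open>h\<close> on a set of cosets; meaningful when \<open>h\<close> is constant on each coset.\<close>

definition quot_lift :: "('m \<Rightarrow> 'n) \<Rightarrow> 'm set \<Rightarrow> 'n"
  where "quot_lift h X = the_elem (h ` X)"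


section \<open>Monoid algebras\<close>

text \<open>
  \<open>monoid_algebra B G\<close> is \<open>B[G]\<close>: finitely supported functions with convolution product.
  As a module it is the free module on \<open>carrier G\<close>.
\<close>

definition monoid_algebra ::
  "('b, 'k) ring_scheme \<Rightarrow> ('g, 'l) monoid_scheme \<Rightarrow> ('b, 'g \<Rightarrow> 'b) module"
  where "monoid_algebra B G =
    \<lparr>carrier = {f. (\<forall>x. f x \<in> carrier B) \<and> {x. f x \<noteq> \<zero>\<^bsub>B\<^esub>} \<subseteq> carrier G \<and> finite {x. f x \<noteq> \<zero>\<^bsub>B\<^esub>}},
     monoid.mult = (\<lambda>f g z. \<Oplus>\<^bsub>B\<^esub>p\<in>{(x, y). f x \<noteq> \<zero>\<^bsub>B\<^esub> \<and> g y \<noteq> \<zero>\<^bsub>B\<^esub> \<and> x \<otimes>\<^bsub>G\<^esub> y = z}. f (fst p) \<otimes>\<^bsub>B\<^esub> g (snd p)),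
     one = (\<lambda>_. \<zero>\<^bsub>B\<^esub>)(\<one>\<^bsub>G\<^esub> := \<one>\<^bsub>B\<^esub>),
     zero = (\<lambda>_. \<zero>\<^bsub>B\<^esub>),
     add = (\<lambda>f g x. f x \<oplus>\<^bsub>B\<^esub> g x),
     smult = (\<lambda>b f x. b \<otimes>\<^bsub>B\<^esub> f x)\<rparr>"

definition single :: "('b, 'k) ring_scheme \<Rightarrow> 'g \<Rightarrow> 'g \<Rightarrow> 'b"
  where "single B x = (\<lambda>_. \<zero>\<^bsub>B\<^esub>)(x := \<one>\<^bsub>B\<^esub>)"

text \<open>
  The additive extension of \<open>b x \<mapsto> g b \<cdot> k x\<close> from \<open>B[G]\<close> to \<open>N\<close>, where \<open>g\<close> maps \<open>B\<close> to the
  ring of scalars of \<open>N\<close>.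
\<close>

definition lin_ext ::
  "('b, 'k) ring_scheme \<Rightarrow> ('c, 'n, 'q) module_scheme \<Rightarrow> ('b \<Rightarrow> 'c) \<Rightarrow> ('g \<Rightarrow> 'n) \<Rightarrow> ('g \<Rightarrow> 'b) \<Rightarrow> 'n"
  where "lin_ext B N g k f = (\<Oplus>\<^bsub>N\<^esub>x\<in>{x. f x \<noteq> \<zero>\<^bsub>B\<^esub>}. g (f x) \<odot>\<^bsub>N\<^esub> k x)"


section \<open>Tensor products of algebras\<close>

text \<open>
  The tensor product of the algebras \<open>M\<close> and \<open>N\<close> is the free module on \<open>carrier M \<times> carrier N\<close>,
  i.e. \<open>B[M \<times> N]\<close> for the multiplicative monoid \<open>M \<times> N\<close>, modulo the bilinearity relations.
  The set of relations is stable, up to scalars, under multiplication by the basis elements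
  \<open>(m, x)\<close>, so the ideal it generates is the submodule it generates.
\<close>

definition tensor_free ::
  "('b, 'k) ring_scheme \<Rightarrow> ('b, 'm, 'p) module_scheme \<Rightarrow> ('b, 'n, 'q) module_scheme
    \<Rightarrow> ('b, 'm \<times> 'n \<Rightarrow> 'b) module"
  where "tensor_free B M N = monoid_algebra B (M \<times>\<times> N)"

definition tensor_rels ::
  "('b, 'k) ring_scheme \<Rightarrow> ('b, 'm, 'p) module_scheme \<Rightarrow> ('b, 'n, 'q) module_scheme
    \<Rightarrow> ('m \<times> 'n \<Rightarrow> 'b) set"
  where "tensor_rels B M N = (let F = tensor_free B M N; d = single B in
    {d (m \<oplus>\<^bsub>M\<^esub> m', x) \<ominus>\<^bsub>F\<^esub> (d (m, x) \<oplus>\<^bsub>F\<^esub> d (m', x)) | m m' x.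
       m \<in> carrier M \<and> m' \<in> carrier M \<and> x \<in> carrier N} \<union>
    {d (m, x \<oplus>\<^bsub>N\<^esub> x') \<ominus>\<^bsub>F\<^esub> (d (m, x) \<oplus>\<^bsub>F\<^esub> d (m, x')) | m x x'.
       m \<in> carrier M \<and> x \<in> carrier N \<and> x' \<in> carrier N} \<union>
    {d (b \<odot>\<^bsub>M\<^esub> m, x) \<ominus>\<^bsub>F\<^esub> (b \<odot>\<^bsub>F\<^esub> d (m, x)) | b m x.
       b \<in> carrier B \<and> m \<in> carrier M \<and> x \<in> carrier N} \<union>
    {d (m, b \<odot>\<^bsub>N\<^esub> x) \<ominus>\<^bsub>F\<^esub> (b \<odot>\<^bsub>F\<^esub> d (m, x)) | b m x.
       b \<in> carrier B \<and> m \<in> carrier M \<and> x \<in> carrier N})"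

definition tensor_ideal ::
  "('b, 'k) ring_scheme \<Rightarrow> ('b, 'm, 'p) module_scheme \<Rightarrow> ('b, 'n, 'q) module_scheme
    \<Rightarrow> ('m \<times> 'n \<Rightarrow> 'b) set"
  where "tensor_ideal B M N = Idl\<^bsub>tensor_free B M N\<^esub> (tensor_rels B M N)"

definition tensor_algebra ::
  "('b, 'k) ring_scheme \<Rightarrow> ('b, 'm, 'p) module_scheme \<Rightarrow> ('b, 'n, 'q) module_scheme
    \<Rightarrow> ('b, ('m \<times> 'n \<Rightarrow> 'b) set) module"
  where "tensor_algebra B M N = quot_algebra (tensor_free B M N) (tensor_ideal B M N)"

definition tensor_pure ::
  "('b, 'k) ring_scheme \<Rightarrow> ('b, 'm, 'p) module_scheme \<Rightarrow> ('b, 'n, 'q) module_scheme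
    \<Rightarrow> 'm \<Rightarrow> 'n \<Rightarrow> ('m \<times> 'n \<Rightarrow> 'b) set"
  where "tensor_pure B M N m x = tensor_ideal B M N +>\<^bsub>tensor_free B M N\<^esub> single B (m, x)"

definition tensor_map ::
  "('b, 'k) ring_scheme \<Rightarrow> ('b, 'm', 'p') module_scheme \<Rightarrow> ('b, 'n', 'q') module_scheme
    \<Rightarrow> ('m \<Rightarrow> 'm') \<Rightarrow> ('n \<Rightarrow> 'n') \<Rightarrow> ('m \<times> 'n \<Rightarrow> 'b) set \<Rightarrow> ('m' \<times> 'n' \<Rightarrow> 'b) set"
  where "tensor_map B M' N' f h =
    quot_lift (lin_ext B (tensor_algebra B M' N') (\<lambda>b. b) (\<lambda>(m, x). tensor_pure B M' N' (f m) (h x)))"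

text \<open>The ring \<open>M \<otimes>\<^sub>B C\<close> regarded as an algebra over \<open>C\<close>.\<close>

definition base_change ::
  "('b, 'k) ring_scheme \<Rightarrow> ('b, 'm, 'p) module_scheme \<Rightarrow> ('b, 'c, 'q) module_scheme
    \<Rightarrow> ('c, ('m \<times> 'c \<Rightarrow> 'b) set) module"
  where "base_change B M C = (let T = tensor_algebra B M C in
    \<lparr>carrier = carrier T, monoid.mult = monoid.mult T, one = one T, zero = zero T, add = ring.add T,
     smult = (\<lambda>c t. tensor_pure B M C \<one>\<^bsub>M\<^esub> c \<otimes>\<^bsub>T\<^esub> t)\<rparr>)"


section \<open>Tensor powers\<close>

text \<open>
  \<open>A\<^sup>\<otimes>\<^sup>n\<close> is obtained in the same way from the free module on the \<open>n\<close>-tuples of elements of \<open>A\<close>,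
  which are extensional functions on \<open>{1..n}\<close>, modulo the multilinearity relations.
\<close>

definition power_free ::
  "('b, 'k) ring_scheme \<Rightarrow> ('b, 'a, 'p) module_scheme \<Rightarrow> nat \<Rightarrow> ('b, (nat \<Rightarrow> 'a) \<Rightarrow> 'b) module"
  where "power_free B A n = monoid_algebra B (product_group {1..n} (\<lambda>_. A))"

definition power_rels ::
  "('b, 'k) ring_scheme \<Rightarrow> ('b, 'a, 'p) module_scheme \<Rightarrow> nat \<Rightarrow> ((nat \<Rightarrow> 'a) \<Rightarrow> 'b) set"
  where "power_rels B A n = (let F = power_free B A n; d = single B in
    {d (t(i := x \<oplus>\<^bsub>A\<^esub> y)) \<ominus>\<^bsub>F\<^esub> (d (t(i := x)) \<oplus>\<^bsub>F\<^esub> d (t(i := y))) | t i x y.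
       t \<in> {1..n} \<rightarrow>\<^sub>E carrier A \<and> i \<in> {1..n} \<and> x \<in> carrier A \<and> y \<in> carrier A} \<union>
    {d (t(i := b \<odot>\<^bsub>A\<^esub> x)) \<ominus>\<^bsub>F\<^esub> (b \<odot>\<^bsub>F\<^esub> d (t(i := x))) | t i b x.
       t \<in> {1..n} \<rightarrow>\<^sub>E carrier A \<and> i \<in> {1..n} \<and> b \<in> carrier B \<and> x \<in> carrier A})"

definition power_ideal ::
  "('b, 'k) ring_scheme \<Rightarrow> ('b, 'a, 'p) module_scheme \<Rightarrow> nat \<Rightarrow> ((nat \<Rightarrow> 'a) \<Rightarrow> 'b) set"
  where "power_ideal B A n = Idl\<^bsub>power_free B A n\<^esub> (power_rels B A n)"

definition tensor_power ::
  "('b, 'k) ring_scheme \<Rightarrow> ('b, 'a, 'p) module_scheme \<Rightarrow> nat \<Rightarrow> ('b, ((nat \<Rightarrow> 'a) \<Rightarrow> 'b) set) module"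
  where "tensor_power B A n = quot_algebra (power_free B A n) (power_ideal B A n)"

definition power_pure ::
  "('b, 'k) ring_scheme \<Rightarrow> ('b, 'a, 'p) module_scheme \<Rightarrow> nat \<Rightarrow> (nat \<Rightarrow> 'a) \<Rightarrow> ((nat \<Rightarrow> 'a) \<Rightarrow> 'b) set"
  where "power_pure B A n t = power_ideal B A n +>\<^bsub>power_free B A n\<^esub> single B t"

text \<open>The element \<open>1 \<otimes> \<dots> \<otimes> a \<otimes> \<dots> \<otimes> 1\<close> with \<open>a\<close> in position \<open>i\<close>.\<close>

definition power_place ::
  "('b, 'k) ring_scheme \<Rightarrow> ('b, 'a, 'p) module_scheme \<Rightarrow> nat \<Rightarrow> nat \<Rightarrow> 'a \<Rightarrow> ((nat \<Rightarrow> 'a) \<Rightarrow> 'b) set"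
  where "power_place B A n i a = power_pure B A n ((\<lambda>k\<in>{1..n}. \<one>\<^bsub>A\<^esub>)(i := a))"


section \<open>Free modules and characteristic polynomials\<close>

definition coords_of ::
  "('b, 'k) ring_scheme \<Rightarrow> ('b, 'm, 'p) module_scheme \<Rightarrow> nat \<Rightarrow> (nat \<Rightarrow> 'm) \<Rightarrow> 'm \<Rightarrow> (nat \<Rightarrow> 'b) \<Rightarrow> bool"
  where "coords_of B M n e x c \<longleftrightarrow>
    c \<in> {1..n} \<rightarrow>\<^sub>E carrier B \<and> x = (\<Oplus>\<^bsub>M\<^esub>i\<in>{1..n}. c i \<odot>\<^bsub>M\<^esub> e i)"

definition module_basis ::
  "('b, 'k) ring_scheme \<Rightarrow> ('b, 'm, 'p) module_scheme \<Rightarrow> nat \<Rightarrow> (nat \<Rightarrow> 'm) \<Rightarrow> bool"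
  where "module_basis B M n e \<longleftrightarrow>
    e \<in> {1..n} \<rightarrow> carrier M \<and> (\<forall>x\<in>carrier M. \<exists>!c. coords_of B M n e x c)"

definition ring_of_rank ::
  "('b, 'k) ring_scheme \<Rightarrow> ('b, 'm, 'p) module_scheme \<Rightarrow> nat \<Rightarrow> bool"
  where "ring_of_rank B A n \<longleftrightarrow> algebra B A \<and> (\<exists>e. module_basis B A n e)"

definition ring_det :: "('r, 'k) ring_scheme \<Rightarrow> nat \<Rightarrow> (nat \<Rightarrow> nat \<Rightarrow> 'r) \<Rightarrow> 'r"
  where "ring_det R n M = (\<Oplus>\<^bsub>R\<^esub>p\<in>{p. p permutes {1..n}}.
    (if evenperm p then (\<Otimes>\<^bsub>R\<^esub>i\<in>{1..n}. M i (p i)) else \<ominus>\<^bsub>R\<^esub> (\<Otimes>\<^bsub>R\<^esub>i\<in>{1..n}. M i (p i))))"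

definition mat_char_poly :: "('b, 'k) ring_scheme \<Rightarrow> nat \<Rightarrow> (nat \<Rightarrow> nat \<Rightarrow> 'b) \<Rightarrow> nat \<Rightarrow> 'b"
  where "mat_char_poly B n M = ring_det (UP B) n
    (\<lambda>i j. (if i = j then monom (UP B) \<one>\<^bsub>B\<^esub> 1 else \<zero>\<^bsub>UP B\<^esub>) \<ominus>\<^bsub>UP B\<^esub> monom (UP B) (M i j) 0)"

definition lin_matrix ::
  "('b, 'k) ring_scheme \<Rightarrow> ('b, 'm, 'p) module_scheme \<Rightarrow> nat \<Rightarrow> (nat \<Rightarrow> 'm) \<Rightarrow> ('m \<Rightarrow> 'm) \<Rightarrow> nat \<Rightarrow> nat \<Rightarrow> 'b"
  where "lin_matrix B M n e \<phi> i j = (THE c. coords_of B M n e (\<phi> (e j)) c) i"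

text \<open>The characteristic polynomial does not depend on the basis, so an arbitrary one is chosen.\<close>

definition lin_char_poly ::
  "('b, 'k) ring_scheme \<Rightarrow> ('b, 'm, 'p) module_scheme \<Rightarrow> nat \<Rightarrow> ('m \<Rightarrow> 'm) \<Rightarrow> nat \<Rightarrow> 'b"
  where "lin_char_poly B M n \<phi> =
    mat_char_poly B n (lin_matrix B M n (SOME e. module_basis B M n e) \<phi>)"

text \<open>\<open>s\<^sub>j(a)\<close> is \<open>(-1)\<^sup>j\<close> times the coefficient of \<open>x\<^sup>n\<^sup>-\<^sup>j\<close> (for \<open>j \<le> n\<close>).\<close>

definition char_coeff ::
  "('b, 'k) ring_scheme \<Rightarrow> ('b, 'a, 'p) module_scheme \<Rightarrow> nat \<Rightarrow> nat \<Rightarrow> 'a \<Rightarrow> 'b"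
  where "char_coeff B A n j a =
    (\<ominus>\<^bsub>B\<^esub> \<one>\<^bsub>B\<^esub>) [^]\<^bsub>B\<^esub> j \<otimes>\<^bsub>B\<^esub> coeff (UP B) (lin_char_poly B A n (\<lambda>x. a \<otimes>\<^bsub>A\<^esub> x)) (n - j)"


section \<open>The \<open>S\<^sub>n\<close>-closure\<close>

definition sn_ideal ::
  "('b, 'k) ring_scheme \<Rightarrow> ('b, 'a, 'p) module_scheme \<Rightarrow> nat \<Rightarrow> ((nat \<Rightarrow> 'a) \<Rightarrow> 'b) set set"
  where "sn_ideal B A n = (let T = tensor_power B A n in
    Idl\<^bsub>T\<^esub> {(char_coeff B A n j a \<odot>\<^bsub>T\<^esub> \<one>\<^bsub>T\<^esub>) \<ominus>\<^bsub>T\<^esub>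
        (\<Oplus>\<^bsub>T\<^esub>K\<in>{K. K \<subseteq> {1..n} \<and> card K = j}. \<Otimes>\<^bsub>T\<^esub>i\<in>K. power_place B A n i a) | a j.
        a \<in> carrier A \<and> j \<in> {1..n}})"

definition sn_closure ::
  "('b, 'k) ring_scheme \<Rightarrow> ('b, 'a, 'p) module_scheme \<Rightarrow> nat \<Rightarrow> ('b, ((nat \<Rightarrow> 'a) \<Rightarrow> 'b) set set) module"
  where "sn_closure B A n = quot_algebra (tensor_power B A n) (sn_ideal B A n)"

definition sn_class ::
  "('b, 'k) ring_scheme \<Rightarrow> ('b, 'a, 'p) module_scheme \<Rightarrow> nat
    \<Rightarrow> ((nat \<Rightarrow> 'a) \<Rightarrow> 'b) set \<Rightarrow> ((nat \<Rightarrow> 'a) \<Rightarrow> 'b) set set"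
  where "sn_class B A n u = sn_ideal B A n +>\<^bsub>tensor_power B A n\<^esub> u"

text \<open>
  The map \<open>G(A/B) \<rightarrow> G(A'/B')\<close>, \<open>b (a\<^sub>1 \<otimes> \<dots> \<otimes> a\<^sub>n) \<mapsto> g b (f a\<^sub>1 \<otimes> \<dots> \<otimes> f a\<^sub>n)\<close>, induced by ring
  homomorphisms \<open>g : B \<rightarrow> B'\<close> and \<open>f : A \<rightarrow> A'\<close>. It exists only if \<open>f\<close> is semilinear over \<open>g\<close>
  and compatible with the characteristic polynomials, e.g. if \<open>f\<close> is an isomorphism over \<open>B\<close>
  or the canonical map \<open>A \<rightarrow> A \<otimes>\<^sub>B B'\<close>.
\<close>

definition sn_map ::
  "('b, 'k) ring_scheme \<Rightarrow> ('c, 'l) ring_scheme \<Rightarrow> ('c, 'd, 'q) module_scheme \<Rightarrow> nat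
    \<Rightarrow> ('b \<Rightarrow> 'c) \<Rightarrow> ('a \<Rightarrow> 'd) \<Rightarrow> ((nat \<Rightarrow> 'a) \<Rightarrow> 'b) set set \<Rightarrow> ((nat \<Rightarrow> 'd) \<Rightarrow> 'c) set set"
  where "sn_map B B' A' n g f =
    quot_lift (\<lambda>u. sn_class B' A' n
      (quot_lift (lin_ext B (tensor_power B' A' n) g (\<lambda>t. power_pure B' A' n (\<lambda>i\<in>{1..n}. f (t i)))) u))"

text \<open>
  The canonical map \<open>G(A/B) \<otimes>\<^sub>B C \<rightarrow> G((A \<otimes>\<^sub>B C)/C)\<close>, \<open>x \<otimes> c \<mapsto> c \<theta>(x)\<close>, where
  \<open>\<theta>(a\<^sub>1 \<otimes> \<dots> \<otimes> a\<^sub>n) = (a\<^sub>1 \<otimes> 1) \<otimes> \<dots> \<otimes> (a\<^sub>n \<otimes> 1)\<close>.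
\<close>

definition sn_base_change_map ::
  "('b, 'k) ring_scheme \<Rightarrow> ('b, 'a, 'p) module_scheme \<Rightarrow> nat \<Rightarrow> ('b, 'c, 'q) module_scheme
    \<Rightarrow> (((nat \<Rightarrow> 'a) \<Rightarrow> 'b) set set \<times> 'c \<Rightarrow> 'b) set
    \<Rightarrow> ((nat \<Rightarrow> ('a \<times> 'c \<Rightarrow> 'b) set) \<Rightarrow> 'c) set set"
  where "sn_base_change_map B A n C = (let
      AC = base_change B A C;
      G' = sn_closure C AC n;
      \<eta> = (\<lambda>b. b \<odot>\<^bsub>C\<^esub> \<one>\<^bsub>C\<^esub>);
      \<theta> = sn_map B C AC n \<eta> (\<lambda>a. tensor_pure B A C a \<one>\<^bsub>C\<^esub>)
    in quot_lift (lin_ext B G' \<eta> (\<lambda>(x, c). c \<odot>\<^bsub>G'\<^esub> \<theta> x)))"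

end

theory Submission
  imports Defs
begin

text \<open>
  Both sides represent the same problem. A homomorphism out of \<open>G(A/B)\<close>, semilinear over
  some \<open>g : B \<rightarrow> B'\<close>, is the same thing as \<open>n\<close> homomorphisms \<open>\<phi>\<^sub>1, \<dots>, \<phi>\<^sub>n\<close> out of \<open>A\<close>, semilinear
  over \<open>g\<close>, that are ``the roots of the characteristic polynomials'':
  \<open>g(s\<^sub>j(a))\<close> is the \<open>j\<close>-th elementary symmetric function of \<open>\<phi>\<^sub>1(a), \<dots>, \<phi>\<^sub>n(a)\<close> for all \<open>a\<close>.
  Existence is \<open>tensor_pow.lift_homs\<close> followed by \<open>Sn_closure.sn_lift\<close>, uniqueness is
  \<open>Sn_closure.Gal_hom_eqI\<close>. Write \<open>E = A \<otimes> C\<close>. The canonical map \<open>\<Phi> : G(A/B) \<otimes> C \<rightarrow> G(E/C)\<close> comes from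
  the roots \<open>a \<mapsto> (a \<otimes> 1)\<^sup>(\<^sup>i\<^sup>)\<close>. Its inverse must come from the roots \<open>\<phi>\<^sub>i : E \<rightarrow> G(A/B) \<otimes> C\<close>,
  \<open>a \<otimes> c \<mapsto> a\<^sup>(\<^sup>i\<^sup>) \<otimes> c\<close>. Once these are known to be admissible, the two composites and the two sides of
  the naturality square are compared on generators.

  The point is the admissibility. The relation between \<open>s\<^sub>j\<close> and the \<open>\<phi>\<^sub>i\<close> is known for the elements
  \<open>a \<otimes> 1\<close>, which only span \<open>E\<close> over \<open>C\<close>, and it is not additive in \<open>\<alpha> \<in> E\<close>; it is wanted for every
  \<open>\<alpha>\<close> (\<open>char_relations_if_spanning\<close>). The relations for \<open>\<alpha>\<close> and \<open>1 \<le> j \<le> n\<close> together say that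
  \<open>det(1 - x\<alpha>) = \<Prod>\<^sub>i (1 - x \<phi>\<^sub>i(\<alpha>))\<close>. So consider the two functions \<open>u \<mapsto> det u\<close> and
  \<open>u \<mapsto> \<Prod>\<^sub>i \<phi>\<^sub>i(u)\<close> on the polynomials \<open>u \<in> E[x]\<close> with constant term \<open>1\<close>. Both are multiplicative, and
  they agree on \<open>1 - c x\<^sup>k s\<close> with \<open>c \<in> C\<close> and \<open>s = a \<otimes> 1\<close>, because there both are obtained from the
  relations for \<open>s\<close> by substituting \<open>c x\<^sup>k\<close> for \<open>x\<close>. A polynomial \<open>u = 1 + \<alpha> x\<^sup>k + \<dots>\<close> whose
  coefficient \<open>\<alpha>\<close> is a sum of terms \<open>c s\<close> becomes \<open>1\<close> modulo \<open>x\<^sup>k\<^sup>+\<^sup>1\<close> after multiplication by the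
  corresponding factors \<open>1 - c x\<^sup>k s\<close>. Iterating, every \<open>u\<close> becomes \<open>1\<close> modulo any given power of \<open>x\<close>
  after multiplication by such factors, which can be cancelled afterwards; hence the two functions
  agree everywhere.

  Two facts about characteristic polynomials are used throughout. They do not depend on the basis, which
  follows from the multiplicativity of determinants, and they are compatible with a change of scalars that maps a
  basis to a basis (\<open>char_coeff_semilinear\<close>). The latter applies to \<open>A \<rightarrow> E\<close> because the elements
  \<open>e\<^sub>i \<otimes> 1\<close> form a basis of \<open>E\<close> (\<open>tensor_pair.E_basis\<close>).
\<close>

text \<open>Indices run over \<open>{1..n}\<close>; the lower bound is to remain \<open>1\<close> instead of becoming \<open>Suc 0\<close>.\<close>

declare One_nat_def [simp del]

section \<open>Finite sums and products\<close>

lemma (in comm_monoid) finprod_swap: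
  assumes "finite A" "finite B" "\<And>a b. a \<in> A \<Longrightarrow> b \<in> B \<Longrightarrow> f a b \<in> carrier G"
  shows "(\<Otimes>a\<in>A. \<Otimes>b\<in>B. f a b) = (\<Otimes>b\<in>B. \<Otimes>a\<in>A. f a b)"
  using assms(1,3)
proof (induction A rule: finite_induct)
  case (insert x F)
  have "(\<Otimes>b\<in>B. \<Otimes>a\<in>insert x F. f a b) = (\<Otimes>b\<in>B. f x b \<otimes> (\<Otimes>a\<in>F. f a b))"
    using insert by (intro finprod_cong') (auto simp: Pi_def)
  also have "\<dots> = (\<Otimes>b\<in>B. f x b) \<otimes> (\<Otimes>b\<in>B. \<Otimes>a\<in>F. f a b)"
    using insert assms by (intro finprod_multf) (auto simp: Pi_def)
  finally show ?case using insert by (simp add: Pi_def)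
qed simp

lemma (in comm_monoid) finprod_Times:
  assumes "finite A" "finite B" "\<And>a b. a \<in> A \<Longrightarrow> b \<in> B \<Longrightarrow> f a b \<in> carrier G"
  shows "(\<Otimes>p\<in>A \<times> B. f (fst p) (snd p)) = (\<Otimes>a\<in>A. \<Otimes>b\<in>B. f a b)"
  using assms(1,3)
proof (induction A rule: finite_induct)
  case (insert x F)
  have e: "insert x F \<times> B = Pair x ` B \<union> F \<times> B" by auto
  have "(\<Otimes>p\<in>insert x F \<times> B. f (fst p) (snd p))
    = (\<Otimes>p\<in>Pair x ` B. f (fst p) (snd p)) \<otimes> (\<Otimes>p\<in>F \<times> B. f (fst p) (snd p))"
    unfolding e using insert assms(2) by (intro finprod_Un_disjoint) (auto simp: Pi_def)
  also have "(\<Otimes>p\<in>Pair x ` B. f (fst p) (snd p)) = (\<Otimes>b\<in>B. f x b)"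
    using insert by (subst finprod_reindex) (auto simp: Pi_def inj_on_def)
  finally show ?case using insert by (simp add: Pi_def)
qed simp

text \<open>
  Expanding a product of sums: choose a summand in every factor. A choice on \<open>insert x F\<close> is a choice at
  \<open>x\<close> together with a choice on \<open>F\<close>.
\<close>

lemma (in cring) finprod_finsum_distrib:
  assumes "finite S" "finite T" "\<And>i k. i \<in> S \<Longrightarrow> k \<in> T \<Longrightarrow> f i k \<in> carrier R"
  shows "(\<Otimes>i\<in>S. \<Oplus>k\<in>T. f i k) = (\<Oplus>\<kappa>\<in>S \<rightarrow>\<^sub>E T. \<Otimes>i\<in>S. f i (\<kappa> i))"
  using assms(1,3)
proof (induction S rule: finite_induct)
  case empty
  then show ?case by (simp add: PiE_empty_domain)
next
  case (insert x F)
  let ?h = "\<lambda>(y, g). g(x := y)"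
  let ?P = "F \<rightarrow>\<^sub>E T"
  have fin: "finite ?P" using insert assms(2) by (simp add: finite_PiE)
  have c: "(\<Otimes>i\<in>F. f i (\<kappa> i)) \<in> carrier R" if "\<kappa> \<in> ?P" for \<kappa>
    using that insert by (intro finprod_closed) (auto simp: PiE_iff)
  have c': "(\<Otimes>i\<in>insert x F. f i (\<kappa> i)) \<in> carrier R" if "\<kappa> \<in> insert x F \<rightarrow>\<^sub>E T" for \<kappa>
    using that insert by (intro finprod_closed) (auto simp: PiE_iff)
  have im: "insert x F \<rightarrow>\<^sub>E T = ?h ` (T \<times> ?P)" by (rule PiE_insert_eq)
  have inj: "inj_on ?h (T \<times> ?P)" using inj_combinator[OF \<open>x \<notin> F\<close>, of "\<lambda>_. T"] by simp
  have "(\<Oplus>\<kappa>\<in>insert x F \<rightarrow>\<^sub>E T. \<Otimes>i\<in>insert x F. f i (\<kappa> i))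
     = (\<Oplus>p\<in>T \<times> ?P. \<Otimes>i\<in>insert x F. f i (?h p i))"
    unfolding im by (rule finsum_reindex[OF _ inj]) (auto simp: im[symmetric] c' Pi_def)
  also have "\<dots> = (\<Oplus>p\<in>T \<times> ?P. f x (fst p) \<otimes> (\<Otimes>i\<in>F. f i (snd p i)))"
  proof (rule finsum_cong')
    show "(\<lambda>p. f x (fst p) \<otimes> (\<Otimes>i\<in>F. f i (snd p i))) \<in> T \<times> ?P \<rightarrow> carrier R"
      using insert c by auto
    fix p assume p: "p \<in> T \<times> ?P"
    then obtain y g where [simp]: "p = (y, g)" and y: "y \<in> T" "g \<in> ?P" by auto
    have "(\<Otimes>i\<in>insert x F. f i (?h p i)) = f x y \<otimes> (\<Otimes>i\<in>F. f i ((g(x := y)) i))"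
      using insert y by (subst finprod_insert) (auto simp: PiE_iff)
    also have "(\<Otimes>i\<in>F. f i ((g(x := y)) i)) = (\<Otimes>i\<in>F. f i (g i))"
      using insert y by (intro finprod_cong') (auto simp: PiE_iff)
    finally show "(\<Otimes>i\<in>insert x F. f i (?h p i)) = f x (fst p) \<otimes> (\<Otimes>i\<in>F. f i (snd p i))" by simp
  qed simp
  also have "\<dots> = (\<Oplus>y\<in>T. \<Oplus>g\<in>?P. f x y \<otimes> (\<Otimes>i\<in>F. f i (g i)))"
    using insert assms(2) fin c by (intro add.finprod_Times) auto
  also have "\<dots> = (\<Oplus>y\<in>T. f x y \<otimes> (\<Oplus>g\<in>?P. \<Otimes>i\<in>F. f i (g i)))"
    using insert fin c by (intro finsum_cong' finsum_rdistr[symmetric]) (auto simp: Pi_def)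
  also have "\<dots> = (\<Oplus>y\<in>T. f x y) \<otimes> (\<Oplus>g\<in>?P. \<Otimes>i\<in>F. f i (g i))"
    using insert assms(2) fin c by (intro finsum_ldistr[symmetric]) (auto simp: Pi_def)
  also have "\<dots> = (\<Otimes>i\<in>insert x F. \<Oplus>k\<in>T. f i k)"
    using insert by (subst finprod_insert) (auto simp: Pi_def)
  finally show ?case ..
qed

section \<open>Determinants\<close>

definition perm_sign :: "('r, 'k) ring_scheme \<Rightarrow> (nat \<Rightarrow> nat) \<Rightarrow> 'r"
  where "perm_sign R p = (if evenperm p then \<one>\<^bsub>R\<^esub> else \<ominus>\<^bsub>R\<^esub> \<one>\<^bsub>R\<^esub>)"

context cring
begin

lemma perm_sign_closed [simp]: "perm_sign R p \<in> carrier R"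
  by (simp add: perm_sign_def)

lemma perm_sign_comp:
  assumes "p permutes {1..n}" "q permutes {1..n}"
  shows "perm_sign R (p \<circ> q) = perm_sign R p \<otimes> perm_sign R q"
proof -
  have "permutation p" "permutation q" using assms by (auto simp: permutation_permutes)
  then show ?thesis by (simp add: perm_sign_def evenperm_comp l_minus r_minus)
qed

lemma det_term_closed:
  assumes "\<And>i j. i \<in> {1..n} \<Longrightarrow> j \<in> {1..n} \<Longrightarrow> M i j \<in> carrier R" "p permutes {1..n}"
  shows "(\<Otimes>i\<in>{1..n}. M i (p i)) \<in> carrier R"
  using assms by (intro finprod_closed) (auto simp: permutes_in_image simp del: atLeastAtMost_iff)

lemma ring_det_eq_perm_sign:
  assumes "\<And>i j. i \<in> {1..n} \<Longrightarrow> j \<in> {1..n} \<Longrightarrow> M i j \<in> carrier R"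
  shows "ring_det R n M
    = (\<Oplus>p\<in>{p. p permutes {1..n}}. perm_sign R p \<otimes> (\<Otimes>i\<in>{1..n}. M i (p i)))"
  unfolding ring_det_def
  using det_term_closed[of n M, OF assms]
  by (intro finsum_cong') (auto simp: perm_sign_def l_minus)

lemma ring_det_closed:
  assumes "\<And>i j. i \<in> {1..n} \<Longrightarrow> j \<in> {1..n} \<Longrightarrow> M i j \<in> carrier R"
  shows "ring_det R n M \<in> carrier R"
  using det_term_closed[of n M, OF assms]
  by (subst ring_det_eq_perm_sign[OF assms]) (auto intro!: finsum_closed)

lemma ring_det_cong:
  assumes "\<And>i j. i \<in> {1..n} \<Longrightarrow> j \<in> {1..n} \<Longrightarrow> M i j = M' i j"
    and "\<And>i j. i \<in> {1..n} \<Longrightarrow> j \<in> {1..n} \<Longrightarrow> M' i j \<in> carrier R"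
  shows "ring_det R n M = ring_det R n M'"
proof -
  have "(\<Otimes>i\<in>{1..n}. M i (p i)) = (\<Otimes>i\<in>{1..n}. M' i (p i))" if "p permutes {1..n}" for p
    using assms permutes_in_image[OF that] by (intro finprod_cong') auto
  with det_term_closed[of n M', OF assms(2)] show ?thesis
    unfolding ring_det_def by (intro finsum_cong') auto
qed

lemma ring_det_permute_rows:
  assumes M: "\<And>i j. i \<in> {1..n} \<Longrightarrow> j \<in> {1..n} \<Longrightarrow> M i j \<in> carrier R" and q: "q permutes {1..n}"
  shows "ring_det R n (\<lambda>i. M (q i)) = perm_sign R q \<otimes> ring_det R n M"
proof -
  let ?P = "{p. p permutes {1..n}}"
  have qi: "q i \<in> {1..n} \<longleftrightarrow> i \<in> {1..n}" for i using q by (rule permutes_in_image)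
  have fin: "finite ?P" by (simp add: finite_permutations)
  have im: "(\<lambda>p. p \<circ> q) ` ?P = ?P"
    using image_compose_permutations_right[OF q] by (auto simp: image_def)
  have inj: "inj_on (\<lambda>p. p \<circ> q) ?P"
    using permutes_surj[OF q] by (auto simp: inj_on_def fun_eq_iff) (metis surj_def)
  have c: "(\<Otimes>i\<in>{1..n}. M i (p i)) \<in> carrier R" if "p \<in> ?P" for p
    using det_term_closed[of n M, OF M] that by auto
  have c': "(\<Otimes>i\<in>{1..n}. M (q i) (p i)) \<in> carrier R" if "p \<in> ?P" for p
    using det_term_closed[of n "\<lambda>i. M (q i)"] M that qi by auto
  have prod: "(\<Otimes>i\<in>{1..n}. M (q i) ((p \<circ> q) i)) = (\<Otimes>i\<in>{1..n}. M i (p i))" if "p \<in> ?P" for p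
  proof -
    have "(\<Otimes>i\<in>q ` {1..n}. M i (p i)) = (\<Otimes>i\<in>{1..n}. M (q i) (p (q i)))"
      using that M permutes_inj_on[OF q] permutes_image[OF q]
      by (intro finprod_reindex) (auto simp: permutes_in_image[of p] simp del: atLeastAtMost_iff)
    then show ?thesis by (simp add: permutes_image[OF q])
  qed
  have "ring_det R n (\<lambda>i. M (q i))
    = (\<Oplus>p\<in>(\<lambda>p. p \<circ> q) ` ?P. perm_sign R p \<otimes> (\<Otimes>i\<in>{1..n}. M (q i) (p i)))"
    unfolding im using M qi by (intro ring_det_eq_perm_sign) auto
  also have "\<dots> = (\<Oplus>p\<in>?P. perm_sign R (p \<circ> q) \<otimes> (\<Otimes>i\<in>{1..n}. M (q i) ((p \<circ> q) i)))"
    using c' inj by (intro finsum_reindex) (auto simp: im)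
  also have "\<dots> = (\<Oplus>p\<in>?P. perm_sign R q \<otimes> (perm_sign R p \<otimes> (\<Otimes>i\<in>{1..n}. M i (p i))))"
  proof (rule finsum_cong')
    fix p assume p: "p \<in> ?P"
    have "perm_sign R (p \<circ> q) = perm_sign R p \<otimes> perm_sign R q"
      using p by (intro perm_sign_comp[OF _ q]) simp
    then show "perm_sign R (p \<circ> q) \<otimes> (\<Otimes>i\<in>{1..n}. M (q i) ((p \<circ> q) i))
      = perm_sign R q \<otimes> (perm_sign R p \<otimes> (\<Otimes>i\<in>{1..n}. M i (p i)))"
      unfolding prod[OF p] using c[OF p] by (simp add: m_ac)
  qed (use c in auto)
  also have "\<dots> = perm_sign R q \<otimes> ring_det R n M"
    using c fin ring_det_eq_perm_sign[of n M] M by (simp add: finsum_rdistr Pi_def)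
  finally show ?thesis .
qed

text \<open>
  The terms of \<open>p\<close> and of \<open>p\<close> composed with the transposition of the two equal rows cancel. Pairing the
  terms avoids division by \<open>2\<close>, so that the lemma holds in every characteristic.
\<close>

lemma ring_det_equal_rows:
  assumes M: "\<And>i j. i \<in> {1..n} \<Longrightarrow> j \<in> {1..n} \<Longrightarrow> M i j \<in> carrier R"
    and ab: "a \<in> {1..n}" "b \<in> {1..n}" "a \<noteq> b" "\<And>j. j \<in> {1..n} \<Longrightarrow> M a j = M b j"
  shows "ring_det R n M = \<zero>"
proof -
  let ?P = "{p. p permutes {1..n}}"
  let ?E = "{p. p permutes {1..n} \<and> evenperm p}"
  let ?\<tau> = "transpose a b"
  let ?O = "(\<lambda>p. p \<circ> ?\<tau>) ` ?E"
  let ?t = "\<lambda>p. \<Otimes>i\<in>{1..n}. M i (p i)"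
  have \<tau>: "?\<tau> permutes {1..n}" using ab by (intro permutes_swap_id)
  have ev: "evenperm (p \<circ> ?\<tau>) \<longleftrightarrow> \<not> evenperm p" if "p permutes {1..n}" for p
    using that \<tau> ab by (subst evenperm_comp) (auto simp: permutation_permutes evenperm_swap)
  have c: "?t p \<in> carrier R" if "p permutes {1..n}" for p
    using det_term_closed[of n M p, OF M] that by auto
  have t\<tau>: "?t (p \<circ> ?\<tau>) = ?t p" if p: "p permutes {1..n}" for p
  proof -
    have pi: "p i \<in> {1..n} \<longleftrightarrow> i \<in> {1..n}" for i using p by (rule permutes_in_image)
    have "(\<Otimes>i\<in>?\<tau> ` {1..n}. M i (p i)) = (\<Otimes>i\<in>{1..n}. M (?\<tau> i) (p (?\<tau> i)))"
      using M permutes_inj_on[OF \<tau>] permutes_image[OF \<tau>] pi by (intro finprod_reindex) auto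
    also have "\<dots> = (\<Otimes>i\<in>{1..n}. M i (p (?\<tau> i)))"
      using M pi permutes_in_image[OF \<tau>] ab by (intro finprod_cong') (auto simp: transpose_def)
    finally show ?thesis unfolding permutes_image[OF \<tau>] by simp
  qed
  have split: "?P = ?E \<union> ?O"
  proof
    show "?P \<subseteq> ?E \<union> ?O"
    proof
      fix p assume p: "p \<in> ?P"
      have "p = (p \<circ> ?\<tau>) \<circ> ?\<tau>" by (simp add: fun_eq_iff)
      moreover have "p \<circ> ?\<tau> permutes {1..n}" using p \<tau> by (simp add: permutes_compose)
      ultimately show "p \<in> ?E \<union> ?O"
        using p ev[of p] by (cases "evenperm p") (blast, metis (mono_tags, lifting) UnI2 image_eqI mem_Collect_eq)
    qed
    show "?E \<union> ?O \<subseteq> ?P" using \<tau> by (auto simp: permutes_compose)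
  qed
  have inv: "(p \<circ> ?\<tau>) \<circ> ?\<tau> = p" for p :: "nat \<Rightarrow> nat" by (simp add: fun_eq_iff)
  have inj: "inj_on (\<lambda>p. p \<circ> ?\<tau>) ?E" by (rule inj_on_inverseI) (rule inv)
  have fin: "finite ?E" by (rule finite_subset[OF _ finite_permutations[of "{1..n}"]]) auto
  have cO: "?t p \<in> carrier R" if "p \<in> ?O" for p using that c split by auto
  have "ring_det R n M = (\<Oplus>p\<in>?E \<union> ?O. if evenperm p then ?t p else \<ominus> ?t p)"
    unfolding ring_det_def split ..
  also have "\<dots> = (\<Oplus>p\<in>?E. if evenperm p then ?t p else \<ominus> ?t p) \<oplus> (\<Oplus>p\<in>?O. if evenperm p then ?t p else \<ominus> ?t p)"
    using fin c cO ev by (intro finsum_Un_disjoint) auto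
  also have "(\<Oplus>p\<in>?E. if evenperm p then ?t p else \<ominus> ?t p) = (\<Oplus>p\<in>?E. ?t p)"
    using c by (intro finsum_cong') auto
  also have "(\<Oplus>p\<in>?O. if evenperm p then ?t p else \<ominus> ?t p)
    = (\<Oplus>p\<in>?E. if evenperm (p \<circ> ?\<tau>) then ?t (p \<circ> ?\<tau>) else \<ominus> ?t (p \<circ> ?\<tau>))"
    using inj cO by (intro finsum_reindex) auto
  also have "\<dots> = (\<Oplus>p\<in>?E. \<ominus> ?t p)"
    using c ev t\<tau> by (intro finsum_cong') auto
  also have "(\<Oplus>p\<in>?E. ?t p) \<oplus> (\<Oplus>p\<in>?E. \<ominus> ?t p) = (\<Oplus>p\<in>?E. ?t p \<oplus> \<ominus> ?t p)"
    using c by (intro finsum_addf[symmetric]) auto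
  also have "\<dots> = \<zero>" using c by (intro add.finprod_one_eqI) (auto simp: r_neg)
  finally show ?thesis .
qed

text \<open>
  Expanding the entries of the product by all maps \<open>\<kappa>\<close> from rows to rows leaves the determinants of \<open>N\<close>
  with rows \<open>N (\<kappa> i)\<close>. These vanish unless \<open>\<kappa>\<close> is injective, i.e. the restriction of a permutation,
  and then they are \<open>\<plusminus> det N\<close>.
\<close>

lemma ring_det_mult:
  assumes M: "\<And>i j. i \<in> {1..n} \<Longrightarrow> j \<in> {1..n} \<Longrightarrow> M i j \<in> carrier R"
    and N: "\<And>i j. i \<in> {1..n} \<Longrightarrow> j \<in> {1..n} \<Longrightarrow> N i j \<in> carrier R"
  shows "ring_det R n (\<lambda>i j. \<Oplus>k\<in>{1..n}. M i k \<otimes> N k j) = ring_det R n M \<otimes> ring_det R n N"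
proof -
  let ?I = "{1..n}" let ?P = "{p. p permutes ?I}" let ?F = "?I \<rightarrow>\<^sub>E ?I"
  have finF: "finite ?F" by (simp add: finite_PiE)
  have finP: "finite ?P" by (simp add: finite_permutations)
  have mc: "(\<Otimes>i\<in>?I. M i (\<kappa> i)) \<in> carrier R" if "\<kappa> \<in> ?F" for \<kappa>
    using that M by (intro finprod_closed) (auto simp: PiE_iff)
  have nc: "(\<Otimes>i\<in>?I. N (\<kappa> i) (p i)) \<in> carrier R" if "\<kappa> \<in> ?F" "p permutes ?I" for \<kappa> p
    using that N permutes_in_image[OF that(2)] by (intro finprod_closed) (auto simp: PiE_iff)
  have dc: "ring_det R n (\<lambda>i. N (\<kappa> i)) \<in> carrier R" if "\<kappa> \<in> ?F" for \<kappa>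
    using that N by (intro ring_det_closed) (auto simp: PiE_iff)
  have "ring_det R n (\<lambda>i j. \<Oplus>k\<in>?I. M i k \<otimes> N k j)
    = (\<Oplus>p\<in>?P. perm_sign R p \<otimes> (\<Otimes>i\<in>?I. \<Oplus>k\<in>?I. M i k \<otimes> N k (p i)))"
    using M N by (intro ring_det_eq_perm_sign) (auto intro!: finsum_closed)
  also have "\<dots> = (\<Oplus>p\<in>?P. \<Oplus>\<kappa>\<in>?F. (\<Otimes>i\<in>?I. M i (\<kappa> i)) \<otimes> (perm_sign R p \<otimes> (\<Otimes>i\<in>?I. N (\<kappa> i) (p i))))"
  proof (rule finsum_cong')
    fix p assume "p \<in> ?P"
    then have p: "p permutes ?I" by simp
    have "(\<Otimes>i\<in>?I. \<Oplus>k\<in>?I. M i k \<otimes> N k (p i)) = (\<Oplus>\<kappa>\<in>?F. \<Otimes>i\<in>?I. M i (\<kappa> i) \<otimes> N (\<kappa> i) (p i))"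
      using M N permutes_in_image[OF p] by (intro finprod_finsum_distrib) auto
    also have "\<dots> = (\<Oplus>\<kappa>\<in>?F. (\<Otimes>i\<in>?I. M i (\<kappa> i)) \<otimes> (\<Otimes>i\<in>?I. N (\<kappa> i) (p i)))"
    proof (rule finsum_cong')
      fix \<kappa> assume k: "\<kappa> \<in> ?F"
      show "(\<Otimes>i\<in>?I. M i (\<kappa> i) \<otimes> N (\<kappa> i) (p i)) = (\<Otimes>i\<in>?I. M i (\<kappa> i)) \<otimes> (\<Otimes>i\<in>?I. N (\<kappa> i) (p i))"
        using M N k permutes_in_image[OF p] by (intro finprod_multf) (auto simp: PiE_iff)
    qed (use mc nc p in auto)
    finally have "perm_sign R p \<otimes> (\<Otimes>i\<in>?I. \<Oplus>k\<in>?I. M i k \<otimes> N k (p i))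
      = (\<Oplus>\<kappa>\<in>?F. perm_sign R p \<otimes> ((\<Otimes>i\<in>?I. M i (\<kappa> i)) \<otimes> (\<Otimes>i\<in>?I. N (\<kappa> i) (p i))))"
      using mc nc p finF by (simp add: finsum_rdistr Pi_def)
    also have "\<dots> = (\<Oplus>\<kappa>\<in>?F. (\<Otimes>i\<in>?I. M i (\<kappa> i)) \<otimes> (perm_sign R p \<otimes> (\<Otimes>i\<in>?I. N (\<kappa> i) (p i))))"
      using mc nc p by (intro finsum_cong') (auto simp: m_lcomm)
    finally show "perm_sign R p \<otimes> (\<Otimes>i\<in>?I. \<Oplus>k\<in>?I. M i k \<otimes> N k (p i))
      = (\<Oplus>\<kappa>\<in>?F. (\<Otimes>i\<in>?I. M i (\<kappa> i)) \<otimes> (perm_sign R p \<otimes> (\<Otimes>i\<in>?I. N (\<kappa> i) (p i))))" .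
  qed (use mc nc in \<open>auto intro!: finsum_closed\<close>)
  also have "\<dots> = (\<Oplus>\<kappa>\<in>?F. \<Oplus>p\<in>?P. (\<Otimes>i\<in>?I. M i (\<kappa> i)) \<otimes> (perm_sign R p \<otimes> (\<Otimes>i\<in>?I. N (\<kappa> i) (p i))))"
    using mc nc finF finP by (intro add.finprod_swap) auto
  also have "\<dots> = (\<Oplus>\<kappa>\<in>?F. (\<Otimes>i\<in>?I. M i (\<kappa> i)) \<otimes> ring_det R n (\<lambda>i. N (\<kappa> i)))"
  proof (rule finsum_cong')
    fix \<kappa> assume k: "\<kappa> \<in> ?F"
    have "ring_det R n (\<lambda>i. N (\<kappa> i)) = (\<Oplus>p\<in>?P. perm_sign R p \<otimes> (\<Otimes>i\<in>?I. N (\<kappa> i) (p i)))"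
      using k N by (intro ring_det_eq_perm_sign) (auto simp: PiE_iff)
    then show "(\<Oplus>p\<in>?P. (\<Otimes>i\<in>?I. M i (\<kappa> i)) \<otimes> (perm_sign R p \<otimes> (\<Otimes>i\<in>?I. N (\<kappa> i) (p i))))
      = (\<Otimes>i\<in>?I. M i (\<kappa> i)) \<otimes> ring_det R n (\<lambda>i. N (\<kappa> i))"
      using k mc nc finP by (simp add: finsum_rdistr Pi_def)
  qed (use mc dc in auto)
  also have "\<dots> = (\<Oplus>\<kappa>\<in>(\<lambda>q. restrict q ?I) ` ?P. (\<Otimes>i\<in>?I. M i (\<kappa> i)) \<otimes> ring_det R n (\<lambda>i. N (\<kappa> i)))"
  proof (rule add.finprod_mono_neutral_cong_right)
    show "(\<lambda>q. restrict q ?I) ` ?P \<subseteq> ?F"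
      using permutes_in_image by (fastforce simp: PiE_iff)
    fix \<kappa> assume k: "\<kappa> \<in> ?F - (\<lambda>q. restrict q ?I) ` ?P"
    have "\<not> inj_on \<kappa> ?I"
    proof
      assume inj: "inj_on \<kappa> ?I"
      let ?q = "\<lambda>i. if i \<in> ?I then \<kappa> i else i"
      have "\<kappa> ` ?I \<subseteq> ?I" using k by auto
      then have "bij_betw \<kappa> ?I ?I" using inj by (simp add: bij_betw_def endo_inj_surj)
      then have "bij_betw ?q ?I ?I" by (rule bij_betw_cong[THEN iffD1, rotated]) simp
      then have "?q permutes ?I" by (rule bij_imp_permutes) auto
      moreover have "\<kappa> = restrict ?q ?I" using k by (auto simp: fun_eq_iff PiE_def extensional_def)
      ultimately show False using k by blast
    qed
    then obtain a b where ab: "a \<in> ?I" "b \<in> ?I" "a \<noteq> b" "\<kappa> a = \<kappa> b" by (auto simp: inj_on_def)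
    then have "ring_det R n (\<lambda>i. N (\<kappa> i)) = \<zero>"
      using k N by (intro ring_det_equal_rows[of n _ a b]) (auto simp: PiE_iff)
    then show "(\<Otimes>i\<in>?I. M i (\<kappa> i)) \<otimes> ring_det R n (\<lambda>i. N (\<kappa> i)) = \<zero>" using k mc by simp
  qed (use finF mc dc in auto)
  also have "\<dots> = (\<Oplus>q\<in>?P. (\<Otimes>i\<in>?I. M i (restrict q ?I i)) \<otimes> ring_det R n (\<lambda>i. N (restrict q ?I i)))"
  proof (rule finsum_reindex)
    show "(\<lambda>\<kappa>. (\<Otimes>i\<in>?I. M i (\<kappa> i)) \<otimes> ring_det R n (\<lambda>i. N (\<kappa> i))) \<in> (\<lambda>q. restrict q ?I) ` ?P \<rightarrow> carrier R"
    proof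
      fix \<kappa> assume "\<kappa> \<in> (\<lambda>q. restrict q ?I) ` ?P"
      then have "\<kappa> \<in> ?F" using permutes_in_image by (fastforce simp: PiE_iff)
      then show "(\<Otimes>i\<in>?I. M i (\<kappa> i)) \<otimes> ring_det R n (\<lambda>i. N (\<kappa> i)) \<in> carrier R" using mc dc by auto
    qed
    show "inj_on (\<lambda>q. restrict q ?I) ?P"
    proof (rule inj_onI)
      fix p q assume p: "p \<in> ?P" "q \<in> ?P" and e: "restrict p ?I = restrict q ?I"
      show "p = q"
      proof
        fix x
        show "p x = q x"
        proof (cases "x \<in> ?I")
          case True then show ?thesis using fun_cong[OF e, of x] by simp
        next
          case False then show ?thesis using p by (simp add: permutes_def del: atLeastAtMost_iff)
        qed
      qed
    qed
  qed
  also have "\<dots> = (\<Oplus>q\<in>?P. (perm_sign R q \<otimes> (\<Otimes>i\<in>?I. M i (q i))) \<otimes> ring_det R n N)"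
  proof (rule finsum_cong')
    fix q assume "q \<in> ?P"
    then have q: "q permutes ?I" by simp
    have 1: "(\<Otimes>i\<in>?I. M i (restrict q ?I i)) = (\<Otimes>i\<in>?I. M i (q i))"
      using M permutes_in_image[OF q] by (intro finprod_cong') auto
    have "ring_det R n (\<lambda>i. N (restrict q ?I i)) = ring_det R n (\<lambda>i. N (q i))"
      using N permutes_in_image[OF q] by (intro ring_det_cong) auto
    also have "\<dots> = perm_sign R q \<otimes> ring_det R n N" using N q by (rule ring_det_permute_rows)
    finally show "(\<Otimes>i\<in>?I. M i (restrict q ?I i)) \<otimes> ring_det R n (\<lambda>i. N (restrict q ?I i))
      = (perm_sign R q \<otimes> (\<Otimes>i\<in>?I. M i (q i))) \<otimes> ring_det R n N"
      unfolding 1 using det_term_closed[of n M q, OF M q] ring_det_closed[of n N, OF N]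
      by (simp add: m_ac)
  qed (use det_term_closed[of n M, OF M] ring_det_closed[of n N, OF N] in auto)
  also have "\<dots> = ring_det R n M \<otimes> ring_det R n N"
    using det_term_closed[of n M, OF M] ring_det_closed[of n N, OF N] finP
      ring_det_eq_perm_sign[of n M] M
    by (simp add: finsum_ldistr Pi_def)
  finally show ?thesis .
qed

lemma ring_det_one:
  "ring_det R n (\<lambda>i j. if i = j then \<one> else \<zero>) = \<one>"
proof -
  let ?P = "{p. p permutes {1..n}}"
  let ?t = "\<lambda>p. \<Otimes>i\<in>{1..n}. if i = p i then \<one> else \<zero>"
  have c: "?t p \<in> carrier R" for p by (intro finprod_closed) auto
  have z: "?t p = \<zero>" if p: "p permutes {1..n}" "p \<noteq> id" for p
  proof -
    obtain a where a: "p a \<noteq> a" using p(2) by (auto simp: fun_eq_iff)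
    then have aI: "a \<in> {1..n}" using p(1) by (meson permutes_not_in)
    have "?t p = (\<Otimes>i\<in>insert a ({1..n} - {a}). if i = p i then \<one> else \<zero>)"
      using aI by (simp add: insert_absorb)
    also have "\<dots> = \<zero> \<otimes> (\<Otimes>i\<in>{1..n} - {a}. if i = p i then \<one> else \<zero>)"
      using a by (subst finprod_insert) auto
    finally show ?thesis by (simp add: finprod_closed)
  qed
  have "ring_det R n (\<lambda>i j. if i = j then \<one> else \<zero>) = (\<Oplus>p\<in>?P. perm_sign R p \<otimes> ?t p)"
    by (rule ring_det_eq_perm_sign) auto
  also have "\<dots> = (\<Oplus>p\<in>{id}. perm_sign R p \<otimes> ?t p)"
    using z c by (intro add.finprod_mono_neutral_cong_right) (auto simp: finite_permutations permutes_id)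
  also have "\<dots> = \<one>" by (simp add: perm_sign_def)
  finally show ?thesis .
qed

end

section \<open>Characteristic polynomials\<close>

lemma (in cring) finprod_one_plus:
  assumes "finite S" "\<And>i. i \<in> S \<Longrightarrow> u i \<in> carrier R"
  shows "(\<Otimes>i\<in>S. \<one> \<oplus> u i) = (\<Oplus>K\<in>Pow S. \<Otimes>i\<in>K. u i)"
  using assms
proof (induction S rule: finite_induct)
  case (insert x F)
  have c: "(\<Otimes>i\<in>K. u i) \<in> carrier R" if "K \<subseteq> insert x F" for K
    using that insert.prems by (intro finprod_closed) auto
  have inj: "inj_on (insert x) (Pow F)" using insert.hyps by (auto simp: inj_on_def)
  have "(\<Oplus>K\<in>Pow (insert x F). \<Otimes>i\<in>K. u i)
    = (\<Oplus>K\<in>Pow F. \<Otimes>i\<in>K. u i) \<oplus> (\<Oplus>K\<in>insert x ` Pow F. \<Otimes>i\<in>K. u i)"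
    unfolding Pow_insert using insert c by (intro finsum_Un_disjoint) (auto simp: subset_insertI2)
  also have "(\<Oplus>K\<in>insert x ` Pow F. \<Otimes>i\<in>K. u i) = (\<Oplus>K\<in>Pow F. \<Otimes>i\<in>insert x K. u i)"
    using inj by (intro finsum_reindex) (auto intro!: c)
  also have "\<dots> = (\<Oplus>K\<in>Pow F. u x \<otimes> (\<Otimes>i\<in>K. u i))"
  proof (rule finsum_cong')
    fix K assume K: "K \<in> Pow F"
    then have "finite K" "x \<notin> K" using insert.hyps finite_subset by auto
    with K insert.prems show "(\<Otimes>i\<in>insert x K. u i) = u x \<otimes> (\<Otimes>i\<in>K. u i)"
      by (intro finprod_insert) auto
  qed (use insert.prems in \<open>auto intro!: c\<close>)
  also have "\<dots> = u x \<otimes> (\<Oplus>K\<in>Pow F. \<Otimes>i\<in>K. u i)"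
    using insert by (intro finsum_rdistr[symmetric]) (auto intro!: c)
  finally have "(\<Oplus>K\<in>Pow (insert x F). \<Otimes>i\<in>K. u i)
    = (\<Oplus>K\<in>Pow F. \<Otimes>i\<in>K. u i) \<oplus> u x \<otimes> (\<Oplus>K\<in>Pow F. \<Otimes>i\<in>K. u i)" .
  moreover have "(\<Oplus>K\<in>Pow F. \<Otimes>i\<in>K. u i) \<in> carrier R" using c by (intro finsum_closed) auto
  ultimately show ?case
    using insert by (simp add: Pi_def l_distr)
qed simp

definition elem_sym :: "('r, 'k) ring_scheme \<Rightarrow> nat \<Rightarrow> (nat \<Rightarrow> 'r) \<Rightarrow> nat \<Rightarrow> 'r"
  where "elem_sym R n v j = (\<Oplus>\<^bsub>R\<^esub>K\<in>{K. K \<subseteq> {1..n} \<and> card K = j}. \<Otimes>\<^bsub>R\<^esub>i\<in>K. v i)"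

lemma (in cring) elem_sym_closed:
  assumes "\<And>i. i \<in> {1..n} \<Longrightarrow> v i \<in> carrier R"
  shows "elem_sym R n v j \<in> carrier R"
  unfolding elem_sym_def using assms by (intro finsum_closed) (auto intro!: finprod_closed)

lemma (in cring) elem_sym_0: "elem_sym R n v 0 = \<one>"
proof -
  have "{K. K \<subseteq> {1..n} \<and> card K = 0} = {{}}" by (auto dest: finite_subset)
  then show ?thesis by (simp add: elem_sym_def)
qed

lemma (in cring) elem_sym_cong:
  assumes "\<And>i. i \<in> {1..n} \<Longrightarrow> v i = w i" "\<And>i. i \<in> {1..n} \<Longrightarrow> w i \<in> carrier R"
  shows "elem_sym R n v j = elem_sym R n w j"
  unfolding elem_sym_def
proof (rule finsum_cong')
  show "finprod R w \<in> {K. K \<subseteq> {1..n} \<and> card K = j} \<rightarrow> carrier R"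
    using assms by (auto intro!: finprod_closed)
  fix K assume "K \<in> {K. K \<subseteq> {1..n} \<and> card K = j}"
  then show "finprod R v K = finprod R w K" using assms by (intro finprod_cong') blast+
qed simp

lemma (in ring_hom_cring) hom_elem_sym:
  assumes "\<And>i. i \<in> {1..n} \<Longrightarrow> v i \<in> carrier R"
  shows "h (elem_sym R n v j) = elem_sym S n (\<lambda>i. h (v i)) j"
proof -
  have c: "v \<in> K \<rightarrow> carrier R" if "K \<subseteq> {1..n}" for K using assms that by auto
  have "h (elem_sym R n v j) = (\<Oplus>\<^bsub>S\<^esub>K\<in>{K. K \<subseteq> {1..n} \<and> card K = j}. h (\<Otimes>i\<in>K. v i))"
    unfolding elem_sym_def using c by (subst hom_finsum) (auto intro!: R.finprod_closed simp: o_def)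
  also have "\<dots> = elem_sym S n (\<lambda>i. h (v i)) j"
    unfolding elem_sym_def
  proof (rule S.finsum_cong')
    fix K assume "K \<in> {K. K \<subseteq> {1..n} \<and> card K = j}"
    then show "h (\<Otimes>i\<in>K. v i) = (\<Otimes>\<^bsub>S\<^esub>i\<in>K. h (v i))" by (subst hom_finprod[OF c]) (auto simp: o_def)
  qed (use c in \<open>auto intro!: S.finprod_closed\<close>)
  finally show ?thesis .
qed

lemma (in cring) finprod_one_minus:
  assumes v: "\<And>i. i \<in> {1..n} \<Longrightarrow> v i \<in> carrier R" and y: "y \<in> carrier R"
  shows "(\<Otimes>i\<in>{1..n}. \<one> \<ominus> y \<otimes> v i) = (\<Oplus>j\<in>{..n}. elem_sym R n v j \<otimes> (\<ominus> y) [^] j)"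
proof -
  let ?C = "\<lambda>j. {K. K \<subseteq> {1..n} \<and> card K = j}"
  have c: "(\<Otimes>i\<in>K. v i) \<in> carrier R" if "K \<subseteq> {1..n}" for K
    using v that by (intro finprod_closed) auto
  have m: "(\<Otimes>i\<in>K. \<ominus> y \<otimes> v i) = (\<Otimes>i\<in>K. v i) \<otimes> (\<ominus> y) [^] card K" if K: "K \<subseteq> {1..n}" for K
  proof -
    have "finite K" using K finite_subset by auto
    then have "(\<Otimes>i\<in>K. \<ominus> y) = (\<ominus> y) [^] card K" using y by (intro finprod_const) auto
    moreover have "(\<Otimes>i\<in>K. \<ominus> y \<otimes> v i) = (\<Otimes>i\<in>K. \<ominus> y) \<otimes> (\<Otimes>i\<in>K. v i)"
      using v y K by (intro finprod_multf) auto
    ultimately show ?thesis using c[OF K] y by (simp add: m_comm)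
  qed
  have U: "Pow {1..n} = (\<Union>j\<in>{..n}. ?C j)"
    using card_mono[of "{1..n}"] by fastforce
  have "(\<Otimes>i\<in>{1..n}. \<one> \<ominus> y \<otimes> v i) = (\<Otimes>i\<in>{1..n}. \<one> \<oplus> \<ominus> y \<otimes> v i)"
    using v y by (intro finprod_cong') (auto simp: a_minus_def l_minus)
  also have "\<dots> = (\<Oplus>K\<in>Pow {1..n}. \<Otimes>i\<in>K. \<ominus> y \<otimes> v i)"
    using v y by (intro finprod_one_plus) auto
  also have "\<dots> = (\<Oplus>j\<in>{..n}. \<Oplus>K\<in>?C j. \<Otimes>i\<in>K. \<ominus> y \<otimes> v i)"
    unfolding U using v y by (intro add.finprod_UN_disjoint) (auto intro!: finprod_closed simp: pairwise_def disjnt_def)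
  also have "\<dots> = (\<Oplus>j\<in>{..n}. elem_sym R n v j \<otimes> (\<ominus> y) [^] j)"
  proof (rule finsum_cong')
    fix j assume "j \<in> {..n}"
    have "(\<Oplus>K\<in>?C j. \<Otimes>i\<in>K. \<ominus> y \<otimes> v i) = (\<Oplus>K\<in>?C j. (\<Otimes>i\<in>K. v i) \<otimes> (\<ominus> y) [^] j)"
      using c y by (intro finsum_cong') (auto simp: m)
    also have "\<dots> = elem_sym R n v j \<otimes> (\<ominus> y) [^] j"
      unfolding elem_sym_def using c y by (intro finsum_ldistr[symmetric]) auto
    finally show "(\<Oplus>K\<in>?C j. \<Otimes>i\<in>K. \<ominus> y \<otimes> v i) = elem_sym R n v j \<otimes> (\<ominus> y) [^] j" .
  qed (use y v elem_sym_closed[of n v] in auto)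
  finally show ?thesis .
qed

text \<open>
  The coefficients \<open>s\<^sub>j\<close> of the characteristic polynomial of a matrix, with the sign that makes them
  elementary symmetric functions of the eigenvalues.
\<close>

definition mat_coeff :: "('b, 'k) ring_scheme \<Rightarrow> nat \<Rightarrow> (nat \<Rightarrow> nat \<Rightarrow> 'b) \<Rightarrow> nat \<Rightarrow> 'b"
  where "mat_coeff B n M j = (\<ominus>\<^bsub>B\<^esub> \<one>\<^bsub>B\<^esub>) [^]\<^bsub>B\<^esub> j \<otimes>\<^bsub>B\<^esub> coeff (UP B) (mat_char_poly B n M) (n - j)"

text \<open>
  Most coefficients of products below are computed for a factor with at most two terms, where the
  convolution formula is not the useful one.
\<close>

declare (in UP_ring) coeff_mult [simp del]

context UP_cring
begin

lemma linear_poly_mult_coeff: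
  assumes "a \<in> carrier R" "b \<in> carrier R" "p \<in> carrier P"
  shows "coeff P ((monom P a 1 \<oplus>\<^bsub>P\<^esub> monom P b 0) \<otimes>\<^bsub>P\<^esub> p) k
    = (if k = 0 then \<zero> else a \<otimes> coeff P p (k - 1)) \<oplus> b \<otimes> coeff P p k"
proof -
  have "coeff P (monom P b 0 \<otimes>\<^bsub>P\<^esub> p) k = b \<otimes> coeff P p k"
    using coeff_monom_mult[of b p 0 k] assms by simp
  moreover have "coeff P (monom P a 1 \<otimes>\<^bsub>P\<^esub> p) k = (if k = 0 then \<zero> else a \<otimes> coeff P p (k - 1))"
  proof (cases k)
    case 0
    then show ?thesis using assms by (simp add: coeff_mult)
  next
    case (Suc m)
    then show ?thesis using coeff_monom_mult[of a p 1 m] assms by (simp flip: Suc_eq_plus1)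
  qed
  ultimately show ?thesis using assms by (simp add: P.l_distr)
qed

lemma mat_char_poly_entries:
  assumes "\<And>i j. i \<in> {1..n} \<Longrightarrow> j \<in> {1..n} \<Longrightarrow> M i j \<in> carrier R"
  shows "mat_char_poly R n M
    = ring_det P n (\<lambda>i j. monom P (if i = j then \<one> else \<zero>) 1 \<oplus>\<^bsub>P\<^esub> monom P (\<ominus> M i j) 0)"
  unfolding mat_char_poly_def P_def[symmetric]
  using assms by (intro P.ring_det_cong) (auto simp: P.minus_eq)

lemma mat_char_poly_closed:
  assumes "\<And>i j. i \<in> {1..n} \<Longrightarrow> j \<in> {1..n} \<Longrightarrow> M i j \<in> carrier R"
  shows "mat_char_poly R n M \<in> carrier P"
  using assms unfolding mat_char_poly_def P_def[symmetric] by (intro P.ring_det_closed) auto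

lemma mat_coeff_closed:
  assumes "\<And>i j. i \<in> {1..n} \<Longrightarrow> j \<in> {1..n} \<Longrightarrow> M i j \<in> carrier R"
  shows "mat_coeff R n M j \<in> carrier R"
  using mat_char_poly_closed[of n M] assms unfolding mat_coeff_def P_def[symmetric] by simp

text \<open>
  This reads off the coefficients \<open>c\<^sub>j\<close> from \<open>\<Sum>\<^sub>j c\<^sub>j (-x)\<^sup>j\<close>, the form in which the polynomials
  \<open>det(1 - xM)\<close> and \<open>\<Prod>\<^sub>i (1 - x v\<^sub>i)\<close> appear.
\<close>

lemma coeff_sum_powers:
  assumes c: "\<And>j. j \<in> {..n} \<Longrightarrow> c j \<in> carrier R"
  shows "coeff P (\<Oplus>\<^bsub>P\<^esub>j\<in>{..n}. monom P (c j) 0 \<otimes>\<^bsub>P\<^esub> (\<ominus>\<^bsub>P\<^esub> monom P \<one> 1) [^]\<^bsub>P\<^esub> j) m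
    = (if m \<le> n then (\<ominus> \<one>) [^] m \<otimes> c m else \<zero>)"
proof -
  have t: "monom P (c j) 0 \<otimes>\<^bsub>P\<^esub> (\<ominus>\<^bsub>P\<^esub> monom P \<one> 1) [^]\<^bsub>P\<^esub> j = monom P (c j \<otimes> (\<ominus> \<one>) [^] j) j"
    if "j \<in> {..n}" for j
  proof -
    have "(\<ominus>\<^bsub>P\<^esub> monom P \<one> 1) [^]\<^bsub>P\<^esub> j = monom P ((\<ominus> \<one>) [^] j) j"
      using monom_pow[of "\<ominus> \<one>" 1 j] by simp
    then show ?thesis using c[OF that] by (simp flip: monom_mult)
  qed
  have "coeff P (\<Oplus>\<^bsub>P\<^esub>j\<in>{..n}. monom P (c j) 0 \<otimes>\<^bsub>P\<^esub> (\<ominus>\<^bsub>P\<^esub> monom P \<one> 1) [^]\<^bsub>P\<^esub> j) m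
    = (\<Oplus>j\<in>{..n}. coeff P (monom P (c j) 0 \<otimes>\<^bsub>P\<^esub> (\<ominus>\<^bsub>P\<^esub> monom P \<one> 1) [^]\<^bsub>P\<^esub> j) m)"
    using c by (intro coeff_finsum) auto
  also have "\<dots> = (\<Oplus>j\<in>{..n}. if m = j then (\<ominus> \<one>) [^] m \<otimes> c m else \<zero>)"
    using c by (intro R.finsum_cong') (auto simp: t R.m_comm)
  also have "\<dots> = (if m \<le> n then (\<ominus> \<one>) [^] m \<otimes> c m else \<zero>)"
  proof (cases "m \<le> n")
    case True
    then show ?thesis
      using R.add.finprod_singleton[of m "{..n}" "\<lambda>_. (\<ominus> \<one>) [^] m \<otimes> c m"] c by simp
  next
    case False
    then show ?thesis by (auto intro!: R.add.finprod_one_eqI)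
  qed
  finally show ?thesis .
qed

end

context UP_pre_univ_prop
begin

text \<open>
  The value at \<open>(1, y)\<close> of the homogenization of degree \<open>m\<close> of \<open>p\<close>, i.e. \<open>y\<^sup>m p(1/y)\<close>. It turns
  the characteristic polynomial \<open>det(x - M)\<close> into \<open>det(1 - yM)\<close>.
\<close>

definition rev_eval :: "'c \<Rightarrow> nat \<Rightarrow> (nat \<Rightarrow> 'a) \<Rightarrow> 'c"
  where "rev_eval y m p = (\<Oplus>\<^bsub>S\<^esub>k\<in>{..m}. h (coeff P p k) \<otimes>\<^bsub>S\<^esub> y [^]\<^bsub>S\<^esub> (m - k))"

lemma rev_eval_closed:
  assumes "y \<in> carrier S" "p \<in> carrier P"
  shows "rev_eval y m p \<in> carrier S"
  unfolding rev_eval_def using assms by (intro S.finsum_closed) auto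

lemma rev_eval_add:
  assumes "y \<in> carrier S" "p \<in> carrier P" "q \<in> carrier P"
  shows "rev_eval y m (p \<oplus>\<^bsub>P\<^esub> q) = rev_eval y m p \<oplus>\<^bsub>S\<^esub> rev_eval y m q"
proof -
  have "rev_eval y m (p \<oplus>\<^bsub>P\<^esub> q) = (\<Oplus>\<^bsub>S\<^esub>k\<in>{..m}. h (coeff P p k) \<otimes>\<^bsub>S\<^esub> y [^]\<^bsub>S\<^esub> (m - k)
      \<oplus>\<^bsub>S\<^esub> h (coeff P q k) \<otimes>\<^bsub>S\<^esub> y [^]\<^bsub>S\<^esub> (m - k))"
    unfolding rev_eval_def using assms by (intro S.finsum_cong') (auto simp: S.l_distr)
  also have "\<dots> = rev_eval y m p \<oplus>\<^bsub>S\<^esub> rev_eval y m q"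
    unfolding rev_eval_def using assms by (intro S.finsum_addf) auto
  finally show ?thesis .
qed

lemma rev_eval_a_inv:
  assumes "y \<in> carrier S" "p \<in> carrier P"
  shows "rev_eval y m (\<ominus>\<^bsub>P\<^esub> p) = \<ominus>\<^bsub>S\<^esub> rev_eval y m p"
proof -
  have "rev_eval y m \<zero>\<^bsub>P\<^esub> = \<zero>\<^bsub>S\<^esub>"
    unfolding rev_eval_def using assms by (intro S.add.finprod_one_eqI) auto
  then have "rev_eval y m p \<oplus>\<^bsub>S\<^esub> rev_eval y m (\<ominus>\<^bsub>P\<^esub> p) = \<zero>\<^bsub>S\<^esub>"
    using rev_eval_add[of y p "\<ominus>\<^bsub>P\<^esub> p" m] assms by (simp add: P.r_neg)
  then show ?thesis
    using assms rev_eval_closed by (metis P.a_inv_closed S.add.m_comm S.minus_equality)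
qed

lemma rev_eval_finsum:
  assumes "y \<in> carrier S" "finite I" "\<And>i. i \<in> I \<Longrightarrow> f i \<in> carrier P"
  shows "rev_eval y m (\<Oplus>\<^bsub>P\<^esub>i\<in>I. f i) = (\<Oplus>\<^bsub>S\<^esub>i\<in>I. rev_eval y m (f i))"
  using assms(2,3)
proof (induction I rule: finite_induct)
  case empty
  then show ?case unfolding rev_eval_def using assms(1) by (auto intro!: S.add.finprod_one_eqI)
next
  case (insert x F)
  then show ?case using assms(1) rev_eval_closed rev_eval_add by (simp add: Pi_def)
qed

lemma rev_eval_linear_mult:
  assumes y: "y \<in> carrier S" and p: "p \<in> carrier P" "coeff P p (Suc m) = \<zero>"
    and ab: "a \<in> carrier R" "b \<in> carrier R"
  shows "rev_eval y (Suc m) ((monom P a 1 \<oplus>\<^bsub>P\<^esub> monom P b 0) \<otimes>\<^bsub>P\<^esub> p)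
    = (h a \<oplus>\<^bsub>S\<^esub> y \<otimes>\<^bsub>S\<^esub> h b) \<otimes>\<^bsub>S\<^esub> rev_eval y m p"
proof -
  let ?c = "\<lambda>k. h (coeff P p k)" let ?y = "\<lambda>k. y [^]\<^bsub>S\<^esub> (k::nat)"
  have c: "?c k \<in> carrier S" for k using p by simp
  have "rev_eval y (Suc m) ((monom P a 1 \<oplus>\<^bsub>P\<^esub> monom P b 0) \<otimes>\<^bsub>P\<^esub> p)
    = (\<Oplus>\<^bsub>S\<^esub>k\<in>{..Suc m}. (if k = 0 then \<zero>\<^bsub>S\<^esub> else h a \<otimes>\<^bsub>S\<^esub> ?c (k - 1)) \<otimes>\<^bsub>S\<^esub> ?y (Suc m - k)
        \<oplus>\<^bsub>S\<^esub> (h b \<otimes>\<^bsub>S\<^esub> ?c k) \<otimes>\<^bsub>S\<^esub> ?y (Suc m - k))"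
    unfolding rev_eval_def using assms
    by (intro S.finsum_cong') (auto simp: linear_poly_mult_coeff S.l_distr)
  also have "\<dots> = (\<Oplus>\<^bsub>S\<^esub>k\<in>{..Suc m}. (if k = 0 then \<zero>\<^bsub>S\<^esub> else h a \<otimes>\<^bsub>S\<^esub> ?c (k - 1)) \<otimes>\<^bsub>S\<^esub> ?y (Suc m - k))
      \<oplus>\<^bsub>S\<^esub> (\<Oplus>\<^bsub>S\<^esub>k\<in>{..Suc m}. (h b \<otimes>\<^bsub>S\<^esub> ?c k) \<otimes>\<^bsub>S\<^esub> ?y (Suc m - k))"
    using y ab p by (intro S.finsum_addf) auto
  also have "(\<Oplus>\<^bsub>S\<^esub>k\<in>{..Suc m}. (if k = 0 then \<zero>\<^bsub>S\<^esub> else h a \<otimes>\<^bsub>S\<^esub> ?c (k - 1)) \<otimes>\<^bsub>S\<^esub> ?y (Suc m - k))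
    = (\<Oplus>\<^bsub>S\<^esub>k\<in>{..m}. h a \<otimes>\<^bsub>S\<^esub> (?c k \<otimes>\<^bsub>S\<^esub> ?y (m - k)))"
    using y ab p by (subst S.finsum_Suc2) (auto intro!: S.finsum_cong' simp: S.m_assoc S.finsum_closed)
  also have "\<dots> = h a \<otimes>\<^bsub>S\<^esub> rev_eval y m p"
    unfolding rev_eval_def using y ab p by (intro S.finsum_rdistr[symmetric]) auto
  also have "(\<Oplus>\<^bsub>S\<^esub>k\<in>{..Suc m}. (h b \<otimes>\<^bsub>S\<^esub> ?c k) \<otimes>\<^bsub>S\<^esub> ?y (Suc m - k))
    = (\<Oplus>\<^bsub>S\<^esub>k\<in>{..m}. (h b \<otimes>\<^bsub>S\<^esub> ?c k) \<otimes>\<^bsub>S\<^esub> ?y (Suc m - k))"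
    using y ab p by (subst S.finsum_Suc) (auto simp: S.finsum_closed)
  also have "\<dots> = (\<Oplus>\<^bsub>S\<^esub>k\<in>{..m}. (y \<otimes>\<^bsub>S\<^esub> h b) \<otimes>\<^bsub>S\<^esub> (?c k \<otimes>\<^bsub>S\<^esub> ?y (m - k)))"
    using y ab c by (intro S.finsum_cong') (auto simp: Suc_diff_le S.m_ac)
  also have "\<dots> = (y \<otimes>\<^bsub>S\<^esub> h b) \<otimes>\<^bsub>S\<^esub> rev_eval y m p"
    unfolding rev_eval_def using y ab p by (intro S.finsum_rdistr[symmetric]) auto
  finally show ?thesis using y ab rev_eval_closed[OF y p(1)] by (simp add: S.l_distr)
qed

text \<open>
  Homogenization is multiplicative if the degrees add up; for a product of linear factors the degree is
  the number of factors. The vanishing of the higher coefficients is part of the induction, since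
  \<open>rev_eval\<close> would ignore them.
\<close>

lemma rev_eval_linear_prod:
  assumes y: "y \<in> carrier S" and "finite I" "\<And>i. i \<in> I \<Longrightarrow> a i \<in> carrier R" "\<And>i. i \<in> I \<Longrightarrow> b i \<in> carrier R"
  shows "rev_eval y (card I) (\<Otimes>\<^bsub>P\<^esub>i\<in>I. monom P (a i) 1 \<oplus>\<^bsub>P\<^esub> monom P (b i) 0)
      = (\<Otimes>\<^bsub>S\<^esub>i\<in>I. h (a i) \<oplus>\<^bsub>S\<^esub> y \<otimes>\<^bsub>S\<^esub> h (b i))
    \<and> (\<forall>k>card I. coeff P (\<Otimes>\<^bsub>P\<^esub>i\<in>I. monom P (a i) 1 \<oplus>\<^bsub>P\<^esub> monom P (b i) 0) k = \<zero>)"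
  using assms(2-4)
proof (induction I rule: finite_induct)
  case empty
  then show ?case by (auto simp: rev_eval_def)
next
  case (insert x F)
  let ?p = "\<Otimes>\<^bsub>P\<^esub>i\<in>F. monom P (a i) 1 \<oplus>\<^bsub>P\<^esub> monom P (b i) 0"
  have p: "?p \<in> carrier P" using insert by (intro P.finprod_closed) auto
  have e: "(\<Otimes>\<^bsub>P\<^esub>i\<in>insert x F. monom P (a i) 1 \<oplus>\<^bsub>P\<^esub> monom P (b i) 0)
    = (monom P (a x) 1 \<oplus>\<^bsub>P\<^esub> monom P (b x) 0) \<otimes>\<^bsub>P\<^esub> ?p"
    using insert by (intro P.finprod_insert) auto
  have IH: "rev_eval y (card F) ?p = (\<Otimes>\<^bsub>S\<^esub>i\<in>F. h (a i) \<oplus>\<^bsub>S\<^esub> y \<otimes>\<^bsub>S\<^esub> h (b i))"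
    "\<And>k. k > card F \<Longrightarrow> coeff P ?p k = \<zero>" using insert by auto
  show ?case unfolding e
    using rev_eval_linear_mult[OF y p, of "card F" "a x" "b x"] IH insert p y
    by (auto simp: linear_poly_mult_coeff Pi_def)
qed

text \<open>
  The reversed characteristic polynomial, evaluated in an arbitrary commutative ring \<open>S\<close> over \<open>R\<close>.
  A suitable choice of \<open>S\<close> and \<open>y\<close> shows that the characteristic polynomial is monic, that its
  coefficients are compatible with ring homomorphisms, and how they determine \<open>det(1 - c x\<^sup>k M)\<close>.
\<close>

lemma det_one_minus:
  assumes M: "\<And>i j. i \<in> {1..n} \<Longrightarrow> j \<in> {1..n} \<Longrightarrow> M i j \<in> carrier R" and y: "y \<in> carrier S"
  shows "ring_det S n (\<lambda>i j. (if i = j then \<one>\<^bsub>S\<^esub> else \<zero>\<^bsub>S\<^esub>) \<ominus>\<^bsub>S\<^esub> y \<otimes>\<^bsub>S\<^esub> h (M i j))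
    = (\<Oplus>\<^bsub>S\<^esub>j\<in>{..n}. h (mat_coeff R n M j) \<otimes>\<^bsub>S\<^esub> (\<ominus>\<^bsub>S\<^esub> y) [^]\<^bsub>S\<^esub> j)"
proof -
  let ?e = "\<lambda>i j. monom P (if i = j then \<one> else \<zero>) 1 \<oplus>\<^bsub>P\<^esub> monom P (\<ominus> M i j) 0"
  let ?d = "\<lambda>i j. (if i = j then \<one>\<^bsub>S\<^esub> else \<zero>\<^bsub>S\<^esub>) \<ominus>\<^bsub>S\<^esub> y \<otimes>\<^bsub>S\<^esub> h (M i j)"
  let ?\<chi> = "mat_char_poly R n M"
  have \<chi>: "?\<chi> \<in> carrier P" using M by (rule mat_char_poly_closed)
  have dc: "?d i j \<in> carrier S" if "i \<in> {1..n}" "j \<in> {1..n}" for i j using M[OF that] y by simp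
  have prod: "rev_eval y n (\<Otimes>\<^bsub>P\<^esub>i\<in>{1..n}. ?e i (p i)) = (\<Otimes>\<^bsub>S\<^esub>i\<in>{1..n}. ?d i (p i))"
    if p: "p permutes {1..n}" for p
  proof -
    have pi: "p i \<in> {1..n}" if "i \<in> {1..n}" for i using permutes_in_image[OF p] that by blast
    have "rev_eval y (card {1..n}) (\<Otimes>\<^bsub>P\<^esub>i\<in>{1..n}. ?e i (p i))
      = (\<Otimes>\<^bsub>S\<^esub>i\<in>{1..n}. h (if i = p i then \<one> else \<zero>) \<oplus>\<^bsub>S\<^esub> y \<otimes>\<^bsub>S\<^esub> h (\<ominus> M i (p i)))"
      using y M pi by (intro rev_eval_linear_prod[THEN conjunct1]) auto
    also have "\<dots> = (\<Otimes>\<^bsub>S\<^esub>i\<in>{1..n}. ?d i (p i))"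
      using y M[OF _ pi] by (intro S.finprod_cong') (auto simp: S.minus_eq S.r_minus)
    finally show ?thesis by simp
  qed
  have pc: "(\<Otimes>\<^bsub>P\<^esub>i\<in>{1..n}. ?e i (p i)) \<in> carrier P" if "p permutes {1..n}" for p
    using that M permutes_in_image[OF that] by (intro P.finprod_closed) auto
  have "rev_eval y n ?\<chi> = (\<Oplus>\<^bsub>S\<^esub>p\<in>{p. p permutes {1..n}}.
      rev_eval y n (if evenperm p then (\<Otimes>\<^bsub>P\<^esub>i\<in>{1..n}. ?e i (p i)) else \<ominus>\<^bsub>P\<^esub> (\<Otimes>\<^bsub>P\<^esub>i\<in>{1..n}. ?e i (p i))))"
    unfolding mat_char_poly_entries[of n M, OF M, simplified] ring_det_def
    using y pc by (subst rev_eval_finsum) (auto simp: finite_permutations)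
  also have "\<dots> = ring_det S n ?d"
    unfolding ring_det_def
    using S.det_term_closed[of n ?d, OF dc] y pc
    by (intro S.finsum_cong') (auto simp: prod rev_eval_a_inv)
  finally have det: "ring_det S n ?d = rev_eval y n ?\<chi>" ..
  have "rev_eval y n ?\<chi> = (\<Oplus>\<^bsub>S\<^esub>k\<in>(\<lambda>j. n - j) ` {..n}. h (coeff P ?\<chi> k) \<otimes>\<^bsub>S\<^esub> y [^]\<^bsub>S\<^esub> (n - k))"
  proof -
    have "(\<lambda>j. n - j) ` {..n} = {..n}" by (force simp: image_iff intro: diff_diff_cancel[symmetric])
    then show ?thesis by (simp add: rev_eval_def)
  qed
  also have "\<dots> = (\<Oplus>\<^bsub>S\<^esub>j\<in>{..n}. h (coeff P ?\<chi> (n - j)) \<otimes>\<^bsub>S\<^esub> y [^]\<^bsub>S\<^esub> (n - (n - j)))"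
    using y \<chi> by (intro S.finsum_reindex) (auto simp: inj_on_def)
  also have "\<dots> = (\<Oplus>\<^bsub>S\<^esub>j\<in>{..n}. h (mat_coeff R n M j) \<otimes>\<^bsub>S\<^esub> (\<ominus>\<^bsub>S\<^esub> y) [^]\<^bsub>S\<^esub> j)"
  proof (rule S.finsum_cong')
    fix j assume j: "j \<in> {..n}"
    let ?u = "(\<ominus>\<^bsub>S\<^esub> \<one>\<^bsub>S\<^esub>) [^]\<^bsub>S\<^esub> j" and ?w = "(\<ominus>\<^bsub>S\<^esub> y) [^]\<^bsub>S\<^esub> j" and ?a = "h (coeff P ?\<chi> (n - j))"
    have uw: "?u \<otimes>\<^bsub>S\<^esub> ?w = y [^]\<^bsub>S\<^esub> j"
      using y by (simp add: S.l_minus flip: S.nat_pow_distrib)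
    have "h (mat_coeff R n M j) = ?u \<otimes>\<^bsub>S\<^esub> ?a"
      unfolding mat_coeff_def P_def[symmetric] using \<chi> by simp
    moreover have "(?u \<otimes>\<^bsub>S\<^esub> ?a) \<otimes>\<^bsub>S\<^esub> ?w = ?a \<otimes>\<^bsub>S\<^esub> (?u \<otimes>\<^bsub>S\<^esub> ?w)"
      using y \<chi> S.m_assoc[of ?u ?a ?w] S.m_lcomm[of ?u ?a ?w] by simp
    ultimately show "?a \<otimes>\<^bsub>S\<^esub> y [^]\<^bsub>S\<^esub> (n - (n - j)) = h (mat_coeff R n M j) \<otimes>\<^bsub>S\<^esub> ?w"
      using j by (simp add: uw)
  qed (use y \<chi> mat_coeff_closed[of n M, OF M] in auto)
  finally show ?thesis unfolding det .
qed

end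

text \<open>
  The characteristic polynomial is monic: take \<open>y = 0\<close> in \<open>det_one_minus\<close>.
\<close>

lemma (in UP_cring) mat_coeff_0:
  assumes M: "\<And>i j. i \<in> {1..n} \<Longrightarrow> j \<in> {1..n} \<Longrightarrow> M i j \<in> carrier R"
  shows "mat_coeff R n M 0 = \<one>"
proof -
  interpret H: UP_pre_univ_prop R R id P
    by unfold_locales auto
  have c: "mat_coeff R n M j \<in> carrier R" for j using M by (rule mat_coeff_closed)
  have "(\<Oplus>j\<in>{..n}. id (mat_coeff R n M j) \<otimes> (\<ominus> \<zero>) [^] j) = ring_det R n (\<lambda>i j. (if i = j then \<one> else \<zero>) \<ominus> \<zero> \<otimes> id (M i j))"
    using M by (intro H.det_one_minus[symmetric]) auto
  also have "\<dots> = ring_det R n (\<lambda>i j. if i = j then \<one> else \<zero>)"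
    using M by (intro R.ring_det_cong) (auto simp: R.minus_eq)
  also have "\<dots> = \<one>" by (rule R.ring_det_one)
  also have "(\<Oplus>j\<in>{..n}. id (mat_coeff R n M j) \<otimes> (\<ominus> \<zero>) [^] j)
    = (\<Oplus>j\<in>{..n}. if 0 = j then mat_coeff R n M 0 else \<zero>)"
    using c by (intro R.finsum_cong') (auto simp: R.nat_pow_zero)
  also have "\<dots> = mat_coeff R n M 0"
    using R.add.finprod_singleton[of 0 "{..n}" "\<lambda>_. mat_coeff R n M 0"] c by simp
  finally show ?thesis .
qed

text \<open>
  Both families of coefficients are those of the polynomial \<open>det(1 - xM)\<close> over \<open>S\<close>.
\<close>

lemma (in ring_hom_cring) hom_mat_coeff:
  assumes M: "\<And>i j. i \<in> {1..n} \<Longrightarrow> j \<in> {1..n} \<Longrightarrow> M i j \<in> carrier R" and j: "j \<le> n"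
  shows "h (mat_coeff R n M j) = mat_coeff S n (\<lambda>i j. h (M i j)) j"
proof -
  let ?P = "UP S" let ?k = "\<lambda>a. monom ?P a 0"
  interpret UR: UP_cring R "UP R" by unfold_locales simp
  interpret US: UP_cring S ?P by unfold_locales simp
  have k: "?k \<in> ring_hom S ?P" by (rule US.const_ring_hom)
  interpret K: UP_pre_univ_prop S ?P ?k ?P by unfold_locales (simp_all add: k)
  interpret L: UP_pre_univ_prop R ?P "\<lambda>a. ?k (h a)" "UP R"
    using ring_hom_trans[OF homh k] by unfold_locales (simp_all add: o_def)
  have hM: "h (M i j) \<in> carrier S" if "i \<in> {1..n}" "j \<in> {1..n}" for i j using M that by simp
  have y: "monom ?P \<one>\<^bsub>S\<^esub> 1 \<in> carrier ?P" by simp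
  have c: "mat_coeff R n M j \<in> carrier R" for j using M by (rule UR.mat_coeff_closed)
  have c': "mat_coeff S n (\<lambda>i j. h (M i j)) j \<in> carrier S" for j using hM by (rule US.mat_coeff_closed)
  have "(\<Oplus>\<^bsub>?P\<^esub>j\<in>{..n}. ?k (h (mat_coeff R n M j)) \<otimes>\<^bsub>?P\<^esub> (\<ominus>\<^bsub>?P\<^esub> monom ?P \<one>\<^bsub>S\<^esub> 1) [^]\<^bsub>?P\<^esub> j)
    = (\<Oplus>\<^bsub>?P\<^esub>j\<in>{..n}. ?k (mat_coeff S n (\<lambda>i j. h (M i j)) j) \<otimes>\<^bsub>?P\<^esub> (\<ominus>\<^bsub>?P\<^esub> monom ?P \<one>\<^bsub>S\<^esub> 1) [^]\<^bsub>?P\<^esub> j)"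
    using L.det_one_minus[OF M y] K.det_one_minus[OF hM y] by simp
  then have "(\<ominus>\<^bsub>S\<^esub> \<one>\<^bsub>S\<^esub>) [^]\<^bsub>S\<^esub> j \<otimes>\<^bsub>S\<^esub> h (mat_coeff R n M j)
      = (\<ominus>\<^bsub>S\<^esub> \<one>\<^bsub>S\<^esub>) [^]\<^bsub>S\<^esub> j \<otimes>\<^bsub>S\<^esub> mat_coeff S n (\<lambda>i j. h (M i j)) j"
    using US.coeff_sum_powers[of n "\<lambda>j. h (mat_coeff R n M j)" j]
      US.coeff_sum_powers[of n "\<lambda>j. mat_coeff S n (\<lambda>i j. h (M i j)) j" j] c c' j by simp
  moreover have "(\<ominus>\<^bsub>S\<^esub> \<one>\<^bsub>S\<^esub>) [^]\<^bsub>S\<^esub> j \<otimes>\<^bsub>S\<^esub> ((\<ominus>\<^bsub>S\<^esub> \<one>\<^bsub>S\<^esub>) [^]\<^bsub>S\<^esub> j \<otimes>\<^bsub>S\<^esub> x) = x" if "x \<in> carrier S" for x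
  proof -
    have "(\<ominus>\<^bsub>S\<^esub> \<one>\<^bsub>S\<^esub>) [^]\<^bsub>S\<^esub> j \<otimes>\<^bsub>S\<^esub> (\<ominus>\<^bsub>S\<^esub> \<one>\<^bsub>S\<^esub>) [^]\<^bsub>S\<^esub> j = \<one>\<^bsub>S\<^esub>"
      by (simp add: S.l_minus flip: S.nat_pow_distrib)
    then show ?thesis using that by (simp flip: S.m_assoc)
  qed
  ultimately show ?thesis using c c' by (metis hom_closed)
qed

text \<open>
  Similar matrices have the same characteristic polynomial: from \<open>P (x - M') = (x - M) P\<close> one gets the
  equality of the determinants after multiplication by \<open>det P\<close>, which is a unit because
  \<open>det P det Q = 1\<close>.
\<close>

lemma (in cring) ring_det_similar:
  assumes M: "\<And>i j. i \<in> {1..n} \<Longrightarrow> j \<in> {1..n} \<Longrightarrow> M i j \<in> carrier R"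
    and M': "\<And>i j. i \<in> {1..n} \<Longrightarrow> j \<in> {1..n} \<Longrightarrow> M' i j \<in> carrier R"
    and P: "\<And>i j. i \<in> {1..n} \<Longrightarrow> j \<in> {1..n} \<Longrightarrow> P i j \<in> carrier R"
    and Q: "\<And>i j. i \<in> {1..n} \<Longrightarrow> j \<in> {1..n} \<Longrightarrow> Q i j \<in> carrier R"
    and x: "x \<in> carrier R"
    and PQ: "\<And>i j. i \<in> {1..n} \<Longrightarrow> j \<in> {1..n} \<Longrightarrow> (\<Oplus>k\<in>{1..n}. P i k \<otimes> Q k j) = (if i = j then \<one> else \<zero>)"
    and PM: "\<And>i j. i \<in> {1..n} \<Longrightarrow> j \<in> {1..n} \<Longrightarrow>
      (\<Oplus>k\<in>{1..n}. P i k \<otimes> M' k j) = (\<Oplus>k\<in>{1..n}. M i k \<otimes> P k j)"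
  shows "ring_det R n (\<lambda>i j. (if i = j then x else \<zero>) \<ominus> M i j)
    = ring_det R n (\<lambda>i j. (if i = j then x else \<zero>) \<ominus> M' i j)" (is "ring_det R n ?X = ring_det R n ?X'")
proof -
  have X: "?X i j \<in> carrier R" if "i \<in> {1..n}" "j \<in> {1..n}" for i j using M[OF that] x by simp
  have X': "?X' i j \<in> carrier R" if "i \<in> {1..n}" "j \<in> {1..n}" for i j using M'[OF that] x by simp
  have minus: "(\<Oplus>k\<in>{1..n}. f k \<ominus> g k) = (\<Oplus>k\<in>{1..n}. f k) \<ominus> (\<Oplus>k\<in>{1..n}. g k)"
    if "\<And>k. k \<in> {1..n} \<Longrightarrow> f k \<in> carrier R" "\<And>k. k \<in> {1..n} \<Longrightarrow> g k \<in> carrier R" for f g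
  proof -
    have "(\<Oplus>k\<in>{1..n}. f k) = (\<Oplus>k\<in>{1..n}. (f k \<ominus> g k) \<oplus> g k)"
      using that by (intro finsum_cong') (auto simp: minus_eq a_assoc l_neg)
    also have "\<dots> = (\<Oplus>k\<in>{1..n}. f k \<ominus> g k) \<oplus> (\<Oplus>k\<in>{1..n}. g k)"
      using that by (intro finsum_addf) auto
    finally have "(\<Oplus>k\<in>{1..n}. f k) = (\<Oplus>k\<in>{1..n}. f k \<ominus> g k) \<oplus> (\<Oplus>k\<in>{1..n}. g k)" .
    moreover have "(\<Oplus>k\<in>{1..n}. f k \<ominus> g k) \<in> carrier R" "(\<Oplus>k\<in>{1..n}. g k) \<in> carrier R"
      using that by (auto intro!: finsum_closed)
    ultimately show ?thesis by (simp add: minus_eq[of "_ \<oplus> _"] a_assoc r_neg)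
  qed
  have PX': "(\<Oplus>k\<in>{1..n}. P i k \<otimes> ?X' k j) = P i j \<otimes> x \<ominus> (\<Oplus>k\<in>{1..n}. P i k \<otimes> M' k j)"
    if ij: "i \<in> {1..n}" "j \<in> {1..n}" for i j
  proof -
    have "(\<Oplus>k\<in>{1..n}. P i k \<otimes> ?X' k j) = (\<Oplus>k\<in>{1..n}. (if j = k then P i j \<otimes> x else \<zero>) \<ominus> P i k \<otimes> M' k j)"
      using P M' x ij by (intro finsum_cong') (auto simp: minus_eq r_distr r_minus)
    also have "\<dots> = (\<Oplus>k\<in>{1..n}. if j = k then P i j \<otimes> x else \<zero>) \<ominus> (\<Oplus>k\<in>{1..n}. P i k \<otimes> M' k j)"
      using P M' x ij by (intro minus) auto
    also have "(\<Oplus>k\<in>{1..n}. if j = k then P i j \<otimes> x else \<zero>) = P i j \<otimes> x"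
      using add.finprod_singleton[of j "{1..n}" "\<lambda>_. P i j \<otimes> x"] ij P x by simp
    finally show ?thesis .
  qed
  have XP: "(\<Oplus>k\<in>{1..n}. ?X i k \<otimes> P k j) = P i j \<otimes> x \<ominus> (\<Oplus>k\<in>{1..n}. M i k \<otimes> P k j)"
    if ij: "i \<in> {1..n}" "j \<in> {1..n}" for i j
  proof -
    have "(\<Oplus>k\<in>{1..n}. ?X i k \<otimes> P k j) = (\<Oplus>k\<in>{1..n}. (if i = k then P i j \<otimes> x else \<zero>) \<ominus> M i k \<otimes> P k j)"
    proof (rule finsum_cong')
      fix k assume k: "k \<in> {1..n}"
      show "?X i k \<otimes> P k j = (if i = k then P i j \<otimes> x else \<zero>) \<ominus> M i k \<otimes> P k j"
        using P[OF k ij(2)] M[OF ij(1) k] x by (auto simp: minus_eq l_distr l_minus m_comm[of x])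
    qed (use P M x ij in auto)
    also have "\<dots> = (\<Oplus>k\<in>{1..n}. if i = k then P i j \<otimes> x else \<zero>) \<ominus> (\<Oplus>k\<in>{1..n}. M i k \<otimes> P k j)"
      using P M x ij by (intro minus) auto
    also have "(\<Oplus>k\<in>{1..n}. if i = k then P i j \<otimes> x else \<zero>) = P i j \<otimes> x"
      using add.finprod_singleton[of i "{1..n}" "\<lambda>_. P i j \<otimes> x"] ij P x by simp
    finally show ?thesis .
  qed
  have dP: "ring_det R n P \<in> carrier R" using P by (rule ring_det_closed)
  have dQ: "ring_det R n Q \<in> carrier R" using Q by (rule ring_det_closed)
  have dX: "ring_det R n ?X \<in> carrier R" using X by (rule ring_det_closed)
  have dX': "ring_det R n ?X' \<in> carrier R" using X' by (rule ring_det_closed)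
  have "ring_det R n P \<otimes> ring_det R n Q = ring_det R n (\<lambda>i j. \<Oplus>k\<in>{1..n}. P i k \<otimes> Q k j)"
    using P Q by (rule ring_det_mult[symmetric])
  also have "\<dots> = ring_det R n (\<lambda>i j. if i = j then \<one> else \<zero>)"
    using PQ by (intro ring_det_cong) auto
  finally have unit: "ring_det R n P \<otimes> ring_det R n Q = \<one>" by (simp add: ring_det_one)
  have "ring_det R n P \<otimes> ring_det R n ?X' = ring_det R n (\<lambda>i j. \<Oplus>k\<in>{1..n}. P i k \<otimes> ?X' k j)"
    using P X' by (rule ring_det_mult[symmetric])
  also have "\<dots> = ring_det R n (\<lambda>i j. \<Oplus>k\<in>{1..n}. ?X i k \<otimes> P k j)"
  proof (rule ring_det_cong)
    fix i j assume ij: "i \<in> {1..n}" "j \<in> {1..n}"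
    show "(\<Oplus>k\<in>{1..n}. P i k \<otimes> ?X' k j) = (\<Oplus>k\<in>{1..n}. ?X i k \<otimes> P k j)"
      using PX'[OF ij] XP[OF ij] PM[OF ij] by simp
    show "(\<Oplus>k\<in>{1..n}. ?X i k \<otimes> P k j) \<in> carrier R"
      using X P ij by (intro finsum_closed) auto
  qed
  also have "\<dots> = ring_det R n ?X \<otimes> ring_det R n P" using X P by (rule ring_det_mult)
  finally have "ring_det R n P \<otimes> ring_det R n ?X' = ring_det R n P \<otimes> ring_det R n ?X"
    using dP dX by (simp add: m_comm)
  then have "ring_det R n Q \<otimes> (ring_det R n P \<otimes> ring_det R n ?X') = ring_det R n Q \<otimes> (ring_det R n P \<otimes> ring_det R n ?X)"
    by simp
  then have "(ring_det R n P \<otimes> ring_det R n Q) \<otimes> ring_det R n ?X' = (ring_det R n P \<otimes> ring_det R n Q) \<otimes> ring_det R n ?X"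
    using dP dQ dX dX' by (simp add: m_ac)
  then show ?thesis unfolding unit using dX dX' by simp
qed

section \<open>Bases and multiplication matrices\<close>

definition coord :: "('b, 'k) ring_scheme \<Rightarrow> ('b, 'm, 'p) module_scheme \<Rightarrow> nat \<Rightarrow> (nat \<Rightarrow> 'm) \<Rightarrow> 'm \<Rightarrow> nat \<Rightarrow> 'b"
  where "coord B M n e x = (THE c. coords_of B M n e x c)"

definition mult_matrix :: "('b, 'k) ring_scheme \<Rightarrow> ('b, 'm, 'p) module_scheme \<Rightarrow> nat \<Rightarrow> (nat \<Rightarrow> 'm) \<Rightarrow> 'm \<Rightarrow> nat \<Rightarrow> nat \<Rightarrow> 'b"
  where "mult_matrix B A n e a = lin_matrix B A n e (\<lambda>x. a \<otimes>\<^bsub>A\<^esub> x)"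

lemma mult_matrix_coord: "mult_matrix B A n e a i j = coord B A n e (a \<otimes>\<^bsub>A\<^esub> e j) i"
  by (simp add: mult_matrix_def lin_matrix_def coord_def)

context module
begin

lemma smult_finsum_scalars:
  assumes "finite I" "\<And>i. i \<in> I \<Longrightarrow> c i \<in> carrier R" "x \<in> carrier M"
  shows "(\<Oplus>i\<in>I. c i) \<odot>\<^bsub>M\<^esub> x = (\<Oplus>\<^bsub>M\<^esub>i\<in>I. c i \<odot>\<^bsub>M\<^esub> x)"
  using assms by (induction I rule: finite_induct) (auto simp: Pi_def smult_l_distr)

lemma lincomb_lincomb:
  fixes n :: nat
  assumes "\<And>k. k \<in> {1..n} \<Longrightarrow> c k \<in> carrier R" "\<And>i k. i \<in> {1..n} \<Longrightarrow> k \<in> {1..n} \<Longrightarrow> d i k \<in> carrier R"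
    and "\<And>i. i \<in> {1..n} \<Longrightarrow> e i \<in> carrier M"
  shows "(\<Oplus>\<^bsub>M\<^esub>k\<in>{1..n}. c k \<odot>\<^bsub>M\<^esub> (\<Oplus>\<^bsub>M\<^esub>i\<in>{1..n}. d i k \<odot>\<^bsub>M\<^esub> e i))
    = (\<Oplus>\<^bsub>M\<^esub>i\<in>{1..n}. (\<Oplus>k\<in>{1..n}. d i k \<otimes> c k) \<odot>\<^bsub>M\<^esub> e i)"
proof -
  have "(\<Oplus>\<^bsub>M\<^esub>k\<in>{1..n}. c k \<odot>\<^bsub>M\<^esub> (\<Oplus>\<^bsub>M\<^esub>i\<in>{1..n}. d i k \<odot>\<^bsub>M\<^esub> e i))
    = (\<Oplus>\<^bsub>M\<^esub>k\<in>{1..n}. \<Oplus>\<^bsub>M\<^esub>i\<in>{1..n}. (d i k \<otimes> c k) \<odot>\<^bsub>M\<^esub> e i)"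
  proof (rule M.finsum_cong')
    fix k assume k: "k \<in> {1..n}"
    have "c k \<odot>\<^bsub>M\<^esub> (\<Oplus>\<^bsub>M\<^esub>i\<in>{1..n}. d i k \<odot>\<^bsub>M\<^esub> e i) = (\<Oplus>\<^bsub>M\<^esub>i\<in>{1..n}. c k \<odot>\<^bsub>M\<^esub> (d i k \<odot>\<^bsub>M\<^esub> e i))"
      by (rule finsum_smult_ldistr) (use assms k in auto)
    also have "\<dots> = (\<Oplus>\<^bsub>M\<^esub>i\<in>{1..n}. (d i k \<otimes> c k) \<odot>\<^bsub>M\<^esub> e i)"
      using assms k by (intro M.finsum_cong') (auto simp: R.m_comm smult_assoc1)
    finally show "c k \<odot>\<^bsub>M\<^esub> (\<Oplus>\<^bsub>M\<^esub>i\<in>{1..n}. d i k \<odot>\<^bsub>M\<^esub> e i) = (\<Oplus>\<^bsub>M\<^esub>i\<in>{1..n}. (d i k \<otimes> c k) \<odot>\<^bsub>M\<^esub> e i)" .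
  qed (use assms in \<open>auto intro!: M.finsum_closed\<close>)
  also have "\<dots> = (\<Oplus>\<^bsub>M\<^esub>i\<in>{1..n}. \<Oplus>\<^bsub>M\<^esub>k\<in>{1..n}. (d i k \<otimes> c k) \<odot>\<^bsub>M\<^esub> e i)"
    using assms by (intro M.add.finprod_swap) auto
  also have "\<dots> = (\<Oplus>\<^bsub>M\<^esub>i\<in>{1..n}. (\<Oplus>k\<in>{1..n}. d i k \<otimes> c k) \<odot>\<^bsub>M\<^esub> e i)"
    using assms by (intro M.finsum_cong' smult_finsum_scalars[symmetric]) (auto intro!: R.finsum_closed)
  finally show ?thesis .
qed

context
  fixes n :: nat and e
  assumes basis: "module_basis R M n e"
begin

lemma basis_closed: "i \<in> {1..n} \<Longrightarrow> e i \<in> carrier M"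
  using basis by (auto simp: module_basis_def)

lemma coords_of_coord: "x \<in> carrier M \<Longrightarrow> coords_of R M n e x (coord R M n e x)"
proof -
  assume "x \<in> carrier M"
  then have "\<exists>!c. coords_of R M n e x c" using basis by (auto simp only: module_basis_def)
  then show ?thesis unfolding coord_def by (rule theI')
qed

lemma coord_closed: "x \<in> carrier M \<Longrightarrow> i \<in> {1..n} \<Longrightarrow> coord R M n e x i \<in> carrier R"
  using coords_of_coord[of x] unfolding coords_of_def by auto

lemma coord_expand: "x \<in> carrier M \<Longrightarrow> x = (\<Oplus>\<^bsub>M\<^esub>i\<in>{1..n}. coord R M n e x i \<odot>\<^bsub>M\<^esub> e i)"
  using coords_of_coord[of x] unfolding coords_of_def by auto

lemma coord_unique:
  assumes "\<And>i. i \<in> {1..n} \<Longrightarrow> c i \<in> carrier R" "x = (\<Oplus>\<^bsub>M\<^esub>i\<in>{1..n}. c i \<odot>\<^bsub>M\<^esub> e i)" "i \<in> {1..n}"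
  shows "coord R M n e x i = c i"
proof -
  have x: "x \<in> carrier M" unfolding assms(2) using assms(1) basis_closed by (intro M.finsum_closed) auto
  have "x = (\<Oplus>\<^bsub>M\<^esub>i\<in>{1..n}. restrict c {1..n} i \<odot>\<^bsub>M\<^esub> e i)"
    unfolding assms(2) using assms(1) basis_closed by (intro M.finsum_cong') auto
  then have "coords_of R M n e x (restrict c {1..n})"
    using assms(1) by (simp add: coords_of_def)
  then have "coord R M n e x = restrict c {1..n}"
    using coords_of_coord[OF x] basis x by (auto simp only: module_basis_def)
  then show ?thesis using assms(3) by simp
qed

lemma coord_add:
  assumes "x \<in> carrier M" "y \<in> carrier M" "i \<in> {1..n}"
  shows "coord R M n e (x \<oplus>\<^bsub>M\<^esub> y) i = coord R M n e x i \<oplus> coord R M n e y i"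
proof (rule coord_unique)
  have "(\<Oplus>\<^bsub>M\<^esub>i\<in>{1..n}. (coord R M n e x i \<oplus> coord R M n e y i) \<odot>\<^bsub>M\<^esub> e i)
    = (\<Oplus>\<^bsub>M\<^esub>i\<in>{1..n}. coord R M n e x i \<odot>\<^bsub>M\<^esub> e i \<oplus>\<^bsub>M\<^esub> coord R M n e y i \<odot>\<^bsub>M\<^esub> e i)"
    using assms basis_closed coord_closed by (intro M.finsum_cong') (auto simp: smult_l_distr)
  also have "\<dots> = (\<Oplus>\<^bsub>M\<^esub>i\<in>{1..n}. coord R M n e x i \<odot>\<^bsub>M\<^esub> e i) \<oplus>\<^bsub>M\<^esub> (\<Oplus>\<^bsub>M\<^esub>i\<in>{1..n}. coord R M n e y i \<odot>\<^bsub>M\<^esub> e i)"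
    using assms basis_closed coord_closed by (intro M.finsum_addf) auto
  finally show "x \<oplus>\<^bsub>M\<^esub> y = (\<Oplus>\<^bsub>M\<^esub>i\<in>{1..n}. (coord R M n e x i \<oplus> coord R M n e y i) \<odot>\<^bsub>M\<^esub> e i)"
    using coord_expand assms by simp
qed (use assms coord_closed in auto)

lemma coord_smult:
  assumes "x \<in> carrier M" "c \<in> carrier R" "i \<in> {1..n}"
  shows "coord R M n e (c \<odot>\<^bsub>M\<^esub> x) i = c \<otimes> coord R M n e x i"
proof (rule coord_unique)
  have "c \<odot>\<^bsub>M\<^esub> x = c \<odot>\<^bsub>M\<^esub> (\<Oplus>\<^bsub>M\<^esub>i\<in>{1..n}. coord R M n e x i \<odot>\<^bsub>M\<^esub> e i)"
    using coord_expand assms by simp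
  also have "\<dots> = (\<Oplus>\<^bsub>M\<^esub>i\<in>{1..n}. c \<odot>\<^bsub>M\<^esub> (coord R M n e x i \<odot>\<^bsub>M\<^esub> e i))"
    using assms basis_closed coord_closed by (intro finsum_smult_ldistr) auto
  also have "\<dots> = (\<Oplus>\<^bsub>M\<^esub>i\<in>{1..n}. (c \<otimes> coord R M n e x i) \<odot>\<^bsub>M\<^esub> e i)"
    using assms basis_closed coord_closed by (intro M.finsum_cong') (auto simp: smult_assoc1)
  finally show "c \<odot>\<^bsub>M\<^esub> x = (\<Oplus>\<^bsub>M\<^esub>i\<in>{1..n}. (c \<otimes> coord R M n e x i) \<odot>\<^bsub>M\<^esub> e i)" .
qed (use assms coord_closed in auto)

lemma coord_basis:
  assumes "i \<in> {1..n}" "j \<in> {1..n}"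
  shows "coord R M n e (e j) i = (if i = j then \<one> else \<zero>)"
proof (rule coord_unique)
  have "(\<Oplus>\<^bsub>M\<^esub>i\<in>{1..n}. (if i = j then \<one> else \<zero>) \<odot>\<^bsub>M\<^esub> e i) = (\<Oplus>\<^bsub>M\<^esub>i\<in>{1..n}. if j = i then e j else \<zero>\<^bsub>M\<^esub>)"
    using basis_closed by (intro M.finsum_cong') auto
  also have "\<dots> = e j"
    using M.add.finprod_singleton[of j "{1..n}" "\<lambda>_. e j"] assms basis_closed by simp
  finally show "e j = (\<Oplus>\<^bsub>M\<^esub>i\<in>{1..n}. (if i = j then \<one> else \<zero>) \<odot>\<^bsub>M\<^esub> e i)" ..
qed (use assms in auto)

end

end

context algebra
begin

lemma mult_smult_right:
  "a \<in> carrier R \<Longrightarrow> x \<in> carrier M \<Longrightarrow> y \<in> carrier M \<Longrightarrow> x \<otimes>\<^bsub>M\<^esub> (a \<odot>\<^bsub>M\<^esub> y) = a \<odot>\<^bsub>M\<^esub> (x \<otimes>\<^bsub>M\<^esub> y)"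
  by (metis m_comm smult_assoc2 smult_closed)

lemma structure_map_hom: "(\<lambda>c. c \<odot>\<^bsub>M\<^esub> \<one>\<^bsub>M\<^esub>) \<in> ring_hom R M"
  by (rule ring_hom_memI)
    (auto simp: smult_l_distr smult_assoc1 smult_assoc2)

lemma smult_eq_mult: "c \<in> carrier R \<Longrightarrow> x \<in> carrier M \<Longrightarrow> c \<odot>\<^bsub>M\<^esub> x = (c \<odot>\<^bsub>M\<^esub> \<one>\<^bsub>M\<^esub>) \<otimes>\<^bsub>M\<^esub> x"
  by (simp add: smult_assoc2)

context
  fixes n :: nat and e
  assumes basis: "module_basis R M n e"
begin

lemma mult_matrix_closed:
  "a \<in> carrier M \<Longrightarrow> i \<in> {1..n} \<Longrightarrow> j \<in> {1..n} \<Longrightarrow> mult_matrix R M n e a i j \<in> carrier R"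
  unfolding mult_matrix_coord using basis_closed[OF basis] by (intro coord_closed[OF basis]) auto

lemma mult_matrix_expand:
  "a \<in> carrier M \<Longrightarrow> j \<in> {1..n} \<Longrightarrow> a \<otimes>\<^bsub>M\<^esub> e j = (\<Oplus>\<^bsub>M\<^esub>i\<in>{1..n}. mult_matrix R M n e a i j \<odot>\<^bsub>M\<^esub> e i)"
  unfolding mult_matrix_coord using basis_closed[OF basis] by (intro coord_expand[OF basis]) auto

lemma mult_matrix_add:
  "a \<in> carrier M \<Longrightarrow> b \<in> carrier M \<Longrightarrow> i \<in> {1..n} \<Longrightarrow> j \<in> {1..n} \<Longrightarrow>
    mult_matrix R M n e (a \<oplus>\<^bsub>M\<^esub> b) i j = mult_matrix R M n e a i j \<oplus> mult_matrix R M n e b i j"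
  using basis_closed[OF basis] by (simp add: mult_matrix_coord l_distr coord_add[OF basis])

lemma mult_matrix_smult:
  "a \<in> carrier M \<Longrightarrow> c \<in> carrier R \<Longrightarrow> i \<in> {1..n} \<Longrightarrow> j \<in> {1..n} \<Longrightarrow>
    mult_matrix R M n e (c \<odot>\<^bsub>M\<^esub> a) i j = c \<otimes> mult_matrix R M n e a i j"
  using basis_closed[OF basis] by (simp add: mult_matrix_coord smult_assoc2 coord_smult[OF basis])

lemma mult_matrix_one:
  "i \<in> {1..n} \<Longrightarrow> j \<in> {1..n} \<Longrightarrow> mult_matrix R M n e \<one>\<^bsub>M\<^esub> i j = (if i = j then \<one> else \<zero>)"
  using basis_closed[OF basis] by (simp add: mult_matrix_coord coord_basis[OF basis])

lemma mult_lincomb: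
  assumes "a \<in> carrier M" "\<And>i. i \<in> {1..n} \<Longrightarrow> c i \<in> carrier R"
  shows "a \<otimes>\<^bsub>M\<^esub> (\<Oplus>\<^bsub>M\<^esub>k\<in>{1..n}. c k \<odot>\<^bsub>M\<^esub> e k)
    = (\<Oplus>\<^bsub>M\<^esub>i\<in>{1..n}. (\<Oplus>k\<in>{1..n}. mult_matrix R M n e a i k \<otimes> c k) \<odot>\<^bsub>M\<^esub> e i)"
proof -
  have "a \<otimes>\<^bsub>M\<^esub> (\<Oplus>\<^bsub>M\<^esub>k\<in>{1..n}. c k \<odot>\<^bsub>M\<^esub> e k) = (\<Oplus>\<^bsub>M\<^esub>k\<in>{1..n}. a \<otimes>\<^bsub>M\<^esub> (c k \<odot>\<^bsub>M\<^esub> e k))"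
    using assms basis_closed[OF basis] by (intro finsum_rdistr) auto
  also have "\<dots> = (\<Oplus>\<^bsub>M\<^esub>k\<in>{1..n}. c k \<odot>\<^bsub>M\<^esub> (\<Oplus>\<^bsub>M\<^esub>i\<in>{1..n}. mult_matrix R M n e a i k \<odot>\<^bsub>M\<^esub> e i))"
    using assms basis_closed[OF basis] mult_matrix_closed
    by (intro M.finsum_cong') (auto simp: mult_smult_right mult_matrix_expand intro!: M.finsum_closed)
  also have "\<dots> = (\<Oplus>\<^bsub>M\<^esub>i\<in>{1..n}. (\<Oplus>k\<in>{1..n}. mult_matrix R M n e a i k \<otimes> c k) \<odot>\<^bsub>M\<^esub> e i)"
    using assms basis_closed[OF basis] mult_matrix_closed by (intro lincomb_lincomb) auto
  finally show ?thesis .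
qed

lemma mult_matrix_mult:
  assumes "a \<in> carrier M" "b \<in> carrier M" "i \<in> {1..n}" "j \<in> {1..n}"
  shows "mult_matrix R M n e (a \<otimes>\<^bsub>M\<^esub> b) i j
    = (\<Oplus>k\<in>{1..n}. mult_matrix R M n e a i k \<otimes> mult_matrix R M n e b k j)"
  unfolding mult_matrix_coord[of _ _ _ _ "a \<otimes>\<^bsub>M\<^esub> b"]
proof (rule coord_unique[OF basis])
  have "(a \<otimes>\<^bsub>M\<^esub> b) \<otimes>\<^bsub>M\<^esub> e j = a \<otimes>\<^bsub>M\<^esub> (b \<otimes>\<^bsub>M\<^esub> e j)"
    using assms basis_closed[OF basis] by (simp add: m_assoc)
  also have "\<dots> = a \<otimes>\<^bsub>M\<^esub> (\<Oplus>\<^bsub>M\<^esub>k\<in>{1..n}. mult_matrix R M n e b k j \<odot>\<^bsub>M\<^esub> e k)"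
    using assms by (simp add: mult_matrix_expand)
  also have "\<dots> = (\<Oplus>\<^bsub>M\<^esub>i\<in>{1..n}. (\<Oplus>k\<in>{1..n}. mult_matrix R M n e a i k \<otimes> mult_matrix R M n e b k j) \<odot>\<^bsub>M\<^esub> e i)"
    using assms mult_matrix_closed by (intro mult_lincomb) auto
  finally show "(a \<otimes>\<^bsub>M\<^esub> b) \<otimes>\<^bsub>M\<^esub> e j
    = (\<Oplus>\<^bsub>M\<^esub>i\<in>{1..n}. (\<Oplus>k\<in>{1..n}. mult_matrix R M n e a i k \<otimes> mult_matrix R M n e b k j) \<odot>\<^bsub>M\<^esub> e i)" .
qed (use assms mult_matrix_closed in \<open>auto intro!: R.finsum_closed\<close>)

end

text \<open>
  The change of basis matrix and its inverse give the similarity of the two multiplication matrices;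
  the constants of \<open>R[x]\<close> carry it over to the matrices over \<open>R[x]\<close>.
\<close>

lemma mat_char_poly_basis_indep:
  assumes e: "module_basis R M n e" and e': "module_basis R M n e'" and a: "a \<in> carrier M"
  shows "mat_char_poly R n (mult_matrix R M n e a) = mat_char_poly R n (mult_matrix R M n e' a)"
proof -
  let ?P = "UP R" let ?I = "{1..n}"
  interpret U: UP_cring R ?P by unfold_locales simp
  interpret K: ring_hom_cring R ?P "\<lambda>c. monom ?P c 0"
    using U.const_ring_hom by unfold_locales
  let ?M = "mult_matrix R M n e a" and ?M' = "mult_matrix R M n e' a"
  let ?p = "\<lambda>i j. coord R M n e (e' j) i" and ?q = "\<lambda>i j. coord R M n e' (e j) i"
  have ec: "e i \<in> carrier M" "e' i \<in> carrier M" if "i \<in> ?I" for i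
    using that basis_closed[OF e] basis_closed[OF e'] by auto
  have pc: "?p i j \<in> carrier R" "?q i j \<in> carrier R" if "i \<in> ?I" "j \<in> ?I" for i j
    using that ec coord_closed[OF e] coord_closed[OF e'] by auto
  have Mc: "?M i j \<in> carrier R" "?M' i j \<in> carrier R" if "i \<in> ?I" "j \<in> ?I" for i j
    using that a mult_matrix_closed[OF e] mult_matrix_closed[OF e'] by auto
  have e'_lin: "(\<Oplus>\<^bsub>M\<^esub>k\<in>?I. c k \<odot>\<^bsub>M\<^esub> e' k) = (\<Oplus>\<^bsub>M\<^esub>i\<in>?I. (\<Oplus>k\<in>?I. ?p i k \<otimes> c k) \<odot>\<^bsub>M\<^esub> e i)"
    if c: "\<And>k. k \<in> ?I \<Longrightarrow> c k \<in> carrier R" for c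
  proof -
    have "(\<Oplus>\<^bsub>M\<^esub>k\<in>?I. c k \<odot>\<^bsub>M\<^esub> e' k) = (\<Oplus>\<^bsub>M\<^esub>k\<in>?I. c k \<odot>\<^bsub>M\<^esub> (\<Oplus>\<^bsub>M\<^esub>i\<in>?I. ?p i k \<odot>\<^bsub>M\<^esub> e i))"
      using c ec pc coord_expand[OF e ec(2)] by (intro M.finsum_cong') (auto intro!: M.finsum_closed)
    also have "\<dots> = (\<Oplus>\<^bsub>M\<^esub>i\<in>?I. (\<Oplus>k\<in>?I. ?p i k \<otimes> c k) \<odot>\<^bsub>M\<^esub> e i)"
      using c ec pc by (intro lincomb_lincomb) auto
    finally show ?thesis .
  qed
  have PQ: "(\<Oplus>k\<in>?I. ?p i k \<otimes> ?q k j) = (if i = j then \<one> else \<zero>)" if ij: "i \<in> ?I" "j \<in> ?I" for i j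
  proof -
    have "coord R M n e (e j) i = (\<Oplus>k\<in>?I. ?p i k \<otimes> ?q k j)"
    proof (rule coord_unique[OF e])
      have "e j = (\<Oplus>\<^bsub>M\<^esub>k\<in>?I. ?q k j \<odot>\<^bsub>M\<^esub> e' k)" using coord_expand[OF e' ec(1)] ij by simp
      also have "\<dots> = (\<Oplus>\<^bsub>M\<^esub>i\<in>?I. (\<Oplus>k\<in>?I. ?p i k \<otimes> ?q k j) \<odot>\<^bsub>M\<^esub> e i)" using pc ij by (intro e'_lin) auto
      finally show "e j = (\<Oplus>\<^bsub>M\<^esub>i\<in>?I. (\<Oplus>k\<in>?I. ?p i k \<otimes> ?q k j) \<odot>\<^bsub>M\<^esub> e i)" .
    qed (use pc ij in \<open>auto intro!: R.finsum_closed\<close>)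
    then show ?thesis using coord_basis[OF e ij] by simp
  qed
  have PM: "(\<Oplus>k\<in>?I. ?p i k \<otimes> ?M' k j) = (\<Oplus>k\<in>?I. ?M i k \<otimes> ?p k j)" if ij: "i \<in> ?I" "j \<in> ?I" for i j
  proof -
    have "coord R M n e (a \<otimes>\<^bsub>M\<^esub> e' j) i = (\<Oplus>k\<in>?I. ?p i k \<otimes> ?M' k j)"
    proof (rule coord_unique[OF e])
      show "a \<otimes>\<^bsub>M\<^esub> e' j = (\<Oplus>\<^bsub>M\<^esub>i\<in>?I. (\<Oplus>k\<in>?I. ?p i k \<otimes> ?M' k j) \<odot>\<^bsub>M\<^esub> e i)"
        unfolding mult_matrix_expand[OF e' a ij(2)] using Mc ij by (intro e'_lin) auto
    qed (use pc Mc ij in \<open>auto intro!: R.finsum_closed\<close>)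
    moreover have "coord R M n e (a \<otimes>\<^bsub>M\<^esub> e' j) i = (\<Oplus>k\<in>?I. ?M i k \<otimes> ?p k j)"
    proof (rule coord_unique[OF e])
      have "a \<otimes>\<^bsub>M\<^esub> e' j = a \<otimes>\<^bsub>M\<^esub> (\<Oplus>\<^bsub>M\<^esub>k\<in>?I. ?p k j \<odot>\<^bsub>M\<^esub> e k)"
        using coord_expand[OF e ec(2)] ij by simp
      also have "\<dots> = (\<Oplus>\<^bsub>M\<^esub>i\<in>?I. (\<Oplus>k\<in>?I. ?M i k \<otimes> ?p k j) \<odot>\<^bsub>M\<^esub> e i)"
        using a pc ij by (intro mult_lincomb[OF e]) auto
      finally show "a \<otimes>\<^bsub>M\<^esub> e' j = (\<Oplus>\<^bsub>M\<^esub>i\<in>?I. (\<Oplus>k\<in>?I. ?M i k \<otimes> ?p k j) \<odot>\<^bsub>M\<^esub> e i)" .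
    qed (use pc Mc ij in \<open>auto intro!: R.finsum_closed\<close>)
    ultimately show ?thesis by simp
  qed
  let ?k = "\<lambda>f i j. monom ?P (f i j) 0"
  have hom_sum: "(\<Oplus>\<^bsub>?P\<^esub>k\<in>?I. ?k f i k \<otimes>\<^bsub>?P\<^esub> ?k g k j) = monom ?P (\<Oplus>k\<in>?I. f i k \<otimes> g k j) 0"
    if "i \<in> ?I" "j \<in> ?I" "\<And>k. k \<in> ?I \<Longrightarrow> f i k \<in> carrier R" "\<And>k. k \<in> ?I \<Longrightarrow> g k j \<in> carrier R" for f g i j
  proof -
    have "monom ?P (\<Oplus>k\<in>?I. f i k \<otimes> g k j) 0 = (\<Oplus>\<^bsub>?P\<^esub>k\<in>?I. monom ?P (f i k \<otimes> g k j) 0)"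
      using that by (subst K.hom_finsum) (auto simp: o_def)
    also have "\<dots> = (\<Oplus>\<^bsub>?P\<^esub>k\<in>?I. ?k f i k \<otimes>\<^bsub>?P\<^esub> ?k g k j)"
      using that by (intro U.P.finsum_cong') (simp_all only: K.hom_mult, auto)
    finally show ?thesis ..
  qed
  show ?thesis
    unfolding mat_char_poly_def
  proof (rule U.P.ring_det_similar[where P = "?k ?p" and Q = "?k ?q"])
    fix i j assume ij: "i \<in> ?I" "j \<in> ?I"
    show "(\<Oplus>\<^bsub>?P\<^esub>k\<in>?I. ?k ?p i k \<otimes>\<^bsub>?P\<^esub> ?k ?q k j) = (if i = j then \<one>\<^bsub>?P\<^esub> else \<zero>\<^bsub>?P\<^esub>)"
      using hom_sum[of i j ?p ?q] ij pc PQ[OF ij] by simp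
    show "(\<Oplus>\<^bsub>?P\<^esub>k\<in>?I. ?k ?p i k \<otimes>\<^bsub>?P\<^esub> ?k ?M' k j) = (\<Oplus>\<^bsub>?P\<^esub>k\<in>?I. ?k ?M i k \<otimes>\<^bsub>?P\<^esub> ?k ?p k j)"
      using hom_sum[of i j ?p ?M'] hom_sum[of i j ?M ?p] ij pc Mc PM[OF ij] by simp
  qed (use pc Mc in auto)
qed

text \<open>
  \<open>char_coeff\<close> refers to an arbitrarily chosen basis; this makes it computable in any given one.
\<close>

lemma char_coeff_basis:
  assumes e: "module_basis R M n e" and a: "a \<in> carrier M"
  shows "char_coeff R M n j a = mat_coeff R n (mult_matrix R M n e a) j"
proof -
  have "module_basis R M n (SOME e. module_basis R M n e)" using e by (rule someI[of "module_basis R M n"])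
  from mat_char_poly_basis_indep[OF this e a] show ?thesis
    by (simp add: char_coeff_def mat_coeff_def lin_char_poly_def mult_matrix_def)
qed

lemma char_coeff_closed:
  assumes "module_basis R M n e" "a \<in> carrier M"
  shows "char_coeff R M n j a \<in> carrier R"
proof -
  interpret U: UP_cring R "UP R" by unfold_locales simp
  show ?thesis unfolding char_coeff_basis[OF assms]
    using mult_matrix_closed[OF assms] by (rule U.mat_coeff_closed)
qed

end

text \<open>
  The algebras below have different rings of scalars, and the homomorphisms between them are linear
  along a map \<open>g\<close> of the scalars; \<open>algebra_hom\<close> is the case where \<open>g\<close> is the identity.
\<close>

definition semilinear_hom ::
  "('b, 'k) ring_scheme \<Rightarrow> ('b \<Rightarrow> 'c) \<Rightarrow> ('b, 'm, 'p) module_scheme \<Rightarrow> ('c, 'n, 'q) module_scheme \<Rightarrow> ('m \<Rightarrow> 'n) set"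
  where "semilinear_hom B g M N =
    {h \<in> ring_hom M N. \<forall>b\<in>carrier B. \<forall>x\<in>carrier M. h (b \<odot>\<^bsub>M\<^esub> x) = g b \<odot>\<^bsub>N\<^esub> h x}"

lemma algebra_hom_eq_semilinear_hom: "algebra_hom B M N = semilinear_hom B (\<lambda>b. b) M N"
  by (simp add: algebra_hom_def semilinear_hom_def)

lemma semilinear_homI:
  assumes "h \<in> ring_hom M N" "\<And>b x. b \<in> carrier B \<Longrightarrow> x \<in> carrier M \<Longrightarrow> h (b \<odot>\<^bsub>M\<^esub> x) = g b \<odot>\<^bsub>N\<^esub> h x"
  shows "h \<in> semilinear_hom B g M N"
  using assms by (simp add: semilinear_hom_def)

lemma semilinear_homD:
  assumes "h \<in> semilinear_hom B g M N"
  shows "h \<in> ring_hom M N" "b \<in> carrier B \<Longrightarrow> x \<in> carrier M \<Longrightarrow> h (b \<odot>\<^bsub>M\<^esub> x) = g b \<odot>\<^bsub>N\<^esub> h x"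
  using assms by (auto simp: semilinear_hom_def)

lemma semilinear_hom_comp:
  assumes "f \<in> semilinear_hom B g M N" "h \<in> semilinear_hom C g' N N'" "g \<in> carrier B \<rightarrow> carrier C"
  shows "(\<lambda>x. h (f x)) \<in> semilinear_hom B (\<lambda>b. g' (g b)) M N'"
proof (rule semilinear_homI)
  show "(\<lambda>x. h (f x)) \<in> ring_hom M N'"
    using ring_hom_trans[OF semilinear_homD(1)[OF assms(1)] semilinear_homD(1)[OF assms(2)]] by (simp add: o_def)
  fix b x assume "b \<in> carrier B" "x \<in> carrier M"
  then show "h (f (b \<odot>\<^bsub>M\<^esub> x)) = g' (g b) \<odot>\<^bsub>N'\<^esub> h (f x)"
    using assms(3) semilinear_homD(2)[OF assms(1)] semilinear_homD(2)[OF assms(2), of "g b" "f x"]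
      ring_hom_closed[OF semilinear_homD(1)[OF assms(1)]] by auto
qed

text \<open>
  In corresponding bases the matrix of \<open>f a\<close> is the image under \<open>g\<close> of the matrix of \<open>a\<close>. The lemma
  covers isomorphisms, the canonical map into an extension of scalars, and the maps between such
  extensions.
\<close>

lemma char_coeff_semilinear:
  assumes A: "algebra B A" and A': "algebra B' A'" and g: "g \<in> ring_hom B B'"
    and f: "f \<in> semilinear_hom B g A A'"
    and e: "module_basis B A n e" and e': "module_basis B' A' n (\<lambda>i. f (e i))"
    and a: "a \<in> carrier A" and j: "j \<le> n"
  shows "char_coeff B' A' n j (f a) = g (char_coeff B A n j a)"
proof -
  interpret A: algebra B A by fact
  interpret A': algebra B' A' by fact
  interpret g: ring_hom_cring B B' g using g by unfold_locales
  interpret f: ring_hom_cring A A' f using semilinear_homD(1)[OF f] by unfold_locales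
  interpret U': UP_cring B' "UP B'" by unfold_locales simp
  let ?M = "mult_matrix B A n e a"
  have Mc: "?M i j \<in> carrier B" if "i \<in> {1..n}" "j \<in> {1..n}" for i j
    using A.mult_matrix_closed[OF e a] that .
  have ec: "e i \<in> carrier A" if "i \<in> {1..n}" for i using A.basis_closed[OF e] that .
  have M': "mult_matrix B' A' n (\<lambda>i. f (e i)) (f a) i j = g (?M i j)" if ij: "i \<in> {1..n}" "j \<in> {1..n}" for i j
    unfolding mult_matrix_coord[of B']
  proof (rule A'.coord_unique[OF e'])
    have "f a \<otimes>\<^bsub>A'\<^esub> f (e j) = f (a \<otimes>\<^bsub>A\<^esub> e j)" using a ec[OF ij(2)] by simp
    also have "\<dots> = f (\<Oplus>\<^bsub>A\<^esub>i\<in>{1..n}. ?M i j \<odot>\<^bsub>A\<^esub> e i)"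
      using A.mult_matrix_expand[OF e a ij(2)] by simp
    also have "\<dots> = (\<Oplus>\<^bsub>A'\<^esub>i\<in>{1..n}. f (?M i j \<odot>\<^bsub>A\<^esub> e i))"
      using Mc ec ij by (subst f.hom_finsum) (auto simp: o_def)
    also have "\<dots> = (\<Oplus>\<^bsub>A'\<^esub>i\<in>{1..n}. g (?M i j) \<odot>\<^bsub>A'\<^esub> f (e i))"
      using Mc ec ij by (intro A'.M.finsum_cong') (auto simp: semilinear_homD(2)[OF f])
    finally show "f a \<otimes>\<^bsub>A'\<^esub> f (e j) = (\<Oplus>\<^bsub>A'\<^esub>i\<in>{1..n}. g (?M i j) \<odot>\<^bsub>A'\<^esub> f (e i))" .
  qed (use Mc ij in auto)
  have "char_coeff B' A' n j (f a) = mat_coeff B' n (mult_matrix B' A' n (\<lambda>i. f (e i)) (f a)) j"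
    using a by (intro A'.char_coeff_basis[OF e']) simp
  also have "\<dots> = mat_coeff B' n (\<lambda>i j. g (?M i j)) j"
  proof -
    have "ring_det (UP B') n (\<lambda>i j. (if i = j then monom (UP B') \<one>\<^bsub>B'\<^esub> 1 else \<zero>\<^bsub>UP B'\<^esub>)
        \<ominus>\<^bsub>UP B'\<^esub> monom (UP B') (mult_matrix B' A' n (\<lambda>i. f (e i)) (f a) i j) 0)
      = ring_det (UP B') n (\<lambda>i j. (if i = j then monom (UP B') \<one>\<^bsub>B'\<^esub> 1 else \<zero>\<^bsub>UP B'\<^esub>)
        \<ominus>\<^bsub>UP B'\<^esub> monom (UP B') (g (?M i j)) 0)"
      using M' Mc by (intro U'.P.ring_det_cong) auto
    then show ?thesis by (simp add: mat_coeff_def mat_char_poly_def)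
  qed
  also have "\<dots> = g (mat_coeff B n ?M j)" using Mc j by (intro g.hom_mat_coeff[symmetric]) auto
  also have "\<dots> = g (char_coeff B A n j a)" using A.char_coeff_basis[OF e a] by simp
  finally show ?thesis .
qed

section \<open>Agreement of determinant and norm on a spanning set\<close>

definition up_map :: "('e, 'k) ring_scheme \<Rightarrow> ('e \<Rightarrow> 'r) \<Rightarrow> (nat \<Rightarrow> 'e) \<Rightarrow> nat \<Rightarrow> 'r"
  where "up_map E h p = (\<lambda>m. h (coeff (UP E) p m))"

text \<open>
  Congruence modulo \<open>x\<^sup>N\<close>.
\<close>

definition agree_below :: "('r, 'k) ring_scheme \<Rightarrow> nat \<Rightarrow> (nat \<Rightarrow> 'r) \<Rightarrow> (nat \<Rightarrow> 'r) \<Rightarrow> bool"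
  where "agree_below R N p q \<longleftrightarrow> (\<forall>i<N. coeff (UP R) p i = coeff (UP R) q i)"

inductive_set add_span :: "('e, 'k) ring_scheme \<Rightarrow> 'e set \<Rightarrow> 'e set" for E T where
  zero: "\<zero>\<^bsub>E\<^esub> \<in> add_span E T"
| add: "x \<in> add_span E T \<Longrightarrow> t \<in> T \<Longrightarrow> x \<oplus>\<^bsub>E\<^esub> t \<in> add_span E T"

context UP_cring
begin

lemma agree_below_refl: "agree_below R N p p"
  by (simp add: agree_below_def)

lemma agree_below_sym: "agree_below R N p q \<Longrightarrow> agree_below R N q p"
  by (simp add: agree_below_def)

lemma agree_below_trans: "agree_below R N p q \<Longrightarrow> agree_below R N q r \<Longrightarrow> agree_below R N p r"
  by (simp add: agree_below_def)

lemma agree_below_mult: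
  assumes "p \<in> carrier P" "p' \<in> carrier P" "q \<in> carrier P" "q' \<in> carrier P"
    and "agree_below R N p p'" "agree_below R N q q'"
  shows "agree_below R N (p \<otimes>\<^bsub>P\<^esub> q) (p' \<otimes>\<^bsub>P\<^esub> q')"
  using assms unfolding agree_below_def P_def[symmetric]
  by (auto simp: coeff_mult intro!: R.finsum_cong')

lemma agree_below_a_inv:
  assumes "p \<in> carrier P" "p' \<in> carrier P" "agree_below R N p p'"
  shows "agree_below R N (\<ominus>\<^bsub>P\<^esub> p) (\<ominus>\<^bsub>P\<^esub> p')"
  using assms unfolding agree_below_def P_def[symmetric] by simp

lemma agree_below_finsum:
  assumes "finite I" "\<And>i. i \<in> I \<Longrightarrow> p i \<in> carrier P" "\<And>i. i \<in> I \<Longrightarrow> p' i \<in> carrier P"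
    and "\<And>i. i \<in> I \<Longrightarrow> agree_below R N (p i) (p' i)"
  shows "agree_below R N (\<Oplus>\<^bsub>P\<^esub>i\<in>I. p i) (\<Oplus>\<^bsub>P\<^esub>i\<in>I. p' i)"
  unfolding agree_below_def P_def[symmetric]
proof (intro allI impI)
  fix k assume k: "k < N"
  have "coeff P (\<Oplus>\<^bsub>P\<^esub>i\<in>I. p i) k = (\<Oplus>i\<in>I. coeff P (p i) k)"
    using assms by (intro coeff_finsum) auto
  also have "\<dots> = (\<Oplus>i\<in>I. coeff P (p' i) k)"
    using assms k unfolding agree_below_def P_def[symmetric] by (intro R.finsum_cong') auto
  also have "\<dots> = coeff P (\<Oplus>\<^bsub>P\<^esub>i\<in>I. p' i) k"
    using assms by (intro coeff_finsum[symmetric]) auto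
  finally show "coeff P (\<Oplus>\<^bsub>P\<^esub>i\<in>I. p i) k = coeff P (\<Oplus>\<^bsub>P\<^esub>i\<in>I. p' i) k" .
qed

lemma agree_below_finprod:
  assumes "finite I" "\<And>i. i \<in> I \<Longrightarrow> p i \<in> carrier P" "\<And>i. i \<in> I \<Longrightarrow> p' i \<in> carrier P"
    and "\<And>i. i \<in> I \<Longrightarrow> agree_below R N (p i) (p' i)"
  shows "agree_below R N (\<Otimes>\<^bsub>P\<^esub>i\<in>I. p i) (\<Otimes>\<^bsub>P\<^esub>i\<in>I. p' i)"
  using assms
  by (induction I rule: finite_induct)
    (auto simp: agree_below_refl Pi_def intro!: agree_below_mult P.finprod_closed)

lemma agree_below_ring_det:
  assumes M: "\<And>i j. i \<in> {1..n} \<Longrightarrow> j \<in> {1..n} \<Longrightarrow> M i j \<in> carrier P"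
    and M': "\<And>i j. i \<in> {1..n} \<Longrightarrow> j \<in> {1..n} \<Longrightarrow> M' i j \<in> carrier P"
    and a: "\<And>i j. i \<in> {1..n} \<Longrightarrow> j \<in> {1..n} \<Longrightarrow> agree_below R N (M i j) (M' i j)"
  shows "agree_below R N (ring_det P n M) (ring_det P n M')"
proof -
  have "agree_below R N (\<Otimes>\<^bsub>P\<^esub>i\<in>{1..n}. M i (p i)) (\<Otimes>\<^bsub>P\<^esub>i\<in>{1..n}. M' i (p i))" if "p permutes {1..n}" for p
    using M M' a permutes_in_image[OF that] by (intro agree_below_finprod) auto
  then show ?thesis
    unfolding ring_det_def
    using P.det_term_closed[of n M, OF M] P.det_term_closed[of n M', OF M']
    by (intro agree_below_finsum) (auto simp: finite_permutations intro!: agree_below_a_inv)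
qed

text \<open>
  A polynomial with constant term \<open>1\<close> is invertible modulo \<open>x\<^sup>N\<close>.
\<close>

lemma agree_below_cancel:
  assumes pq: "p \<in> carrier P" "q \<in> carrier P" and w: "w \<in> carrier P" "coeff P w 0 = \<one>"
    and a: "agree_below R N (p \<otimes>\<^bsub>P\<^esub> w) (q \<otimes>\<^bsub>P\<^esub> w)"
  shows "agree_below R N p q"
  unfolding agree_below_def P_def[symmetric]
proof (intro allI impI)
  fix i assume "i < N"
  then show "coeff P p i = coeff P q i"
  proof (induction i rule: less_induct)
    case (less i)
    have split: "coeff P (r \<otimes>\<^bsub>P\<^esub> w) i = coeff P r i \<oplus> (\<Oplus>l\<in>{..<i}. coeff P r l \<otimes> coeff P w (i - l))"
      if r: "r \<in> carrier P" for r
    proof -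
      have "coeff P (r \<otimes>\<^bsub>P\<^esub> w) i = (\<Oplus>l\<in>insert i {..<i}. coeff P r l \<otimes> coeff P w (i - l))"
        using r w by (simp add: coeff_mult ivl_disj_un_singleton(2)[symmetric])
      then show ?thesis using r w by (simp add: Pi_def)
    qed
    have "(\<Oplus>l\<in>{..<i}. coeff P p l \<otimes> coeff P w (i - l)) = (\<Oplus>l\<in>{..<i}. coeff P q l \<otimes> coeff P w (i - l))"
      using less pq w by (intro R.finsum_cong') auto
    moreover have "coeff P (p \<otimes>\<^bsub>P\<^esub> w) i = coeff P (q \<otimes>\<^bsub>P\<^esub> w) i"
      using a less.prems by (simp add: agree_below_def P_def)
    moreover have "(\<Oplus>l\<in>{..<i}. coeff P q l \<otimes> coeff P w (i - l)) \<in> carrier R"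
      using pq w by (intro R.finsum_closed) auto
    ultimately show ?case using split pq by simp
  qed
qed

lemma coeff_monom_mult_below:
  assumes "c \<in> carrier R" "p \<in> carrier P" "i < k"
  shows "coeff P (monom P c k \<otimes>\<^bsub>P\<^esub> p) i = \<zero>"
  using assms by (auto simp: coeff_mult intro!: R.add.finprod_one_eqI)

lemma coeff_mult_one_minus_monom:
  assumes "c \<in> carrier R" "p \<in> carrier P"
  shows "coeff P (p \<otimes>\<^bsub>P\<^esub> (\<one>\<^bsub>P\<^esub> \<ominus>\<^bsub>P\<^esub> monom P c k)) i
    = coeff P p i \<ominus> (if i < k then \<zero> else c \<otimes> coeff P p (i - k))"
proof -
  have "p \<otimes>\<^bsub>P\<^esub> (\<one>\<^bsub>P\<^esub> \<ominus>\<^bsub>P\<^esub> monom P c k) = p \<ominus>\<^bsub>P\<^esub> monom P c k \<otimes>\<^bsub>P\<^esub> p"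
    using assms by (simp add: P.minus_eq P.r_distr P.r_minus P.m_comm)
  then show ?thesis
    using assms coeff_monom_mult_below[of c p i k] coeff_monom_mult[of c p k "i - k"]
    by (auto simp: R.minus_eq)
qed

end

text \<open>
  A homomorphism \<open>\<rho>\<close> from \<open>E\<close> to the \<open>n \<times> n\<close> matrices over \<open>R\<close> and \<open>n\<close> homomorphisms \<open>\<phi>\<^sub>i\<close> from
  \<open>E\<close> to \<open>R\<close>. They give two multiplicative functions from \<open>E[x]\<close> to \<open>R[x]\<close>, the determinant of the
  matrix \<open>\<rho>(u)\<close> and the norm \<open>\<Prod>\<^sub>i \<phi>\<^sub>i(u)\<close>. \<open>EP\<close> and \<open>RP\<close> are \<open>E[x]\<close> and \<open>R[x]\<close>.
\<close>

locale det_norm_pair = E: cring E + R: cring R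
  for E :: "('e, 'k) ring_scheme" (structure) and R :: "('r, 'l) ring_scheme" (structure) +
  fixes n :: nat and \<rho> :: "'e \<Rightarrow> nat \<Rightarrow> nat \<Rightarrow> 'r" and \<phi> :: "nat \<Rightarrow> 'e \<Rightarrow> 'r"
  assumes rho_closed: "a \<in> carrier E \<Longrightarrow> i \<in> {1..n} \<Longrightarrow> j \<in> {1..n} \<Longrightarrow> \<rho> a i j \<in> carrier R"
    and rho_add: "a \<in> carrier E \<Longrightarrow> b \<in> carrier E \<Longrightarrow> i \<in> {1..n} \<Longrightarrow> j \<in> {1..n} \<Longrightarrow>
      \<rho> (a \<oplus>\<^bsub>E\<^esub> b) i j = \<rho> a i j \<oplus>\<^bsub>R\<^esub> \<rho> b i j"
    and rho_mult: "a \<in> carrier E \<Longrightarrow> b \<in> carrier E \<Longrightarrow> i \<in> {1..n} \<Longrightarrow> j \<in> {1..n} \<Longrightarrow>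
      \<rho> (a \<otimes>\<^bsub>E\<^esub> b) i j = (\<Oplus>\<^bsub>R\<^esub>k\<in>{1..n}. \<rho> a i k \<otimes>\<^bsub>R\<^esub> \<rho> b k j)"
    and rho_one: "i \<in> {1..n} \<Longrightarrow> j \<in> {1..n} \<Longrightarrow> \<rho> \<one>\<^bsub>E\<^esub> i j = (if i = j then \<one>\<^bsub>R\<^esub> else \<zero>\<^bsub>R\<^esub>)"
    and phi_hom: "i \<in> {1..n} \<Longrightarrow> \<phi> i \<in> ring_hom E R"
begin

sublocale UE: UP_cring E "UP E" by unfold_locales simp
sublocale UR: UP_cring R "UP R" by unfold_locales simp

abbreviation "EP \<equiv> UP E"
abbreviation "RP \<equiv> UP R"

definition mat_poly :: "(nat \<Rightarrow> 'e) \<Rightarrow> nat \<Rightarrow> nat \<Rightarrow> nat \<Rightarrow> 'r"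
  where "mat_poly u i j = up_map E (\<lambda>a. \<rho> a i j) u"

definition det_poly :: "(nat \<Rightarrow> 'e) \<Rightarrow> nat \<Rightarrow> 'r"
  where "det_poly u = ring_det RP n (mat_poly u)"

definition norm_poly :: "(nat \<Rightarrow> 'e) \<Rightarrow> nat \<Rightarrow> 'r"
  where "norm_poly u = (\<Otimes>\<^bsub>RP\<^esub>i\<in>{1..n}. up_map E (\<phi> i) u)"

lemma up_map_closed:
  assumes "\<And>a. a \<in> carrier E \<Longrightarrow> h a \<in> carrier R" "h \<zero>\<^bsub>E\<^esub> = \<zero>\<^bsub>R\<^esub>" "u \<in> carrier EP"
  shows "up_map E h u \<in> carrier RP"
proof -
  have "bound \<zero>\<^bsub>R\<^esub> (deg E u) (up_map E h u)"
    using UE.deg_aboveD assms(2,3) by (auto simp: bound_def up_map_def)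
  moreover have "up_map E h u m \<in> carrier R" for m
    using assms by (simp add: up_map_def)
  ultimately show ?thesis by (auto simp: UP_def)
qed

lemma coeff_up_map:
  assumes "\<And>a. a \<in> carrier E \<Longrightarrow> h a \<in> carrier R" "h \<zero>\<^bsub>E\<^esub> = \<zero>\<^bsub>R\<^esub>" "u \<in> carrier EP"
  shows "coeff RP (up_map E h u) m = h (coeff EP u m)"
  using up_map_closed[of h u, OF assms] by (simp add: UP_def) (simp add: up_map_def UP_def)

lemma rho_zero:
  assumes "i \<in> {1..n}" "j \<in> {1..n}"
  shows "\<rho> \<zero>\<^bsub>E\<^esub> i j = \<zero>\<^bsub>R\<^esub>"
proof -
  have "\<rho> \<zero>\<^bsub>E\<^esub> i j \<oplus>\<^bsub>R\<^esub> \<rho> \<zero>\<^bsub>E\<^esub> i j = \<rho> \<zero>\<^bsub>E\<^esub> i j"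
    using rho_add[of "\<zero>\<^bsub>E\<^esub>" "\<zero>\<^bsub>E\<^esub>" i j] assms by simp
  then show ?thesis using rho_closed assms by (metis E.zero_closed R.add.l_cancel_one')
qed

lemma rho_finsum:
  assumes "finite I" "\<And>l. l \<in> I \<Longrightarrow> f l \<in> carrier E" and ij: "i \<in> {1..n}" "j \<in> {1..n}"
  shows "\<rho> (\<Oplus>\<^bsub>E\<^esub>l\<in>I. f l) i j = (\<Oplus>\<^bsub>R\<^esub>l\<in>I. \<rho> (f l) i j)"
  using assms(1,2)
  by (induction I rule: finite_induct)
    (use ij rho_zero rho_add rho_closed in \<open>auto simp: Pi_def E.finsum_closed\<close>)

lemma mat_poly_closed:
  "u \<in> carrier EP \<Longrightarrow> i \<in> {1..n} \<Longrightarrow> j \<in> {1..n} \<Longrightarrow> mat_poly u i j \<in> carrier RP"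
  unfolding mat_poly_def using rho_closed rho_zero by (intro up_map_closed) auto

lemma coeff_mat_poly:
  "u \<in> carrier EP \<Longrightarrow> i \<in> {1..n} \<Longrightarrow> j \<in> {1..n} \<Longrightarrow> coeff RP (mat_poly u i j) m = \<rho> (coeff EP u m) i j"
  unfolding mat_poly_def using rho_closed rho_zero by (intro coeff_up_map) auto

lemma phi_closed: "i \<in> {1..n} \<Longrightarrow> a \<in> carrier E \<Longrightarrow> \<phi> i a \<in> carrier R"
  using phi_hom by (rule ring_hom_closed)

lemma phi_zero: "i \<in> {1..n} \<Longrightarrow> \<phi> i \<zero>\<^bsub>E\<^esub> = \<zero>\<^bsub>R\<^esub>"
  using ring_hom_zero[OF phi_hom E.ring_axioms R.ring_axioms] .

lemma phi_poly_closed: "u \<in> carrier EP \<Longrightarrow> i \<in> {1..n} \<Longrightarrow> up_map E (\<phi> i) u \<in> carrier RP"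
  using phi_closed phi_zero by (intro up_map_closed) auto

lemma coeff_phi_poly:
  "u \<in> carrier EP \<Longrightarrow> i \<in> {1..n} \<Longrightarrow> coeff RP (up_map E (\<phi> i) u) m = \<phi> i (coeff EP u m)"
  using phi_closed phi_zero by (intro coeff_up_map) auto

lemma det_poly_closed: "u \<in> carrier EP \<Longrightarrow> det_poly u \<in> carrier RP"
  unfolding det_poly_def by (rule UR.P.ring_det_closed) (rule mat_poly_closed)

lemma norm_poly_closed: "u \<in> carrier EP \<Longrightarrow> norm_poly u \<in> carrier RP"
  unfolding norm_poly_def using phi_poly_closed by (intro UR.P.finprod_closed) auto

lemma mat_poly_mult:
  assumes u: "u \<in> carrier EP" and v: "v \<in> carrier EP" and ij: "i \<in> {1..n}" "j \<in> {1..n}"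
  shows "mat_poly (u \<otimes>\<^bsub>EP\<^esub> v) i j = (\<Oplus>\<^bsub>RP\<^esub>k\<in>{1..n}. mat_poly u i k \<otimes>\<^bsub>RP\<^esub> mat_poly v k j)"
proof (rule UR.up_eqI)
  fix m
  let ?u = "coeff EP u" and ?v = "coeff EP v"
  have uv: "?u l \<in> carrier E" "?v l \<in> carrier E" for l using u v by auto
  have "coeff RP (mat_poly (u \<otimes>\<^bsub>EP\<^esub> v) i j) m = \<rho> (\<Oplus>\<^bsub>E\<^esub>l\<in>{..m}. ?u l \<otimes>\<^bsub>E\<^esub> ?v (m - l)) i j"
    using u v ij by (simp add: coeff_mat_poly UE.coeff_mult)
  also have "\<dots> = (\<Oplus>\<^bsub>R\<^esub>l\<in>{..m}. \<rho> (?u l \<otimes>\<^bsub>E\<^esub> ?v (m - l)) i j)"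
    using uv ij by (intro rho_finsum) auto
  also have "\<dots> = (\<Oplus>\<^bsub>R\<^esub>l\<in>{..m}. \<Oplus>\<^bsub>R\<^esub>k\<in>{1..n}. \<rho> (?u l) i k \<otimes>\<^bsub>R\<^esub> \<rho> (?v (m - l)) k j)"
    using uv ij rho_closed rho_mult by (intro R.finsum_cong') (auto intro!: R.finsum_closed)
  also have "\<dots> = (\<Oplus>\<^bsub>R\<^esub>k\<in>{1..n}. \<Oplus>\<^bsub>R\<^esub>l\<in>{..m}. \<rho> (?u l) i k \<otimes>\<^bsub>R\<^esub> \<rho> (?v (m - l)) k j)"
    using uv ij rho_closed by (intro R.add.finprod_swap) auto
  also have "\<dots> = (\<Oplus>\<^bsub>R\<^esub>k\<in>{1..n}. coeff RP (mat_poly u i k \<otimes>\<^bsub>RP\<^esub> mat_poly v k j) m)"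
    using u v ij rho_closed uv mat_poly_closed
    by (intro R.finsum_cong') (auto simp: coeff_mat_poly UR.coeff_mult intro!: R.finsum_closed)
  also have "\<dots> = coeff RP (\<Oplus>\<^bsub>RP\<^esub>k\<in>{1..n}. mat_poly u i k \<otimes>\<^bsub>RP\<^esub> mat_poly v k j) m"
    using u v ij mat_poly_closed by (intro UR.coeff_finsum[symmetric]) auto
  finally show "coeff RP (mat_poly (u \<otimes>\<^bsub>EP\<^esub> v) i j) m
    = coeff RP (\<Oplus>\<^bsub>RP\<^esub>k\<in>{1..n}. mat_poly u i k \<otimes>\<^bsub>RP\<^esub> mat_poly v k j) m" .
qed (use u v ij mat_poly_closed in \<open>auto intro!: UR.P.finsum_closed\<close>)

lemma det_poly_mult:
  assumes u: "u \<in> carrier EP" and v: "v \<in> carrier EP"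
  shows "det_poly (u \<otimes>\<^bsub>EP\<^esub> v) = det_poly u \<otimes>\<^bsub>RP\<^esub> det_poly v"
proof -
  have "det_poly (u \<otimes>\<^bsub>EP\<^esub> v) = ring_det RP n (\<lambda>i j. \<Oplus>\<^bsub>RP\<^esub>k\<in>{1..n}. mat_poly u i k \<otimes>\<^bsub>RP\<^esub> mat_poly v k j)"
    unfolding det_poly_def using u v mat_poly_closed
    by (intro UR.P.ring_det_cong mat_poly_mult) (auto intro!: UR.P.finsum_closed)
  also have "\<dots> = det_poly u \<otimes>\<^bsub>RP\<^esub> det_poly v"
    unfolding det_poly_def using u v mat_poly_closed by (intro UR.P.ring_det_mult) auto
  finally show ?thesis .
qed

lemma norm_poly_mult:
  assumes u: "u \<in> carrier EP" and v: "v \<in> carrier EP"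
  shows "norm_poly (u \<otimes>\<^bsub>EP\<^esub> v) = norm_poly u \<otimes>\<^bsub>RP\<^esub> norm_poly v"
proof -
  have "up_map E (\<phi> i) (u \<otimes>\<^bsub>EP\<^esub> v) = up_map E (\<phi> i) u \<otimes>\<^bsub>RP\<^esub> up_map E (\<phi> i) v" if i: "i \<in> {1..n}" for i
  proof (rule UR.up_eqI)
    interpret \<phi>: ring_hom_cring E R "\<phi> i" using phi_hom[OF i] by unfold_locales
    fix m
    have "coeff RP (up_map E (\<phi> i) (u \<otimes>\<^bsub>EP\<^esub> v)) m = \<phi> i (\<Oplus>\<^bsub>E\<^esub>l\<in>{..m}. coeff EP u l \<otimes>\<^bsub>E\<^esub> coeff EP v (m - l))"
      using u v i by (simp add: coeff_phi_poly UE.coeff_mult)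
    also have "\<dots> = (\<Oplus>\<^bsub>R\<^esub>l\<in>{..m}. \<phi> i (coeff EP u l) \<otimes>\<^bsub>R\<^esub> \<phi> i (coeff EP v (m - l)))"
      using u v by (subst \<phi>.hom_finsum) (auto simp: o_def intro!: R.finsum_cong')
    also have "\<dots> = coeff RP (up_map E (\<phi> i) u \<otimes>\<^bsub>RP\<^esub> up_map E (\<phi> i) v) m"
      using u v i by (simp add: coeff_phi_poly UR.coeff_mult phi_poly_closed)
    finally show "coeff RP (up_map E (\<phi> i) (u \<otimes>\<^bsub>EP\<^esub> v)) m
      = coeff RP (up_map E (\<phi> i) u \<otimes>\<^bsub>RP\<^esub> up_map E (\<phi> i) v) m" .
  qed (use u v i phi_poly_closed in auto)
  then have "norm_poly (u \<otimes>\<^bsub>EP\<^esub> v) = (\<Otimes>\<^bsub>RP\<^esub>i\<in>{1..n}. up_map E (\<phi> i) u \<otimes>\<^bsub>RP\<^esub> up_map E (\<phi> i) v)"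
    unfolding norm_poly_def using u v phi_poly_closed by (intro UR.P.finprod_cong') auto
  also have "\<dots> = norm_poly u \<otimes>\<^bsub>RP\<^esub> norm_poly v"
    unfolding norm_poly_def using u v phi_poly_closed by (intro UR.P.finprod_multf) auto
  finally show ?thesis .
qed

lemma det_poly_agree:
  assumes "u \<in> carrier EP" "v \<in> carrier EP" "agree_below E N u v"
  shows "agree_below R N (det_poly u) (det_poly v)"
  unfolding det_poly_def using assms mat_poly_closed
  by (intro UR.agree_below_ring_det) (auto simp: agree_below_def coeff_mat_poly)

lemma norm_poly_agree:
  assumes "u \<in> carrier EP" "v \<in> carrier EP" "agree_below E N u v"
  shows "agree_below R N (norm_poly u) (norm_poly v)"
  unfolding norm_poly_def using assms phi_poly_closed
  by (intro UR.agree_below_finprod) (auto simp: agree_below_def coeff_phi_poly)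

lemma det_poly_one: "det_poly \<one>\<^bsub>EP\<^esub> = \<one>\<^bsub>RP\<^esub>"
proof -
  have "det_poly \<one>\<^bsub>EP\<^esub> = ring_det RP n (\<lambda>i j. if i = j then \<one>\<^bsub>RP\<^esub> else \<zero>\<^bsub>RP\<^esub>)"
    unfolding det_poly_def
    by (intro UR.P.ring_det_cong UR.up_eqI)
      (auto simp: coeff_mat_poly rho_one rho_zero mat_poly_closed)
  then show ?thesis by (simp add: UR.P.ring_det_one)
qed

lemma norm_poly_one: "norm_poly \<one>\<^bsub>EP\<^esub> = \<one>\<^bsub>RP\<^esub>"
proof -
  have "up_map E (\<phi> i) \<one>\<^bsub>EP\<^esub> = \<one>\<^bsub>RP\<^esub>" if i: "i \<in> {1..n}" for i
    using i phi_poly_closed phi_zero ring_hom_one[OF phi_hom]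
    by (intro UR.up_eqI) (auto simp: coeff_phi_poly)
  then show ?thesis unfolding norm_poly_def by (intro UR.P.finprod_one_eqI)
qed

text \<open>
  By downward induction on \<open>k\<close>, the two functions agree modulo \<open>x\<^sup>N\<close> on the polynomials that are \<open>1\<close>
  modulo \<open>x\<^sup>k\<close>. For \<open>k = N\<close> both values are \<open>1\<close>. In the step, an inner induction removes the summands of
  the coefficient of \<open>x\<^sup>k\<close> one by one.
\<close>

lemma det_poly_eq_norm_poly_if_generated:
  assumes T: "T \<subseteq> carrier E"
    and eq: "\<And>t k. t \<in> T \<Longrightarrow> k \<ge> 1 \<Longrightarrow>
      det_poly (\<one>\<^bsub>EP\<^esub> \<ominus>\<^bsub>EP\<^esub> monom EP t k) = norm_poly (\<one>\<^bsub>EP\<^esub> \<ominus>\<^bsub>EP\<^esub> monom EP t k)"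
    and span: "carrier E \<subseteq> add_span E T"
    and u: "u \<in> carrier EP" "coeff EP u 0 = \<one>\<^bsub>E\<^esub>"
  shows "agree_below R N (det_poly u) (norm_poly u)"
proof -
  have claim: "\<forall>u\<in>carrier EP. agree_below E k u \<one>\<^bsub>EP\<^esub> \<longrightarrow> agree_below R N (det_poly u) (norm_poly u)"
    if "k \<le> N" "1 \<le> k" for k
    using that
  proof (induction k rule: inc_induct)
    case base
    show ?case
    proof (intro ballI impI)
      fix u assume "u \<in> carrier EP" "agree_below E N u \<one>\<^bsub>EP\<^esub>"
      then have "agree_below R N (det_poly u) \<one>\<^bsub>RP\<^esub>" "agree_below R N (norm_poly u) \<one>\<^bsub>RP\<^esub>"
        using det_poly_agree[of u "\<one>\<^bsub>EP\<^esub>" N] norm_poly_agree[of u "\<one>\<^bsub>EP\<^esub>" N]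
        by (simp_all add: det_poly_one norm_poly_one)
      then show "agree_below R N (det_poly u) (norm_poly u)"
        using UR.agree_below_sym UR.agree_below_trans by blast
    qed
  next
    case (step k)
    have *: "\<forall>u\<in>carrier EP. agree_below E k u \<one>\<^bsub>EP\<^esub> \<longrightarrow> coeff EP u k = \<alpha>
        \<longrightarrow> agree_below R N (det_poly u) (norm_poly u)" if "\<alpha> \<in> add_span E T" for \<alpha>
      using that
    proof induction
      case zero
      show ?case
      proof (intro ballI impI)
        fix u assume u: "u \<in> carrier EP" "agree_below E k u \<one>\<^bsub>EP\<^esub>" "coeff EP u k = \<zero>\<^bsub>E\<^esub>"
        then have "agree_below E (Suc k) u \<one>\<^bsub>EP\<^esub>"
          using step.prems by (auto simp: agree_below_def less_Suc_eq)
        then show "agree_below R N (det_poly u) (norm_poly u)" using step.IH u by simp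
      qed
    next
      case (add \<alpha> t)
      show ?case
      proof (intro ballI impI)
        fix u assume u: "u \<in> carrier EP" "agree_below E k u \<one>\<^bsub>EP\<^esub>" "coeff EP u k = \<alpha> \<oplus>\<^bsub>E\<^esub> t"
        \<comment> \<open>Multiplication by \<open>1 - t x\<^sup>k\<close> subtracts \<open>t\<close> from the coefficient of \<open>x\<^sup>k\<close>.\<close>
        let ?v = "\<one>\<^bsub>EP\<^esub> \<ominus>\<^bsub>EP\<^esub> monom EP t k"
        have t: "t \<in> carrier E" using add T by auto
        have \<alpha>: "\<alpha> \<in> carrier E" using add.hyps(1) T by (induction) auto
        have v: "?v \<in> carrier EP" using t by simp
        have u0: "coeff EP u 0 = \<one>\<^bsub>E\<^esub>"
          using u(2) step.prems by (auto simp: agree_below_def)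
        have c: "coeff EP (u \<otimes>\<^bsub>EP\<^esub> ?v) i = coeff EP u i \<ominus>\<^bsub>E\<^esub> (if i < k then \<zero>\<^bsub>E\<^esub> else t \<otimes>\<^bsub>E\<^esub> coeff EP u (i - k))" for i
          using t u(1) by (rule UE.coeff_mult_one_minus_monom)
        have "agree_below E k (u \<otimes>\<^bsub>EP\<^esub> ?v) \<one>\<^bsub>EP\<^esub>"
          using u(1,2) by (auto simp: agree_below_def c E.minus_eq)
        moreover have "coeff EP (u \<otimes>\<^bsub>EP\<^esub> ?v) k = \<alpha>"
          using u(3) u0 t \<alpha> by (simp add: c E.minus_eq E.a_assoc E.r_neg)
        ultimately have "agree_below R N (det_poly (u \<otimes>\<^bsub>EP\<^esub> ?v)) (norm_poly (u \<otimes>\<^bsub>EP\<^esub> ?v))"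
          using add.IH u(1) v by blast
        moreover have "det_poly ?v = norm_poly ?v" using eq add.hyps(2) step.prems by simp
        ultimately have a: "agree_below R N (det_poly u \<otimes>\<^bsub>RP\<^esub> norm_poly ?v) (norm_poly u \<otimes>\<^bsub>RP\<^esub> norm_poly ?v)"
          using u(1) v by (simp add: det_poly_mult norm_poly_mult)
        have "agree_below E 1 ?v \<one>\<^bsub>EP\<^esub>"
          using t step.prems by (auto simp: agree_below_def E.minus_eq)
        then have "agree_below R 1 (norm_poly ?v) \<one>\<^bsub>RP\<^esub>"
          using norm_poly_agree[OF v, of "\<one>\<^bsub>EP\<^esub>" 1] by (simp add: norm_poly_one)
        then have "coeff RP (norm_poly ?v) 0 = \<one>\<^bsub>R\<^esub>" by (simp add: agree_below_def)
        then show "agree_below R N (det_poly u) (norm_poly u)"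
          using a u(1) v by (intro UR.agree_below_cancel[OF _ _ _ _ a]) (auto intro: det_poly_closed norm_poly_closed)
      qed
    qed
    have "coeff EP u k \<in> add_span E T" if "u \<in> carrier EP" for u
      using that span by auto
    then show ?case using * by blast
  qed
  show ?thesis
  proof (cases "N = 0")
    case True
    then show ?thesis by (simp add: agree_below_def)
  next
    case False
    then show ?thesis using claim[of 1] u by (simp add: agree_below_def)
  qed
qed

end

text \<open>
  The relations \<open>s\<^sub>j(\<alpha>) = e\<^sub>j(\<phi>\<^sub>1(\<alpha>), \<dots>, \<phi>\<^sub>n(\<alpha>))\<close> extend from elements that span \<open>E\<close> as a
  \<open>C\<close>-module to all of \<open>E\<close>. The matrices are the multiplication matrices, with entries mapped to \<open>N\<close>.
  For \<open>1 - c s x\<^sup>k\<close>, determinant and norm are \<open>\<Sum>\<^sub>j s\<^sub>j(s) (-c x\<^sup>k)\<^sup>j\<close> and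
  \<open>\<Sum>\<^sub>j e\<^sub>j(\<phi>(s)) (-c x\<^sup>k)\<^sup>j\<close>. These formulas give the agreement on the generators, and for \<open>k = 1\<close>,
  \<open>c = 1\<close> and \<open>s = \<alpha>\<close> they turn the agreement on \<open>1 - \<alpha> x\<close> into the relations for \<open>\<alpha>\<close>.
\<close>

theorem char_relations_if_spanning:
  assumes E: "algebra C E" and e: "module_basis C E n e" and N: "algebra C N"
    and \<phi>: "\<And>i. i \<in> {1..n} \<Longrightarrow> \<phi> i \<in> algebra_hom C E N"
    and S: "S \<subseteq> carrier E" and span: "carrier E \<subseteq> add_span E {c \<odot>\<^bsub>E\<^esub> s | c s. c \<in> carrier C \<and> s \<in> S}"
    and rel: "\<And>s j. s \<in> S \<Longrightarrow> j \<in> {1..n} \<Longrightarrow> char_coeff C E n j s \<odot>\<^bsub>N\<^esub> \<one>\<^bsub>N\<^esub> = elem_sym N n (\<lambda>i. \<phi> i s) j"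
    and a: "a \<in> carrier E" and j: "j \<in> {1..n}"
  shows "char_coeff C E n j a \<odot>\<^bsub>N\<^esub> \<one>\<^bsub>N\<^esub> = elem_sym N n (\<lambda>i. \<phi> i a) j"
proof -
  interpret E: algebra C E by fact
  interpret N: algebra C N by fact
  let ?\<psi> = "\<lambda>c. c \<odot>\<^bsub>N\<^esub> \<one>\<^bsub>N\<^esub>"
  let ?m = "mult_matrix C E n e"
  let ?NX = "UP N" let ?EP = "UP E"
  interpret \<psi>: ring_hom_cring C N ?\<psi> using N.structure_map_hom by unfold_locales
  interpret UC: UP_cring C "UP C" by unfold_locales simp
  have \<phi>_hom: "\<phi> i \<in> ring_hom E N" and \<phi>_smult: "\<And>c x. c \<in> carrier C \<Longrightarrow> x \<in> carrier E \<Longrightarrow> \<phi> i (c \<odot>\<^bsub>E\<^esub> x) = c \<odot>\<^bsub>N\<^esub> \<phi> i x"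
    if "i \<in> {1..n}" for i
    using \<phi>[OF that] by (auto simp: algebra_hom_def)
  have mc: "?m x i j \<in> carrier C" if "x \<in> carrier E" "i \<in> {1..n}" "j \<in> {1..n}" for x i j
    using E.mult_matrix_closed[OF e that] .
  interpret D: det_norm_pair E N n "\<lambda>x i j. ?\<psi> (?m x i j)" \<phi>
  proof unfold_locales
    fix x y i j assume x: "x \<in> carrier E" "y \<in> carrier E" and ij: "i \<in> {1..n}" "j \<in> {1..n}"
    show "?\<psi> (?m (x \<oplus>\<^bsub>E\<^esub> y) i j) = ?\<psi> (?m x i j) \<oplus>\<^bsub>N\<^esub> ?\<psi> (?m y i j)"
      unfolding E.mult_matrix_add[OF e x ij] using x ij mc by (intro \<psi>.hom_add) auto
    have "?\<psi> (?m (x \<otimes>\<^bsub>E\<^esub> y) i j) = ?\<psi> (\<Oplus>\<^bsub>C\<^esub>k\<in>{1..n}. ?m x i k \<otimes>\<^bsub>C\<^esub> ?m y k j)"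
      using x ij by (simp only: E.mult_matrix_mult[OF e])
    also have "\<dots> = (\<Oplus>\<^bsub>N\<^esub>k\<in>{1..n}. ?\<psi> (?m x i k \<otimes>\<^bsub>C\<^esub> ?m y k j))"
      using x ij mc by (subst \<psi>.hom_finsum) (auto simp: o_def)
    also have "\<dots> = (\<Oplus>\<^bsub>N\<^esub>k\<in>{1..n}. ?\<psi> (?m x i k) \<otimes>\<^bsub>N\<^esub> ?\<psi> (?m y k j))"
      using x ij mc by (intro N.M.finsum_cong' \<psi>.hom_mult) (auto intro!: N.m_closed)
    finally show "?\<psi> (?m (x \<otimes>\<^bsub>E\<^esub> y) i j) = (\<Oplus>\<^bsub>N\<^esub>k\<in>{1..n}. ?\<psi> (?m x i k) \<otimes>\<^bsub>N\<^esub> ?\<psi> (?m y k j))" .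
  qed (use mc \<phi>_hom E.mult_matrix_one[OF e] in auto)
  have det: "D.det_poly (\<one>\<^bsub>?EP\<^esub> \<ominus>\<^bsub>?EP\<^esub> monom ?EP (c \<odot>\<^bsub>E\<^esub> s) k)
      = (\<Oplus>\<^bsub>?NX\<^esub>j\<in>{..n}. monom ?NX (?\<psi> (char_coeff C E n j s)) 0 \<otimes>\<^bsub>?NX\<^esub> (\<ominus>\<^bsub>?NX\<^esub> monom ?NX (?\<psi> c) k) [^]\<^bsub>?NX\<^esub> j)"
    if c: "c \<in> carrier C" and s: "s \<in> carrier E" and k: "k \<ge> 1" for c s k
  proof -
    let ?y = "monom ?NX (?\<psi> c) k"
    have k': "(\<lambda>c. monom ?NX (?\<psi> c) 0) \<in> ring_hom C ?NX"
      using ring_hom_trans[OF N.structure_map_hom D.UR.const_ring_hom] by (simp add: o_def)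
    interpret L: UP_pre_univ_prop C ?NX "\<lambda>c. monom ?NX (?\<psi> c) 0" "UP C"
      using k' by unfold_locales
    have u: "\<one>\<^bsub>?EP\<^esub> \<ominus>\<^bsub>?EP\<^esub> monom ?EP (c \<odot>\<^bsub>E\<^esub> s) k \<in> carrier ?EP" using c s by simp
    have ent: "D.mat_poly (\<one>\<^bsub>?EP\<^esub> \<ominus>\<^bsub>?EP\<^esub> monom ?EP (c \<odot>\<^bsub>E\<^esub> s) k) i j
      = (if i = j then \<one>\<^bsub>?NX\<^esub> else \<zero>\<^bsub>?NX\<^esub>) \<ominus>\<^bsub>?NX\<^esub> ?y \<otimes>\<^bsub>?NX\<^esub> monom ?NX (?\<psi> (?m s i j)) 0"
      if ij: "i \<in> {1..n}" "j \<in> {1..n}" for i j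
    proof (rule D.UR.up_eqI)
      fix l
      have cs: "c \<odot>\<^bsub>E\<^esub> s \<in> carrier E" using c s by simp
      have "?y \<otimes>\<^bsub>?NX\<^esub> monom ?NX (?\<psi> (?m s i j)) 0 = monom ?NX (?\<psi> (?m (c \<odot>\<^bsub>E\<^esub> s) i j)) k"
        using c s ij mc \<psi>.hom_mult[of c "?m s i j"]
        by (simp add: E.mult_matrix_smult[OF e] flip: D.UR.monom_mult)
      moreover have "?\<psi> (?m (\<ominus>\<^bsub>E\<^esub> (c \<odot>\<^bsub>E\<^esub> s)) i j) = \<ominus>\<^bsub>N\<^esub> ?\<psi> (?m (c \<odot>\<^bsub>E\<^esub> s) i j)"
      proof -
        have "?\<psi> (?m (c \<odot>\<^bsub>E\<^esub> s) i j) \<oplus>\<^bsub>N\<^esub> ?\<psi> (?m (\<ominus>\<^bsub>E\<^esub> (c \<odot>\<^bsub>E\<^esub> s)) i j) = \<zero>\<^bsub>N\<^esub>"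
          using D.rho_add[of "c \<odot>\<^bsub>E\<^esub> s" "\<ominus>\<^bsub>E\<^esub> (c \<odot>\<^bsub>E\<^esub> s)" i j] D.rho_zero[OF ij] cs ij
          by (simp add: E.M.r_neg)
        then show ?thesis using D.rho_closed cs ij N.M.minus_equality N.M.add.m_comm
          by (metis E.M.a_inv_closed)
      qed
      ultimately show "coeff ?NX (D.mat_poly (\<one>\<^bsub>?EP\<^esub> \<ominus>\<^bsub>?EP\<^esub> monom ?EP (c \<odot>\<^bsub>E\<^esub> s) k) i j) l
        = coeff ?NX ((if i = j then \<one>\<^bsub>?NX\<^esub> else \<zero>\<^bsub>?NX\<^esub>) \<ominus>\<^bsub>?NX\<^esub> ?y \<otimes>\<^bsub>?NX\<^esub> monom ?NX (?\<psi> (?m s i j)) 0) l"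
        using ij cs k mc[OF cs ij]
        by (auto simp: D.coeff_mat_poly[OF u] D.rho_one D.rho_zero E.M.minus_eq N.M.minus_eq)
    qed (use c s ij mc D.mat_poly_closed[OF u] in auto)
    have "D.det_poly (\<one>\<^bsub>?EP\<^esub> \<ominus>\<^bsub>?EP\<^esub> monom ?EP (c \<odot>\<^bsub>E\<^esub> s) k)
      = ring_det ?NX n (\<lambda>i j. (if i = j then \<one>\<^bsub>?NX\<^esub> else \<zero>\<^bsub>?NX\<^esub>) \<ominus>\<^bsub>?NX\<^esub> ?y \<otimes>\<^bsub>?NX\<^esub> monom ?NX (?\<psi> (?m s i j)) 0)"
      unfolding D.det_poly_def using ent mc[OF s] c by (intro D.UR.P.ring_det_cong) auto
    also have "\<dots> = (\<Oplus>\<^bsub>?NX\<^esub>j\<in>{..n}. monom ?NX (?\<psi> (mat_coeff C n (?m s) j)) 0 \<otimes>\<^bsub>?NX\<^esub> (\<ominus>\<^bsub>?NX\<^esub> ?y) [^]\<^bsub>?NX\<^esub> j)"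
      using mc[OF s] c by (intro L.det_one_minus) auto
    finally show ?thesis by (simp add: E.char_coeff_basis[OF e s])
  qed
  have norm: "D.norm_poly (\<one>\<^bsub>?EP\<^esub> \<ominus>\<^bsub>?EP\<^esub> monom ?EP (c \<odot>\<^bsub>E\<^esub> s) k)
      = (\<Oplus>\<^bsub>?NX\<^esub>j\<in>{..n}. monom ?NX (elem_sym N n (\<lambda>i. \<phi> i s) j) 0 \<otimes>\<^bsub>?NX\<^esub> (\<ominus>\<^bsub>?NX\<^esub> monom ?NX (?\<psi> c) k) [^]\<^bsub>?NX\<^esub> j)"
    if c: "c \<in> carrier C" and s: "s \<in> carrier E" and k: "k \<ge> 1" for c s k
  proof -
    let ?y = "monom ?NX (?\<psi> c) k"
    interpret K: ring_hom_cring N ?NX "\<lambda>c. monom ?NX c 0"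
      using D.UR.const_ring_hom by unfold_locales
    have u: "\<one>\<^bsub>?EP\<^esub> \<ominus>\<^bsub>?EP\<^esub> monom ?EP (c \<odot>\<^bsub>E\<^esub> s) k \<in> carrier ?EP" using c s by simp
    have ent: "up_map E (\<phi> i) (\<one>\<^bsub>?EP\<^esub> \<ominus>\<^bsub>?EP\<^esub> monom ?EP (c \<odot>\<^bsub>E\<^esub> s) k)
      = \<one>\<^bsub>?NX\<^esub> \<ominus>\<^bsub>?NX\<^esub> ?y \<otimes>\<^bsub>?NX\<^esub> monom ?NX (\<phi> i s) 0" if i: "i \<in> {1..n}" for i
    proof (rule D.UR.up_eqI)
      interpret \<phi>: ring_hom_cring E N "\<phi> i" using \<phi>_hom[OF i] by unfold_locales
      fix l
      have "?y \<otimes>\<^bsub>?NX\<^esub> monom ?NX (\<phi> i s) 0 = monom ?NX (\<phi> i (c \<odot>\<^bsub>E\<^esub> s)) k"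
        using c s i D.phi_closed[OF i s] N.smult_eq_mult[of c "\<phi> i s"]
        by (simp add: \<phi>_smult flip: D.UR.monom_mult)
      then show "coeff ?NX (up_map E (\<phi> i) (\<one>\<^bsub>?EP\<^esub> \<ominus>\<^bsub>?EP\<^esub> monom ?EP (c \<odot>\<^bsub>E\<^esub> s) k)) l
        = coeff ?NX (\<one>\<^bsub>?NX\<^esub> \<ominus>\<^bsub>?NX\<^esub> ?y \<otimes>\<^bsub>?NX\<^esub> monom ?NX (\<phi> i s) 0) l"
        using c s k by (auto simp: D.coeff_phi_poly[OF u i] E.M.minus_eq N.M.minus_eq)
    qed (use c s i D.phi_poly_closed[OF u i] D.phi_closed in auto)
    have "D.norm_poly (\<one>\<^bsub>?EP\<^esub> \<ominus>\<^bsub>?EP\<^esub> monom ?EP (c \<odot>\<^bsub>E\<^esub> s) k)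
      = (\<Otimes>\<^bsub>?NX\<^esub>i\<in>{1..n}. \<one>\<^bsub>?NX\<^esub> \<ominus>\<^bsub>?NX\<^esub> ?y \<otimes>\<^bsub>?NX\<^esub> monom ?NX (\<phi> i s) 0)"
      unfolding D.norm_poly_def using ent c s D.phi_closed by (intro D.UR.P.finprod_cong') auto
    also have "\<dots> = (\<Oplus>\<^bsub>?NX\<^esub>j\<in>{..n}. elem_sym ?NX n (\<lambda>i. monom ?NX (\<phi> i s) 0) j \<otimes>\<^bsub>?NX\<^esub> (\<ominus>\<^bsub>?NX\<^esub> ?y) [^]\<^bsub>?NX\<^esub> j)"
      using c s D.phi_closed by (intro D.UR.P.finprod_one_minus) auto
    also have "elem_sym ?NX n (\<lambda>i. monom ?NX (\<phi> i s) 0) = (\<lambda>j. monom ?NX (elem_sym N n (\<lambda>i. \<phi> i s) j) 0)"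
      using s D.phi_closed by (intro ext K.hom_elem_sym[symmetric]) auto
    finally show ?thesis .
  qed
  have cc: "?\<psi> (char_coeff C E n j x) \<in> carrier N" if "x \<in> carrier E" for x j
    using E.char_coeff_closed[OF e that] by simp
  have sc: "elem_sym N n (\<lambda>i. \<phi> i x) j \<in> carrier N" if "x \<in> carrier E" for x j
    using D.phi_closed that by (intro N.elem_sym_closed) auto
  \<comment> \<open>The relations are only given for \<open>j \<ge> 1\<close>; for \<open>j = 0\<close> both sides are \<open>1\<close>.\<close>
  have rel0: "?\<psi> (char_coeff C E n 0 x) = \<one>\<^bsub>N\<^esub>" if "x \<in> carrier E" for x
  proof -
    have "mat_coeff C n (?m x) 0 = \<one>\<^bsub>C\<^esub>" by (rule UC.mat_coeff_0) (rule mc[OF that])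
    then show ?thesis by (simp add: E.char_coeff_basis[OF e that])
  qed
  let ?T = "{c \<odot>\<^bsub>E\<^esub> s | c s. c \<in> carrier C \<and> s \<in> S}"
  have "agree_below N (Suc n) (D.det_poly (\<one>\<^bsub>?EP\<^esub> \<ominus>\<^bsub>?EP\<^esub> monom ?EP a 1)) (D.norm_poly (\<one>\<^bsub>?EP\<^esub> \<ominus>\<^bsub>?EP\<^esub> monom ?EP a 1))"
  proof (rule D.det_poly_eq_norm_poly_if_generated[where T = ?T])
    show "?T \<subseteq> carrier E" using S by auto
    fix t and k :: nat assume "t \<in> ?T" and k: "k \<ge> 1"
    then obtain c s where t: "t = c \<odot>\<^bsub>E\<^esub> s" and c: "c \<in> carrier C" and s: "s \<in> S" "s \<in> carrier E" using S by auto
    have "?\<psi> (char_coeff C E n j s) = elem_sym N n (\<lambda>i. \<phi> i s) j" if "j \<in> {..n}" for j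
      using rel[OF s(1), of j] that rel0[OF s(2)] by (cases "j = 0") (auto simp: N.elem_sym_0)
    then show "D.det_poly (\<one>\<^bsub>?EP\<^esub> \<ominus>\<^bsub>?EP\<^esub> monom ?EP t k) = D.norm_poly (\<one>\<^bsub>?EP\<^esub> \<ominus>\<^bsub>?EP\<^esub> monom ?EP t k)"
      unfolding t det[OF c s(2) k] norm[OF c s(2) k]
      using c sc[OF s(2)] by (intro D.UR.P.finsum_cong') auto
  qed (use a span in \<open>auto simp: E.M.minus_eq\<close>)
  then have "coeff ?NX (D.det_poly (\<one>\<^bsub>?EP\<^esub> \<ominus>\<^bsub>?EP\<^esub> monom ?EP a 1)) j = coeff ?NX (D.norm_poly (\<one>\<^bsub>?EP\<^esub> \<ominus>\<^bsub>?EP\<^esub> monom ?EP a 1)) j"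
    using j by (simp add: agree_below_def)
  then have "(\<ominus>\<^bsub>N\<^esub> \<one>\<^bsub>N\<^esub>) [^]\<^bsub>N\<^esub> j \<otimes>\<^bsub>N\<^esub> ?\<psi> (char_coeff C E n j a) = (\<ominus>\<^bsub>N\<^esub> \<one>\<^bsub>N\<^esub>) [^]\<^bsub>N\<^esub> j \<otimes>\<^bsub>N\<^esub> elem_sym N n (\<lambda>i. \<phi> i a) j"
    using det[of "\<one>\<^bsub>C\<^esub>" a 1] norm[of "\<one>\<^bsub>C\<^esub>" a 1] a j cc[OF a] sc[OF a]
      D.UR.coeff_sum_powers[of n "\<lambda>j. ?\<psi> (char_coeff C E n j a)" j]
      D.UR.coeff_sum_powers[of n "\<lambda>j. elem_sym N n (\<lambda>i. \<phi> i a) j" j]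
    by simp
  moreover have "(\<ominus>\<^bsub>N\<^esub> \<one>\<^bsub>N\<^esub>) [^]\<^bsub>N\<^esub> j \<otimes>\<^bsub>N\<^esub> ((\<ominus>\<^bsub>N\<^esub> \<one>\<^bsub>N\<^esub>) [^]\<^bsub>N\<^esub> j \<otimes>\<^bsub>N\<^esub> x) = x" if "x \<in> carrier N" for x
  proof -
    have "(\<ominus>\<^bsub>N\<^esub> \<one>\<^bsub>N\<^esub>) [^]\<^bsub>N\<^esub> j \<otimes>\<^bsub>N\<^esub> (\<ominus>\<^bsub>N\<^esub> \<one>\<^bsub>N\<^esub>) [^]\<^bsub>N\<^esub> j = \<one>\<^bsub>N\<^esub>"
      by (simp add: N.l_minus flip: N.nat_pow_distrib)
    then show ?thesis using that by (simp flip: N.m_assoc)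
  qed
  ultimately show ?thesis using cc[OF a] sc[OF a] by metis
qed

section \<open>Quotient algebras\<close>

text \<open>
  Quotient algebras and extensions of scalars are records that share the ring operations of another
  record but differ from it in the scalar multiplication.
\<close>

lemma cring_record_eq:
  assumes "cring R" "carrier R' = carrier R" "monoid.mult R' = monoid.mult R" "one R' = one R"
    "zero R' = zero R" "ring.add R' = ring.add R"
  shows "cring R'"
proof -
  interpret cring R by fact
  show ?thesis
  proof (rule cringI)
    show "abelian_group R'"
      by (rule abelian_groupI) (auto simp: assms a_ac intro!: bexI[of _ "\<ominus>\<^bsub>R\<^esub> _"] l_neg)
    show "comm_monoid R'"
      by (rule comm_monoidI) (auto simp: assms m_ac)
  qed (auto simp: assms l_distr)
qed

lemma ring_hom_vanishes_genideal:
  assumes M: "ring M" and N: "ring N" and h: "h \<in> ring_hom M N"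
    and S: "S \<subseteq> carrier M" and 0: "\<And>s. s \<in> S \<Longrightarrow> h s = \<zero>\<^bsub>N\<^esub>" and x: "x \<in> Idl\<^bsub>M\<^esub> S"
  shows "h x = \<zero>\<^bsub>N\<^esub>"
proof -
  interpret h: ring_hom_ring M N h using M N h by (rule ring_hom_ringI2)
  have "S \<subseteq> a_kernel M N h"
    unfolding a_kernel_def' using S 0 by blast
  then have "Idl\<^bsub>M\<^esub> S \<subseteq> a_kernel M N h" by (rule h.R.genideal_minimal[OF h.kernel_is_ideal])
  then show ?thesis using x unfolding a_kernel_def' by blast
qed

locale quotient_algebra = A: algebra B M + I: ideal I M
  for B :: "('b, 'k) ring_scheme" and M :: "('b, 'm, 'p) module_scheme" and I
begin

abbreviation "Q \<equiv> quot_algebra M I"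
abbreviation cls where "cls x \<equiv> I +>\<^bsub>M\<^esub> x"

lemma quot_ring_ops:
  "carrier Q = carrier (M Quot I)" "monoid.mult Q = monoid.mult (M Quot I)" "one Q = one (M Quot I)"
  "zero Q = zero (M Quot I)" "ring.add Q = ring.add (M Quot I)"
  by (simp_all add: quot_algebra_def)

lemma carrier_quot: "carrier Q = cls ` carrier M"
  by (auto simp: quot_ring_ops FactRing_def A_RCOSETS_def' )

lemma cring_quot: "cring Q"
  by (rule cring_record_eq[OF I.quotient_is_cring[OF A.M_cring]]) (simp_all add: quot_ring_ops)

lemma cls_hom: "cls \<in> ring_hom M Q"
  using I.rcos_ring_hom unfolding ring_hom_def quot_ring_ops by simp

sublocale Q: cring Q by (rule cring_quot)
sublocale cls: ring_hom_cring M Q cls using cls_hom by unfold_locales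

lemma mem_cls: "y \<in> cls x \<Longrightarrow> x \<in> carrier M \<Longrightarrow> \<exists>i\<in>I. y = i \<oplus>\<^bsub>M\<^esub> x"
  by (auto simp: a_r_coset_def r_coset_def)

lemma cls_zero: "i \<in> I \<Longrightarrow> cls i = \<zero>\<^bsub>Q\<^esub>"
  unfolding quot_ring_ops(4) FactRing_def by simp (rule I.a_rcos_const)

text \<open>
  The union in the definition of the scalar multiplication of a quotient ranges over equal cosets,
  because an ideal of an algebra is stable under scalars.
\<close>

lemma smult_cls:
  assumes r: "r \<in> carrier B" and x: "x \<in> carrier M"
  shows "r \<odot>\<^bsub>Q\<^esub> cls x = cls (r \<odot>\<^bsub>M\<^esub> x)"
proof -
  have "cls (r \<odot>\<^bsub>M\<^esub> y) = cls (r \<odot>\<^bsub>M\<^esub> x)" if y: "y \<in> cls x" for y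
  proof -
    obtain i where i: "i \<in> I" "y = i \<oplus>\<^bsub>M\<^esub> x" using mem_cls[OF y x] by blast
    have iM: "i \<in> carrier M" using i by simp
    have "r \<odot>\<^bsub>M\<^esub> i = (r \<odot>\<^bsub>M\<^esub> \<one>\<^bsub>M\<^esub>) \<otimes>\<^bsub>M\<^esub> i" using r iM by (rule A.smult_eq_mult)
    also have "\<dots> \<in> I" using i(1) r by (intro I.I_l_closed) auto
    finally have "cls (r \<odot>\<^bsub>M\<^esub> i) = \<zero>\<^bsub>Q\<^esub>" by (rule cls_zero)
    then show ?thesis using r x i iM by (simp add: A.smult_r_distr)
  qed
  moreover have "x \<in> cls x" using x by (rule I.a_rcos_self)
  ultimately have "(\<Union>y\<in>cls x. cls (r \<odot>\<^bsub>M\<^esub> y)) = cls (r \<odot>\<^bsub>M\<^esub> x)" by blast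
  then show ?thesis by (simp add: quot_algebra_def)
qed

lemma algebra_quot: "algebra B Q"
  by (rule algebraI[OF A.R_cring cring_quot])
    (auto simp: carrier_quot smult_cls A.smult_l_distr A.smult_r_distr A.smult_assoc1 A.smult_assoc2
      simp flip: cls.hom_add cls.hom_mult)

lemma cls_algebra_hom: "cls \<in> algebra_hom B M Q"
  using cls_hom by (auto simp: algebra_hom_def smult_cls)

text \<open>
  For the elements of a coset to have the same image it suffices that \<open>h\<close> is additive and vanishes on \<open>I\<close>.
\<close>

lemma quot_lift_cls:
  assumes N: "cring N" and h: "\<And>x y. x \<in> carrier M \<Longrightarrow> y \<in> carrier M \<Longrightarrow> h (x \<oplus>\<^bsub>M\<^esub> y) = h x \<oplus>\<^bsub>N\<^esub> h y"
    "\<And>x. x \<in> carrier M \<Longrightarrow> h x \<in> carrier N"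
    and 0: "\<And>i. i \<in> I \<Longrightarrow> h i = \<zero>\<^bsub>N\<^esub>" and x: "x \<in> carrier M"
  shows "quot_lift h (cls x) = h x"
proof -
  interpret N: cring N by fact
  have "h y = h x" if y: "y \<in> cls x" for y
  proof -
    obtain i where i: "i \<in> I" "y = i \<oplus>\<^bsub>M\<^esub> x" using mem_cls[OF y x] by blast
    have "h y = h i \<oplus>\<^bsub>N\<^esub> h x" unfolding i(2) using I.a_Hcarr[OF i(1)] x by (rule h(1))
    then show ?thesis unfolding 0[OF i(1)] using h(2)[OF x] by simp
  qed
  then have "h ` cls x = {h x}" using I.a_rcos_self[OF x] by blast
  then show ?thesis by (simp add: quot_lift_def)
qed

lemma quot_lift_hom:
  assumes N: "cring N" and h: "h \<in> ring_hom M N" and 0: "\<And>i. i \<in> I \<Longrightarrow> h i = \<zero>\<^bsub>N\<^esub>"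
  shows "quot_lift h \<in> ring_hom Q N" and "\<And>x. x \<in> carrier M \<Longrightarrow> quot_lift h (cls x) = h x"
proof -
  interpret N: cring N by fact
  interpret h: ring_hom_cring M N h using h by unfold_locales
  show *: "quot_lift h (cls x) = h x" if "x \<in> carrier M" for x
    by (rule quot_lift_cls[OF N h.hom_add h.hom_closed 0 that])
  show "quot_lift h \<in> ring_hom Q N"
    by (rule ring_hom_memI)
      (auto simp: carrier_quot * simp flip: cls.hom_add cls.hom_mult cls.hom_one)
qed

lemma quot_lift_semilinear:
  assumes N: "cring N" and h: "h \<in> semilinear_hom B g M N" and 0: "\<And>i. i \<in> I \<Longrightarrow> h i = \<zero>\<^bsub>N\<^esub>"
  shows "quot_lift h \<in> semilinear_hom B g Q N"
proof (rule semilinear_homI)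
  note * = quot_lift_hom[OF N semilinear_homD(1)[OF h] 0]
  show "quot_lift h \<in> ring_hom Q N" by (rule *(1))
  fix b X assume b: "b \<in> carrier B" and "X \<in> carrier Q"
  then obtain x where x: "x \<in> carrier M" "X = cls x" by (auto simp: carrier_quot)
  then show "quot_lift h (b \<odot>\<^bsub>Q\<^esub> X) = g b \<odot>\<^bsub>N\<^esub> quot_lift h X"
    using b semilinear_homD(2)[OF h] by (simp add: smult_cls *(2))
qed

end

section \<open>Monoid algebras\<close>

locale comm_monoid_algebra = B: cring B + G: comm_monoid G
  for B :: "('b, 'k) ring_scheme" and G :: "('g, 'l) monoid_scheme"
begin

abbreviation "F \<equiv> monoid_algebra B G"
abbreviation supp where "supp f \<equiv> {x. f x \<noteq> \<zero>\<^bsub>B\<^esub>}"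

text \<open>
  The element \<open>b x\<close> of \<open>B[G]\<close>. Identities that are additive in each argument are verified on these
  elements by \<open>mon_induct\<close>.
\<close>

definition mon :: "'b \<Rightarrow> 'g \<Rightarrow> 'g \<Rightarrow> 'b"
  where "mon b x = (\<lambda>y. if y = x then b else \<zero>\<^bsub>B\<^esub>)"

lemma in_carrier_iff:
  "f \<in> carrier F \<longleftrightarrow> (\<forall>x. f x \<in> carrier B) \<and> supp f \<subseteq> carrier G \<and> finite (supp f)"
  by (simp add: monoid_algebra_def)

lemma coeff_in: "f \<in> carrier F \<Longrightarrow> f x \<in> carrier B" by (simp add: in_carrier_iff)

lemma ops:
  "\<zero>\<^bsub>F\<^esub> = (\<lambda>_. \<zero>\<^bsub>B\<^esub>)" "f \<oplus>\<^bsub>F\<^esub> f' = (\<lambda>x. f x \<oplus>\<^bsub>B\<^esub> f' x)" "b \<odot>\<^bsub>F\<^esub> f = (\<lambda>x. b \<otimes>\<^bsub>B\<^esub> f x)"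
  "\<one>\<^bsub>F\<^esub> = single B \<one>\<^bsub>G\<^esub>"
  by (simp_all add: monoid_algebra_def single_def)

lemma mon_closed: "b \<in> carrier B \<Longrightarrow> x \<in> carrier G \<Longrightarrow> mon b x \<in> carrier F"
  by (auto simp: in_carrier_iff mon_def intro: finite_subset[of _ "{x}"])

lemma single_eq_mon: "single B x = mon \<one>\<^bsub>B\<^esub> x"
  by (auto simp: single_def mon_def)

lemma mon_eq_smult: "b \<in> carrier B \<Longrightarrow> mon b x = b \<odot>\<^bsub>F\<^esub> single B x"
  by (auto simp: single_def mon_def ops)

lemma zero_in: "\<zero>\<^bsub>F\<^esub> \<in> carrier F"
  by (simp add: in_carrier_iff ops)

lemma add_in:
  assumes "f \<in> carrier F" "f' \<in> carrier F"
  shows "f \<oplus>\<^bsub>F\<^esub> f' \<in> carrier F"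
proof -
  have s: "supp (\<lambda>x. f x \<oplus>\<^bsub>B\<^esub> f' x) \<subseteq> supp f \<union> supp f'" by auto
  moreover have "finite (supp (\<lambda>x. f x \<oplus>\<^bsub>B\<^esub> f' x))"
    by (rule finite_subset[OF s]) (use assms in \<open>auto simp: in_carrier_iff\<close>)
  ultimately show ?thesis using assms unfolding in_carrier_iff ops by blast
qed

lemma smult_in:
  assumes "f \<in> carrier F" "b \<in> carrier B"
  shows "b \<odot>\<^bsub>F\<^esub> f \<in> carrier F"
proof -
  have s: "supp (\<lambda>x. b \<otimes>\<^bsub>B\<^esub> f x) \<subseteq> supp f" using assms by auto
  moreover have "finite (supp (\<lambda>x. b \<otimes>\<^bsub>B\<^esub> f x))"
    by (rule finite_subset[OF s]) (use assms in \<open>auto simp: in_carrier_iff\<close>)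
  ultimately show ?thesis using assms unfolding in_carrier_iff ops by blast
qed

lemma abelian_group_F: "abelian_group F"
proof (rule abelian_groupI)
  fix f assume f: "f \<in> carrier F"
  show "\<exists>g\<in>carrier F. g \<oplus>\<^bsub>F\<^esub> f = \<zero>\<^bsub>F\<^esub>"
  proof (rule bexI)
    show "(\<ominus>\<^bsub>B\<^esub> \<one>\<^bsub>B\<^esub>) \<odot>\<^bsub>F\<^esub> f \<in> carrier F" using f by (intro smult_in) auto
    show "(\<ominus>\<^bsub>B\<^esub> \<one>\<^bsub>B\<^esub>) \<odot>\<^bsub>F\<^esub> f \<oplus>\<^bsub>F\<^esub> f = \<zero>\<^bsub>F\<^esub>"
      using coeff_in[OF f] by (simp add: ops B.l_minus B.l_neg)
  qed
next
  show "f \<oplus>\<^bsub>F\<^esub> f' \<in> carrier F" if "f \<in> carrier F" "f' \<in> carrier F" for f f' using that by (rule add_in)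
  show "\<zero>\<^bsub>F\<^esub> \<in> carrier F" by (rule zero_in)
qed (auto simp: ops coeff_in B.a_ac)

sublocale FA: abelian_group F by (rule abelian_group_F)

lemma mon_induct [consumes 1, case_names zero add]:
  assumes "f \<in> carrier F" "P \<zero>\<^bsub>F\<^esub>"
    and "\<And>f b x. f \<in> carrier F \<Longrightarrow> b \<in> carrier B \<Longrightarrow> x \<in> carrier G \<Longrightarrow> P f \<Longrightarrow> P (f \<oplus>\<^bsub>F\<^esub> mon b x)"
  shows "P f"
proof -
  have "\<forall>f\<in>carrier F. supp f \<subseteq> S \<longrightarrow> P f" if "finite S" for S
    using that
  proof (induction S rule: finite_induct)
    case empty
    show ?case
    proof (intro ballI impI)
      fix f :: "'g \<Rightarrow> 'b" assume "supp f \<subseteq> {}"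
      then have "f = \<zero>\<^bsub>F\<^esub>" by (auto simp: ops)
      then show "P f" using assms(2) by simp
    qed
  next
    case (insert x S)
    show ?case
    proof (intro ballI impI)
      fix f assume f: "f \<in> carrier F" "supp f \<subseteq> insert x S"
      show "P f"
      proof (cases "f x = \<zero>\<^bsub>B\<^esub>")
        case True
        then show ?thesis using insert f by auto
      next
        case False
        let ?f = "f(x := \<zero>\<^bsub>B\<^esub>)"
        have "supp ?f \<subseteq> supp f" by auto
        then have f': "?f \<in> carrier F"
          using f(1) unfolding in_carrier_iff by (auto intro: finite_subset)
        have "supp ?f \<subseteq> S" using f(2) by auto
        then have "P ?f" using insert f' by auto
        moreover have "f x \<in> carrier B" "x \<in> carrier G" using f False by (auto simp: in_carrier_iff)
        moreover from this have "f = ?f \<oplus>\<^bsub>F\<^esub> mon (f x) x" using f(1) by (auto simp: ops mon_def coeff_in)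
        ultimately show ?thesis using assms(3) f' by metis
      qed
    qed
  qed
  then show ?thesis using assms(1) by (auto simp: in_carrier_iff)
qed

text \<open>
  The product may be computed over any finite sets that contain the supports, in particular over common
  ones for several factors.
\<close>

lemma mult_eq:
  assumes f: "f \<in> carrier F" and f': "f' \<in> carrier F" and S: "finite S" "supp f \<subseteq> S" and T: "finite T" "supp f' \<subseteq> T"
  shows "(f \<otimes>\<^bsub>F\<^esub> f') z = (\<Oplus>\<^bsub>B\<^esub>x\<in>S. \<Oplus>\<^bsub>B\<^esub>y\<in>T. if x \<otimes>\<^bsub>G\<^esub> y = z then f x \<otimes>\<^bsub>B\<^esub> f' y else \<zero>\<^bsub>B\<^esub>)"
proof -
  note c = coeff_in[OF f] coeff_in[OF f']
  have "(f \<otimes>\<^bsub>F\<^esub> f') z = (\<Oplus>\<^bsub>B\<^esub>p\<in>{(x, y). f x \<noteq> \<zero>\<^bsub>B\<^esub> \<and> f' y \<noteq> \<zero>\<^bsub>B\<^esub> \<and> x \<otimes>\<^bsub>G\<^esub> y = z}. f (fst p) \<otimes>\<^bsub>B\<^esub> f' (snd p))"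
    by (simp add: monoid_algebra_def)
  also have "\<dots> = (\<Oplus>\<^bsub>B\<^esub>p\<in>S \<times> T. if fst p \<otimes>\<^bsub>G\<^esub> snd p = z then f (fst p) \<otimes>\<^bsub>B\<^esub> f' (snd p) else \<zero>\<^bsub>B\<^esub>)"
    using S T c by (intro B.add.finprod_mono_neutral_cong_left) auto
  also have "\<dots> = (\<Oplus>\<^bsub>B\<^esub>x\<in>S. \<Oplus>\<^bsub>B\<^esub>y\<in>T. if x \<otimes>\<^bsub>G\<^esub> y = z then f x \<otimes>\<^bsub>B\<^esub> f' y else \<zero>\<^bsub>B\<^esub>)"
    using S T c by (intro B.add.finprod_Times[where f = "\<lambda>x y. if x \<otimes>\<^bsub>G\<^esub> y = z then f x \<otimes>\<^bsub>B\<^esub> f' y else \<zero>\<^bsub>B\<^esub>"]) auto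
  finally show ?thesis .
qed

lemma mult_in:
  assumes f: "f \<in> carrier F" and f': "f' \<in> carrier F"
  shows "f \<otimes>\<^bsub>F\<^esub> f' \<in> carrier F"
proof -
  note c = coeff_in[OF f] coeff_in[OF f']
  have fin: "finite (supp f)" "finite (supp f')" and sub: "supp f \<subseteq> carrier G" "supp f' \<subseteq> carrier G"
    using f f' by (auto simp: in_carrier_iff)
  note e = mult_eq[OF f f' fin(1) _ fin(2)]
  have s: "supp (f \<otimes>\<^bsub>F\<^esub> f') \<subseteq> (\<lambda>(x, y). x \<otimes>\<^bsub>G\<^esub> y) ` (supp f \<times> supp f')"
  proof
    fix z assume z: "z \<in> supp (f \<otimes>\<^bsub>F\<^esub> f')"
    show "z \<in> (\<lambda>(x, y). x \<otimes>\<^bsub>G\<^esub> y) ` (supp f \<times> supp f')"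
    proof (rule ccontr)
      assume n: "z \<notin> (\<lambda>(x, y). x \<otimes>\<^bsub>G\<^esub> y) ` (supp f \<times> supp f')"
      have "(f \<otimes>\<^bsub>F\<^esub> f') z = \<zero>\<^bsub>B\<^esub>"
        unfolding e[OF subset_refl subset_refl] using n by (intro B.add.finprod_one_eqI) auto
      then show False using z by simp
    qed
  qed
  have "finite (supp (f \<otimes>\<^bsub>F\<^esub> f'))" by (rule finite_subset[OF s]) (use fin in auto)
  moreover have "supp (f \<otimes>\<^bsub>F\<^esub> f') \<subseteq> carrier G"
    by (rule subset_trans[OF s]) (use sub in auto)
  moreover have "(f \<otimes>\<^bsub>F\<^esub> f') z \<in> carrier B" for z
    unfolding e[OF subset_refl subset_refl] using c by (intro B.finsum_closed) (auto intro!: B.finsum_closed)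
  ultimately show ?thesis unfolding in_carrier_iff by blast
qed

lemma mult_comm:
  assumes f: "f \<in> carrier F" and f': "f' \<in> carrier F"
  shows "f \<otimes>\<^bsub>F\<^esub> f' = f' \<otimes>\<^bsub>F\<^esub> f"
proof
  fix z
  note c = coeff_in[OF f] coeff_in[OF f']
  have fin: "finite (supp f)" "finite (supp f')" and sub: "supp f \<subseteq> carrier G" "supp f' \<subseteq> carrier G"
    using f f' by (auto simp: in_carrier_iff)
  have "(f \<otimes>\<^bsub>F\<^esub> f') z = (\<Oplus>\<^bsub>B\<^esub>x\<in>supp f. \<Oplus>\<^bsub>B\<^esub>y\<in>supp f'. if x \<otimes>\<^bsub>G\<^esub> y = z then f x \<otimes>\<^bsub>B\<^esub> f' y else \<zero>\<^bsub>B\<^esub>)"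
    using fin by (intro mult_eq[OF f f']) auto
  also have "\<dots> = (\<Oplus>\<^bsub>B\<^esub>y\<in>supp f'. \<Oplus>\<^bsub>B\<^esub>x\<in>supp f. if x \<otimes>\<^bsub>G\<^esub> y = z then f x \<otimes>\<^bsub>B\<^esub> f' y else \<zero>\<^bsub>B\<^esub>)"
    using fin c by (intro B.add.finprod_swap) auto
  also have "\<dots> = (\<Oplus>\<^bsub>B\<^esub>y\<in>supp f'. \<Oplus>\<^bsub>B\<^esub>x\<in>supp f. if y \<otimes>\<^bsub>G\<^esub> x = z then f' y \<otimes>\<^bsub>B\<^esub> f x else \<zero>\<^bsub>B\<^esub>)"
  proof (rule B.finsum_cong')
    fix y assume y: "y \<in> supp f'"
    show "(\<Oplus>\<^bsub>B\<^esub>x\<in>supp f. if x \<otimes>\<^bsub>G\<^esub> y = z then f x \<otimes>\<^bsub>B\<^esub> f' y else \<zero>\<^bsub>B\<^esub>)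
      = (\<Oplus>\<^bsub>B\<^esub>x\<in>supp f. if y \<otimes>\<^bsub>G\<^esub> x = z then f' y \<otimes>\<^bsub>B\<^esub> f x else \<zero>\<^bsub>B\<^esub>)"
    proof (rule B.finsum_cong')
      fix x assume x: "x \<in> supp f"
      show "(if x \<otimes>\<^bsub>G\<^esub> y = z then f x \<otimes>\<^bsub>B\<^esub> f' y else \<zero>\<^bsub>B\<^esub>) = (if y \<otimes>\<^bsub>G\<^esub> x = z then f' y \<otimes>\<^bsub>B\<^esub> f x else \<zero>\<^bsub>B\<^esub>)"
        using x y sub c by (simp add: subset_iff G.m_comm[of x y] B.m_comm)
    qed (use c in auto)
  qed (use c in \<open>auto intro!: B.finsum_closed\<close>)
  also have "\<dots> = (f' \<otimes>\<^bsub>F\<^esub> f) z"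
    using fin by (intro mult_eq[OF f' f, symmetric]) auto
  finally show "(f \<otimes>\<^bsub>F\<^esub> f') z = (f' \<otimes>\<^bsub>F\<^esub> f) z" .
qed

lemma mult_add:
  assumes f: "f \<in> carrier F" and f': "f' \<in> carrier F" and k: "k \<in> carrier F"
  shows "(f \<oplus>\<^bsub>F\<^esub> f') \<otimes>\<^bsub>F\<^esub> k = f \<otimes>\<^bsub>F\<^esub> k \<oplus>\<^bsub>F\<^esub> f' \<otimes>\<^bsub>F\<^esub> k"
proof
  fix z
  note c = coeff_in[OF f] coeff_in[OF f'] coeff_in[OF k]
  let ?S = "supp f \<union> supp f'" and ?T = "supp k"
  let ?t = "\<lambda>f x y. if x \<otimes>\<^bsub>G\<^esub> y = z then f x \<otimes>\<^bsub>B\<^esub> k y else \<zero>\<^bsub>B\<^esub>"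
  have fin: "finite ?S" "finite ?T" using f f' k by (auto simp: in_carrier_iff)
  have s: "supp (f \<oplus>\<^bsub>F\<^esub> f') \<subseteq> ?S" by (auto simp: ops)
  have "((f \<oplus>\<^bsub>F\<^esub> f') \<otimes>\<^bsub>F\<^esub> k) z = (\<Oplus>\<^bsub>B\<^esub>x\<in>?S. \<Oplus>\<^bsub>B\<^esub>y\<in>?T. ?t (f \<oplus>\<^bsub>F\<^esub> f') x y)"
    using fin s add_in[OF f f'] k by (intro mult_eq) auto
  also have "\<dots> = (\<Oplus>\<^bsub>B\<^esub>x\<in>?S. (\<Oplus>\<^bsub>B\<^esub>y\<in>?T. ?t f x y) \<oplus>\<^bsub>B\<^esub> (\<Oplus>\<^bsub>B\<^esub>y\<in>?T. ?t f' x y))"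
  proof (rule B.finsum_cong')
    fix x
    have "(\<Oplus>\<^bsub>B\<^esub>y\<in>?T. ?t (f \<oplus>\<^bsub>F\<^esub> f') x y) = (\<Oplus>\<^bsub>B\<^esub>y\<in>?T. ?t f x y \<oplus>\<^bsub>B\<^esub> ?t f' x y)"
      using c by (intro B.finsum_cong') (auto simp: ops B.l_distr)
    also have "\<dots> = (\<Oplus>\<^bsub>B\<^esub>y\<in>?T. ?t f x y) \<oplus>\<^bsub>B\<^esub> (\<Oplus>\<^bsub>B\<^esub>y\<in>?T. ?t f' x y)"
      using c by (intro B.finsum_addf) auto
    finally show "(\<Oplus>\<^bsub>B\<^esub>y\<in>?T. ?t (f \<oplus>\<^bsub>F\<^esub> f') x y) = (\<Oplus>\<^bsub>B\<^esub>y\<in>?T. ?t f x y) \<oplus>\<^bsub>B\<^esub> (\<Oplus>\<^bsub>B\<^esub>y\<in>?T. ?t f' x y)" .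
  qed (use c in \<open>auto intro!: B.finsum_closed B.a_closed\<close>)
  also have "\<dots> = (\<Oplus>\<^bsub>B\<^esub>x\<in>?S. \<Oplus>\<^bsub>B\<^esub>y\<in>?T. ?t f x y) \<oplus>\<^bsub>B\<^esub> (\<Oplus>\<^bsub>B\<^esub>x\<in>?S. \<Oplus>\<^bsub>B\<^esub>y\<in>?T. ?t f' x y)"
    using c by (intro B.finsum_addf) (auto intro!: B.finsum_closed)
  also have "(\<Oplus>\<^bsub>B\<^esub>x\<in>?S. \<Oplus>\<^bsub>B\<^esub>y\<in>?T. ?t f x y) = (f \<otimes>\<^bsub>F\<^esub> k) z"
    using fin by (intro mult_eq[OF f k, symmetric]) auto
  also have "(\<Oplus>\<^bsub>B\<^esub>x\<in>?S. \<Oplus>\<^bsub>B\<^esub>y\<in>?T. ?t f' x y) = (f' \<otimes>\<^bsub>F\<^esub> k) z"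
    using fin by (intro mult_eq[OF f' k, symmetric]) auto
  finally show "((f \<oplus>\<^bsub>F\<^esub> f') \<otimes>\<^bsub>F\<^esub> k) z = (f \<otimes>\<^bsub>F\<^esub> k \<oplus>\<^bsub>F\<^esub> f' \<otimes>\<^bsub>F\<^esub> k) z" by (simp add: ops)
qed

lemma mult_mon_mon:
  assumes "b \<in> carrier B" "b' \<in> carrier B" "x \<in> carrier G" "x' \<in> carrier G"
  shows "mon b x \<otimes>\<^bsub>F\<^esub> mon b' x' = mon (b \<otimes>\<^bsub>B\<^esub> b') (x \<otimes>\<^bsub>G\<^esub> x')"
proof
  fix z
  have "(mon b x \<otimes>\<^bsub>F\<^esub> mon b' x') z
    = (\<Oplus>\<^bsub>B\<^esub>u\<in>{x}. \<Oplus>\<^bsub>B\<^esub>v\<in>{x'}. if u \<otimes>\<^bsub>G\<^esub> v = z then mon b x u \<otimes>\<^bsub>B\<^esub> mon b' x' v else \<zero>\<^bsub>B\<^esub>)"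
    using assms mon_closed by (intro mult_eq) (auto simp: mon_def split: if_splits)
  then show "(mon b x \<otimes>\<^bsub>F\<^esub> mon b' x') z = mon (b \<otimes>\<^bsub>B\<^esub> b') (x \<otimes>\<^bsub>G\<^esub> x') z"
    using assms by (auto simp: mon_def)
qed

lemma mult_zero: "f \<in> carrier F \<Longrightarrow> \<zero>\<^bsub>F\<^esub> \<otimes>\<^bsub>F\<^esub> f = \<zero>\<^bsub>F\<^esub>"
  by (simp add: ops) (simp add: monoid_algebra_def)

lemma add_mult:
  assumes "f \<in> carrier F" "f' \<in> carrier F" "k \<in> carrier F"
  shows "k \<otimes>\<^bsub>F\<^esub> (f \<oplus>\<^bsub>F\<^esub> f') = k \<otimes>\<^bsub>F\<^esub> f \<oplus>\<^bsub>F\<^esub> k \<otimes>\<^bsub>F\<^esub> f'"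
  using assms by (simp add: mult_comm[of k] mult_add add_in)

lemma mult_assoc:
  assumes f: "f \<in> carrier F" and k: "k \<in> carrier F" and l: "l \<in> carrier F"
  shows "(f \<otimes>\<^bsub>F\<^esub> k) \<otimes>\<^bsub>F\<^esub> l = f \<otimes>\<^bsub>F\<^esub> (k \<otimes>\<^bsub>F\<^esub> l)"
proof -
  have z: "f \<otimes>\<^bsub>F\<^esub> \<zero>\<^bsub>F\<^esub> = \<zero>\<^bsub>F\<^esub>" if "f \<in> carrier F" for f
    using that by (simp add: mult_comm[of f] zero_in mult_zero)
  have 1: "(mon b x \<otimes>\<^bsub>F\<^esub> mon b' x') \<otimes>\<^bsub>F\<^esub> l = mon b x \<otimes>\<^bsub>F\<^esub> (mon b' x' \<otimes>\<^bsub>F\<^esub> l)"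
    if m: "b \<in> carrier B" "x \<in> carrier G" "b' \<in> carrier B" "x' \<in> carrier G" for b x b' x'
    using l
    by (induction l rule: mon_induct)
      (use m in \<open>auto simp: z zero_in mult_in mon_closed add_mult mult_mon_mon B.m_assoc G.m_assoc\<close>)
  have 2: "(mon b x \<otimes>\<^bsub>F\<^esub> k) \<otimes>\<^bsub>F\<^esub> l = mon b x \<otimes>\<^bsub>F\<^esub> (k \<otimes>\<^bsub>F\<^esub> l)"
    if m: "b \<in> carrier B" "x \<in> carrier G" for b x
    using k
    by (induction k rule: mon_induct)
      (use m l in \<open>auto simp: z zero_in mult_in mon_closed add_mult mult_add 1 mult_zero\<close>)
  show ?thesis
    using f
    by (induction f rule: mon_induct)
      (use k l in \<open>auto simp: z zero_in mult_in mon_closed mult_add 2 mult_zero\<close>)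
qed

lemma one_mult:
  assumes f: "f \<in> carrier F"
  shows "\<one>\<^bsub>F\<^esub> \<otimes>\<^bsub>F\<^esub> f = f"
  using f
proof (induction f rule: mon_induct)
  case zero
  then show ?case
    by (subst mult_comm) (auto simp: mult_zero zero_in mon_closed ops(4) single_eq_mon)
qed (auto simp: ops(4) single_eq_mon add_mult mon_closed mult_mon_mon)

lemma smult_mult:
  assumes b: "b \<in> carrier B" and f: "f \<in> carrier F" and k: "k \<in> carrier F"
  shows "(b \<odot>\<^bsub>F\<^esub> f) \<otimes>\<^bsub>F\<^esub> k = b \<odot>\<^bsub>F\<^esub> (f \<otimes>\<^bsub>F\<^esub> k)"
proof -
  have s: "b \<odot>\<^bsub>F\<^esub> f = mon b \<one>\<^bsub>G\<^esub> \<otimes>\<^bsub>F\<^esub> f" if "f \<in> carrier F" for f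
    using that
  proof (induction f rule: mon_induct)
    case zero
    show ?case using b by (subst mult_comm) (auto simp: mult_zero zero_in mon_closed, simp add: ops)
  next
    case (add f c x)
    have "b \<odot>\<^bsub>F\<^esub> (f \<oplus>\<^bsub>F\<^esub> mon c x) = b \<odot>\<^bsub>F\<^esub> f \<oplus>\<^bsub>F\<^esub> mon (b \<otimes>\<^bsub>B\<^esub> c) x"
      using add(1-3) b by (auto simp: ops mon_def coeff_in B.r_distr)
    then show ?case using add b by (simp add: add_mult mon_closed mult_mon_mon)
  qed
  show ?thesis using b f k by (simp add: s mult_in mult_assoc mon_closed)
qed

lemma cring_F: "cring F"
proof (rule cringI)
  show "comm_monoid F"
    by (rule comm_monoidI)
      (simp_all add: mult_in mult_assoc one_mult, simp add: ops(4) single_eq_mon mon_closed, rule mult_comm)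
qed (auto simp: mult_add intro: abelian_group_F)

lemma algebra_F: "algebra B F"
proof (rule algebraI[OF B.is_cring cring_F])
  show "\<one>\<^bsub>B\<^esub> \<odot>\<^bsub>F\<^esub> f = f" if "f \<in> carrier F" for f using coeff_in[OF that] by (simp add: ops)
  show "b \<odot>\<^bsub>F\<^esub> f \<in> carrier F" if "b \<in> carrier B" "f \<in> carrier F" for b f using that by (intro smult_in)
  show "(b \<odot>\<^bsub>F\<^esub> f) \<otimes>\<^bsub>F\<^esub> k = b \<odot>\<^bsub>F\<^esub> (f \<otimes>\<^bsub>F\<^esub> k)" if "b \<in> carrier B" "f \<in> carrier F" "k \<in> carrier F" for b f k
    using that by (rule smult_mult)
qed (auto simp: ops coeff_in B.l_distr B.r_distr B.m_assoc)

sublocale F: algebra B F by (rule algebra_F)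

lemma single_closed: "x \<in> carrier G \<Longrightarrow> single B x \<in> carrier F"
  by (simp add: single_eq_mon mon_closed)

lemma single_mult: "x \<in> carrier G \<Longrightarrow> y \<in> carrier G \<Longrightarrow> single B x \<otimes>\<^bsub>F\<^esub> single B y = single B (x \<otimes>\<^bsub>G\<^esub> y)"
  by (simp add: single_eq_mon mult_mon_mon)

lemma single_induct [consumes 1, case_names zero add]:
  assumes "f \<in> carrier F" "P \<zero>\<^bsub>F\<^esub>"
    and "\<And>f b x. f \<in> carrier F \<Longrightarrow> b \<in> carrier B \<Longrightarrow> x \<in> carrier G \<Longrightarrow> P f \<Longrightarrow> P (f \<oplus>\<^bsub>F\<^esub> b \<odot>\<^bsub>F\<^esub> single B x)"
  shows "P f"
  using assms(1) by (induction f rule: mon_induct) (auto simp: assms mon_eq_smult)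

context
  fixes B' :: "('c, 'u) ring_scheme" and N :: "('c, 'n, 'q) module_scheme" and g :: "'b \<Rightarrow> 'c" and k :: "'g \<Rightarrow> 'n"
  assumes N: "module B' N" and g: "g \<in> ring_hom B B'" and k: "k \<in> carrier G \<rightarrow> carrier N"
begin

interpretation N: module B' N by (rule N)
interpretation g: ring_hom_cring B B' g using g by unfold_locales

lemma k_closed: "x \<in> carrier G \<Longrightarrow> k x \<in> carrier N" using k by auto

lemma lin_ext_eq:
  assumes f: "f \<in> carrier F" and S: "supp f \<subseteq> S" "S \<subseteq> carrier G" "finite S"
  shows "lin_ext B N g k f = (\<Oplus>\<^bsub>N\<^esub>x\<in>S. g (f x) \<odot>\<^bsub>N\<^esub> k x)"
  unfolding lin_ext_def using coeff_in[OF f] k_closed S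
  by (intro N.M.add.finprod_mono_neutral_cong_left) (auto simp: subset_iff)

lemma lin_ext_closed:
  assumes f: "f \<in> carrier F"
  shows "lin_ext B N g k f \<in> carrier N"
  unfolding lin_ext_def using f k_closed by (intro N.M.finsum_closed) (auto simp: in_carrier_iff)

lemma lin_ext_add:
  assumes f: "f \<in> carrier F" and f': "f' \<in> carrier F"
  shows "lin_ext B N g k (f \<oplus>\<^bsub>F\<^esub> f') = lin_ext B N g k f \<oplus>\<^bsub>N\<^esub> lin_ext B N g k f'"
proof -
  let ?S = "supp f \<union> supp f'"
  have S: "?S \<subseteq> carrier G" "finite ?S" using f f' by (auto simp: in_carrier_iff)
  note c = coeff_in[OF f] coeff_in[OF f']
  have "lin_ext B N g k (f \<oplus>\<^bsub>F\<^esub> f') = (\<Oplus>\<^bsub>N\<^esub>x\<in>?S. g (f x) \<odot>\<^bsub>N\<^esub> k x \<oplus>\<^bsub>N\<^esub> g (f' x) \<odot>\<^bsub>N\<^esub> k x)"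
  proof (subst lin_ext_eq)
    show "(\<Oplus>\<^bsub>N\<^esub>x\<in>?S. g ((f \<oplus>\<^bsub>F\<^esub> f') x) \<odot>\<^bsub>N\<^esub> k x)
      = (\<Oplus>\<^bsub>N\<^esub>x\<in>?S. g (f x) \<odot>\<^bsub>N\<^esub> k x \<oplus>\<^bsub>N\<^esub> g (f' x) \<odot>\<^bsub>N\<^esub> k x)"
      using c k_closed S by (intro N.M.finsum_cong') (auto simp: ops N.smult_l_distr subset_iff)
  qed (use S add_in[OF f f'] in \<open>auto simp: ops\<close>)
  also have "\<dots> = (\<Oplus>\<^bsub>N\<^esub>x\<in>?S. g (f x) \<odot>\<^bsub>N\<^esub> k x) \<oplus>\<^bsub>N\<^esub> (\<Oplus>\<^bsub>N\<^esub>x\<in>?S. g (f' x) \<odot>\<^bsub>N\<^esub> k x)"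
    using c k_closed S by (intro N.M.finsum_addf) (auto simp: subset_iff)
  also have "\<dots> = lin_ext B N g k f \<oplus>\<^bsub>N\<^esub> lin_ext B N g k f'"
    using S f f' by (subst (1 2) lin_ext_eq[where S = ?S]) auto
  finally show ?thesis .
qed

lemma lin_ext_smult_single:
  assumes "b \<in> carrier B" "x \<in> carrier G"
  shows "lin_ext B N g k (b \<odot>\<^bsub>F\<^esub> single B x) = g b \<odot>\<^bsub>N\<^esub> k x"
proof -
  have "lin_ext B N g k (mon b x) = (\<Oplus>\<^bsub>N\<^esub>y\<in>{x}. g (mon b x y) \<odot>\<^bsub>N\<^esub> k y)"
    using assms mon_closed by (intro lin_ext_eq) (auto simp: mon_def split: if_splits)
  then show ?thesis using assms k_closed by (simp add: mon_eq_smult[symmetric]) (simp add: mon_def)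
qed

lemma lin_ext_single:
  assumes "x \<in> carrier G"
  shows "lin_ext B N g k (single B x) = k x"
  using lin_ext_smult_single[of "\<one>\<^bsub>B\<^esub>" x] assms k_closed by (auto simp: single_closed)

lemma lin_ext_zero: "lin_ext B N g k \<zero>\<^bsub>F\<^esub> = \<zero>\<^bsub>N\<^esub>"
  by (simp add: lin_ext_def ops)

lemma lin_ext_smult:
  assumes b: "b \<in> carrier B" and f: "f \<in> carrier F"
  shows "lin_ext B N g k (b \<odot>\<^bsub>F\<^esub> f) = g b \<odot>\<^bsub>N\<^esub> lin_ext B N g k f"
  using f
proof (induction f rule: single_induct)
  case zero
  then show ?case using b by (simp add: lin_ext_zero)
next
  case (add f c x)
  have "lin_ext B N g k (b \<odot>\<^bsub>F\<^esub> (f \<oplus>\<^bsub>F\<^esub> c \<odot>\<^bsub>F\<^esub> single B x))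
    = lin_ext B N g k (b \<odot>\<^bsub>F\<^esub> f \<oplus>\<^bsub>F\<^esub> (b \<otimes>\<^bsub>B\<^esub> c) \<odot>\<^bsub>F\<^esub> single B x)"
    using add b by (simp add: F.smult_r_distr F.smult_assoc1 single_closed)
  then show ?case
    using add b k_closed
    by (auto simp: lin_ext_add lin_ext_smult_single single_closed lin_ext_closed N.smult_r_distr N.smult_assoc1)
qed

end

text \<open>
  The universal property of \<open>B[G]\<close>: a linear extension is multiplicative if it is so on \<open>G\<close>.
\<close>

lemma lin_ext_hom:
  assumes N: "algebra B' N" and g: "g \<in> ring_hom B B'" and k: "k \<in> hom G N" "k \<one>\<^bsub>G\<^esub> = \<one>\<^bsub>N\<^esub>"
  shows "lin_ext B N g k \<in> semilinear_hom B g F N"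
proof (rule semilinear_homI)
  interpret N: algebra B' N by fact
  interpret g: ring_hom_cring B B' g using g by unfold_locales
  have k': "k \<in> carrier G \<rightarrow> carrier N" using k by (auto simp: hom_def)
  note 1 = N.module g k'
  have k_mult: "k (x \<otimes>\<^bsub>G\<^esub> y) = k x \<otimes>\<^bsub>N\<^esub> k y" if "x \<in> carrier G" "y \<in> carrier G" for x y
    using k that by (auto simp: hom_def)
  have kc: "k x \<in> carrier N" if "x \<in> carrier G" for x using k' that by auto
  note simps = lin_ext_add[OF 1] lin_ext_closed[OF 1] lin_ext_zero[OF 1] lin_ext_smult[OF 1] lin_ext_single[OF 1] single_closed
  show "lin_ext B N g k (b \<odot>\<^bsub>F\<^esub> f) = g b \<odot>\<^bsub>N\<^esub> lin_ext B N g k f" if "b \<in> carrier B" "f \<in> carrier F" for b f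
    using that by (rule lin_ext_smult[OF 1])
  have m1: "lin_ext B N g k (single B x \<otimes>\<^bsub>F\<^esub> f) = k x \<otimes>\<^bsub>N\<^esub> lin_ext B N g k f"
    if x: "x \<in> carrier G" and f: "f \<in> carrier F" for x f
    using f
  proof (induction f rule: single_induct)
    case zero
    then show ?case using x kc[OF x] by (simp add: simps)
  next
    case (add f b y)
    have "single B x \<otimes>\<^bsub>F\<^esub> (f \<oplus>\<^bsub>F\<^esub> b \<odot>\<^bsub>F\<^esub> single B y)
      = single B x \<otimes>\<^bsub>F\<^esub> f \<oplus>\<^bsub>F\<^esub> b \<odot>\<^bsub>F\<^esub> single B (x \<otimes>\<^bsub>G\<^esub> y)"
      using add x by (simp add: F.r_distr F.mult_smult_right single_closed single_mult)
    then show ?case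
      using add x kc[OF x] kc[OF add.hyps(3)] by (simp add: simps k_mult N.r_distr N.mult_smult_right)
  qed
  show "lin_ext B N g k \<in> ring_hom F N"
  proof (rule ring_hom_memI)
    fix f f' assume f: "f \<in> carrier F" and f': "f' \<in> carrier F"
    show "lin_ext B N g k (f \<otimes>\<^bsub>F\<^esub> f') = lin_ext B N g k f \<otimes>\<^bsub>N\<^esub> lin_ext B N g k f'"
      using f
    proof (induction f rule: single_induct)
      case zero
      then show ?case using f' by (simp add: simps)
    next
      case (add f b x)
      have "(f \<oplus>\<^bsub>F\<^esub> b \<odot>\<^bsub>F\<^esub> single B x) \<otimes>\<^bsub>F\<^esub> f' = f \<otimes>\<^bsub>F\<^esub> f' \<oplus>\<^bsub>F\<^esub> b \<odot>\<^bsub>F\<^esub> (single B x \<otimes>\<^bsub>F\<^esub> f')"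
        using add f' by (simp add: F.l_distr F.smult_assoc2 single_closed)
      then show ?case
        using add f' kc[OF add.hyps(3)] by (simp add: simps m1 N.l_distr N.smult_assoc2)
    qed
  qed (auto simp: simps ops(4) k(2))
qed

end

section \<open>Tensor products\<close>

lemma add_map_finsum:
  assumes "abelian_group M" "abelian_group N" and h: "\<And>x. x \<in> carrier M \<Longrightarrow> h x \<in> carrier N"
    and add: "\<And>x y. x \<in> carrier M \<Longrightarrow> y \<in> carrier M \<Longrightarrow> h (x \<oplus>\<^bsub>M\<^esub> y) = h x \<oplus>\<^bsub>N\<^esub> h y"
    and "finite I" "\<And>i. i \<in> I \<Longrightarrow> f i \<in> carrier M"
  shows "h (\<Oplus>\<^bsub>M\<^esub>i\<in>I. f i) = (\<Oplus>\<^bsub>N\<^esub>i\<in>I. h (f i))"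
proof -
  interpret M: abelian_group M by fact
  interpret N: abelian_group N by fact
  have "h \<zero>\<^bsub>M\<^esub> \<oplus>\<^bsub>N\<^esub> h \<zero>\<^bsub>M\<^esub> = h \<zero>\<^bsub>M\<^esub>" using add[of "\<zero>\<^bsub>M\<^esub>" "\<zero>\<^bsub>M\<^esub>"] by simp
  then have "h \<zero>\<^bsub>M\<^esub> = \<zero>\<^bsub>N\<^esub>" using h by (metis M.zero_closed N.add.l_cancel_one')
  with assms(5,6) show ?thesis
    by (induction I rule: finite_induct) (auto simp: add h Pi_def)
qed

lemma algebra_of_ring_hom:
  assumes "cring C" "cring T" and h: "h \<in> ring_hom C T"
    and ops: "carrier M = carrier T" "monoid.mult M = monoid.mult T" "one M = one T"
      "zero M = zero T" "ring.add M = ring.add T"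
    and smult: "\<And>c x. c \<odot>\<^bsub>M\<^esub> x = h c \<otimes>\<^bsub>T\<^esub> x"
  shows "algebra C M"
proof -
  interpret T: cring T by fact
  interpret h: ring_hom_cring C T h using assms by (auto intro: ring_hom_cring.intro ring_hom_cring_axioms.intro)
  show ?thesis
    by (rule algebraI[OF assms(1) cring_record_eq[OF assms(2) ops]])
      (auto simp: ops smult T.l_distr T.r_distr T.m_assoc)
qed

text \<open>
  \<open>M \<otimes> N\<close> is \<open>B[M \<times> N]\<close> modulo the bilinearity relations. In the notation of this locale, \<open>TF\<close> is
  \<open>B[M \<times> N]\<close>, \<open>T\<close> is the tensor product, and \<open>pure m x\<close> is \<open>m \<otimes> x\<close>.
\<close>

locale tensor_pair = M: algebra B M + N: algebra B N
  for B :: "('b, 'k) ring_scheme" and M :: "('b, 'm, 'p) module_scheme" and N :: "('b, 'n, 'q) module_scheme"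
begin

lemma comm_monoid_DirProd: "comm_monoid (M \<times>\<times> N)"
  by (rule comm_monoidI) (auto simp: M.m_ac N.m_ac)

sublocale F: comm_monoid_algebra B "M \<times>\<times> N"
  by (intro comm_monoid_algebra.intro M.R_cring comm_monoid_DirProd)

abbreviation "TF \<equiv> tensor_free B M N"
abbreviation "T \<equiv> tensor_algebra B M N"
abbreviation pure where "pure \<equiv> tensor_pure B M N"
abbreviation d where "d \<equiv> single B"

lemma TF_eq: "monoid_algebra B (M \<times>\<times> N) = TF"
  by (simp add: tensor_free_def)

sublocale TF: algebra B TF using F.algebra_F unfolding TF_eq .

lemma d_closed: "m \<in> carrier M \<Longrightarrow> x \<in> carrier N \<Longrightarrow> d (m, x) \<in> carrier TF"
  using F.single_closed[of "(m, x)"] by (simp add: TF_eq)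

lemma d_mult:
  "m \<in> carrier M \<Longrightarrow> x \<in> carrier N \<Longrightarrow> m' \<in> carrier M \<Longrightarrow> x' \<in> carrier N \<Longrightarrow>
    d (m, x) \<otimes>\<^bsub>TF\<^esub> d (m', x') = d (m \<otimes>\<^bsub>M\<^esub> m', x \<otimes>\<^bsub>N\<^esub> x')"
  using F.single_mult[of "(m, x)" "(m', x')"] by (simp add: TF_eq)

lemma tensor_rels_cases:
  assumes "r \<in> tensor_rels B M N"
  obtains m m' x where "r = d (m \<oplus>\<^bsub>M\<^esub> m', x) \<ominus>\<^bsub>TF\<^esub> (d (m, x) \<oplus>\<^bsub>TF\<^esub> d (m', x))"
      "m \<in> carrier M" "m' \<in> carrier M" "x \<in> carrier N"
    | m x x' where "r = d (m, x \<oplus>\<^bsub>N\<^esub> x') \<ominus>\<^bsub>TF\<^esub> (d (m, x) \<oplus>\<^bsub>TF\<^esub> d (m, x'))"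
      "m \<in> carrier M" "x \<in> carrier N" "x' \<in> carrier N"
    | b m x where "r = d (b \<odot>\<^bsub>M\<^esub> m, x) \<ominus>\<^bsub>TF\<^esub> b \<odot>\<^bsub>TF\<^esub> d (m, x)"
      "b \<in> carrier B" "m \<in> carrier M" "x \<in> carrier N"
    | b m x where "r = d (m, b \<odot>\<^bsub>N\<^esub> x) \<ominus>\<^bsub>TF\<^esub> b \<odot>\<^bsub>TF\<^esub> d (m, x)"
      "b \<in> carrier B" "m \<in> carrier M" "x \<in> carrier N"
  using assms unfolding tensor_rels_def Let_def
  apply (elim UnE CollectE exE conjE)
     apply (rule that(1); assumption)
    apply (rule that(2); assumption)
   apply (rule that(3); assumption)
  apply (rule that(4); assumption)
  done

lemma tensor_rels_closed: "tensor_rels B M N \<subseteq> carrier TF"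
  by (auto elim!: tensor_rels_cases intro!: TF.minus_closed TF.M.a_closed TF.smult_closed d_closed)

sublocale I: ideal "tensor_ideal B M N" TF
  unfolding tensor_ideal_def by (rule TF.genideal_ideal[OF tensor_rels_closed])

sublocale Q: quotient_algebra B TF "tensor_ideal B M N" ..

lemma T_eq [simp]: "quot_algebra TF (tensor_ideal B M N) = T"
  by (simp add: tensor_algebra_def)

sublocale T: algebra B T using Q.algebra_quot unfolding T_eq .

lemma cls_hom: "Q.cls \<in> ring_hom TF T" using Q.cls_hom unfolding T_eq .
lemma cls_smult: "b \<in> carrier B \<Longrightarrow> x \<in> carrier TF \<Longrightarrow> Q.cls (b \<odot>\<^bsub>TF\<^esub> x) = b \<odot>\<^bsub>T\<^esub> Q.cls x"
  using Q.smult_cls unfolding T_eq by simp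

sublocale cls: ring_hom_cring TF T Q.cls using cls_hom by unfold_locales

lemma pure_eq: "pure m x = Q.cls (d (m, x))"
  by (simp add: tensor_pure_def)

lemma cls_eq:
  assumes "x \<ominus>\<^bsub>TF\<^esub> y \<in> tensor_rels B M N" "x \<in> carrier TF" "y \<in> carrier TF"
  shows "Q.cls x = Q.cls y"
proof -
  have "x \<ominus>\<^bsub>TF\<^esub> y \<in> tensor_ideal B M N"
    unfolding tensor_ideal_def using assms(1) TF.genideal_self[OF tensor_rels_closed] by blast
  then have "Q.cls (x \<ominus>\<^bsub>TF\<^esub> y) = \<zero>\<^bsub>T\<^esub>" using Q.cls_zero by (simp add: T_eq)
  then have "Q.cls x \<oplus>\<^bsub>T\<^esub> \<ominus>\<^bsub>T\<^esub> Q.cls y = \<zero>\<^bsub>T\<^esub>" using assms(2,3) by (simp add: TF.minus_eq)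
  then show ?thesis using assms(2,3) by (metis T.minus_equality T.minus_minus cls.hom_closed T.a_inv_closed)
qed

lemma pure_closed [simp]: "m \<in> carrier M \<Longrightarrow> x \<in> carrier N \<Longrightarrow> pure m x \<in> carrier T"
  by (simp add: pure_eq d_closed)

lemma pure_add_left:
  assumes "m \<in> carrier M" "m' \<in> carrier M" "x \<in> carrier N"
  shows "pure (m \<oplus>\<^bsub>M\<^esub> m') x = pure m x \<oplus>\<^bsub>T\<^esub> pure m' x"
proof -
  have "Q.cls (d (m \<oplus>\<^bsub>M\<^esub> m', x)) = Q.cls (d (m, x) \<oplus>\<^bsub>TF\<^esub> d (m', x))"
    using assms by (intro cls_eq) (auto simp: tensor_rels_def Let_def d_closed)
  then show ?thesis using assms by (simp add: pure_eq d_closed)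
qed

lemma pure_add_right:
  assumes "m \<in> carrier M" "x \<in> carrier N" "x' \<in> carrier N"
  shows "pure m (x \<oplus>\<^bsub>N\<^esub> x') = pure m x \<oplus>\<^bsub>T\<^esub> pure m x'"
proof -
  have "Q.cls (d (m, x \<oplus>\<^bsub>N\<^esub> x')) = Q.cls (d (m, x) \<oplus>\<^bsub>TF\<^esub> d (m, x'))"
    using assms by (intro cls_eq) (auto simp: tensor_rels_def Let_def d_closed)
  then show ?thesis using assms by (simp add: pure_eq d_closed)
qed

lemma pure_smult_left:
  assumes "b \<in> carrier B" "m \<in> carrier M" "x \<in> carrier N"
  shows "pure (b \<odot>\<^bsub>M\<^esub> m) x = b \<odot>\<^bsub>T\<^esub> pure m x"
proof -
  have "Q.cls (d (b \<odot>\<^bsub>M\<^esub> m, x)) = Q.cls (b \<odot>\<^bsub>TF\<^esub> d (m, x))"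
    using assms by (intro cls_eq) (auto simp: tensor_rels_def Let_def d_closed)
  then show ?thesis using assms by (simp add: pure_eq d_closed cls_smult)
qed

lemma pure_smult_right:
  assumes "b \<in> carrier B" "m \<in> carrier M" "x \<in> carrier N"
  shows "pure m (b \<odot>\<^bsub>N\<^esub> x) = b \<odot>\<^bsub>T\<^esub> pure m x"
proof -
  have "Q.cls (d (m, b \<odot>\<^bsub>N\<^esub> x)) = Q.cls (b \<odot>\<^bsub>TF\<^esub> d (m, x))"
    using assms by (intro cls_eq) (auto simp: tensor_rels_def Let_def d_closed)
  then show ?thesis using assms by (simp add: pure_eq d_closed cls_smult)
qed

lemma pure_mult:
  "m \<in> carrier M \<Longrightarrow> x \<in> carrier N \<Longrightarrow> m' \<in> carrier M \<Longrightarrow> x' \<in> carrier N \<Longrightarrow>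
    pure m x \<otimes>\<^bsub>T\<^esub> pure m' x' = pure (m \<otimes>\<^bsub>M\<^esub> m') (x \<otimes>\<^bsub>N\<^esub> x')"
  using cls.hom_mult[of "d (m, x)" "d (m', x')"] by (simp add: pure_eq d_closed d_mult)

lemma pure_one: "pure \<one>\<^bsub>M\<^esub> \<one>\<^bsub>N\<^esub> = \<one>\<^bsub>T\<^esub>"
proof -
  have "\<one>\<^bsub>TF\<^esub> = d (\<one>\<^bsub>M\<^esub>, \<one>\<^bsub>N\<^esub>)" using F.ops(4) by (simp add: TF_eq)
  then show ?thesis using cls.hom_one by (simp add: pure_eq)
qed

text \<open>
  Scalars can be moved into the first factor, so sums of pure tensors exhaust \<open>T\<close>.
\<close>

lemma pure_induct [consumes 1, case_names zero add]:
  assumes X: "X \<in> carrier T" and 0: "P \<zero>\<^bsub>T\<^esub>"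
    and step: "\<And>X m x. X \<in> carrier T \<Longrightarrow> m \<in> carrier M \<Longrightarrow> x \<in> carrier N \<Longrightarrow> P X \<Longrightarrow> P (X \<oplus>\<^bsub>T\<^esub> pure m x)"
  shows "P X"
proof -
  have "P (Q.cls f)" if "f \<in> carrier TF" for f
    using that[folded TF_eq]
  proof (induction f rule: F.single_induct)
    case zero
    then show ?case using 0 by (simp add: TF_eq)
  next
    case (add f b p)
    obtain m x where p: "p = (m, x)" "m \<in> carrier M" "x \<in> carrier N" using add by auto
    have "Q.cls (f \<oplus>\<^bsub>TF\<^esub> b \<odot>\<^bsub>TF\<^esub> d (m, x)) = Q.cls f \<oplus>\<^bsub>T\<^esub> pure (b \<odot>\<^bsub>M\<^esub> m) x"
      using add p by (simp add: TF_eq d_closed cls_smult pure_smult_left flip: pure_eq)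
    then show ?case using step[of "Q.cls f" "b \<odot>\<^bsub>M\<^esub> m" x] add p by (simp add: TF_eq)
  qed
  then show ?thesis using X Q.carrier_quot unfolding T_eq by auto
qed

text \<open>
  The universal property for bilinear maps into modules. The linear extension \<open>\<Lambda>\<close> of \<open>\<kappa>\<close> has to vanish on
  the ideal generated by the relations, although it is not multiplicative and its kernel is only a submodule. The elements all of whose multiples are killed by \<open>\<Lambda>\<close> form an ideal, and it
  contains the relations because \<open>(p, q)\<close> times a relation is again a relation.
\<close>

lemma lift_bilinear:
  assumes P: "module B P" and \<kappa>: "\<And>m x. m \<in> carrier M \<Longrightarrow> x \<in> carrier N \<Longrightarrow> \<kappa> m x \<in> carrier P"
    and add_left: "\<And>m m' x. m \<in> carrier M \<Longrightarrow> m' \<in> carrier M \<Longrightarrow> x \<in> carrier N \<Longrightarrow> \<kappa> (m \<oplus>\<^bsub>M\<^esub> m') x = \<kappa> m x \<oplus>\<^bsub>P\<^esub> \<kappa> m' x"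
    and add_right: "\<And>m x x'. m \<in> carrier M \<Longrightarrow> x \<in> carrier N \<Longrightarrow> x' \<in> carrier N \<Longrightarrow> \<kappa> m (x \<oplus>\<^bsub>N\<^esub> x') = \<kappa> m x \<oplus>\<^bsub>P\<^esub> \<kappa> m x'"
    and smult_left: "\<And>b m x. b \<in> carrier B \<Longrightarrow> m \<in> carrier M \<Longrightarrow> x \<in> carrier N \<Longrightarrow> \<kappa> (b \<odot>\<^bsub>M\<^esub> m) x = b \<odot>\<^bsub>P\<^esub> \<kappa> m x"
    and smult_right: "\<And>b m x. b \<in> carrier B \<Longrightarrow> m \<in> carrier M \<Longrightarrow> x \<in> carrier N \<Longrightarrow> \<kappa> m (b \<odot>\<^bsub>N\<^esub> x) = b \<odot>\<^bsub>P\<^esub> \<kappa> m x"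
  obtains lin where "\<And>X. X \<in> carrier T \<Longrightarrow> lin X \<in> carrier P"
    "\<And>X Y. X \<in> carrier T \<Longrightarrow> Y \<in> carrier T \<Longrightarrow> lin (X \<oplus>\<^bsub>T\<^esub> Y) = lin X \<oplus>\<^bsub>P\<^esub> lin Y"
    "\<And>m x. m \<in> carrier M \<Longrightarrow> x \<in> carrier N \<Longrightarrow> lin (pure m x) = \<kappa> m x"
proof -
  interpret P: module B P by fact
  let ?k = "\<lambda>(m, x). \<kappa> m x"
  let ?\<Lambda> = "lin_ext B P (\<lambda>b. b) ?k"
  have id: "(\<lambda>b. b) \<in> ring_hom B B" by (auto intro: ring_hom_memI)
  have k: "?k \<in> carrier (M \<times>\<times> N) \<rightarrow> carrier P" using \<kappa> by auto
  note L = P id k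
  have \<Lambda>_closed: "?\<Lambda> x \<in> carrier P" if "x \<in> carrier TF" for x
    using F.lin_ext_closed[OF L] that by (simp add: TF_eq)
  have \<Lambda>_add: "?\<Lambda> (x \<oplus>\<^bsub>TF\<^esub> y) = ?\<Lambda> x \<oplus>\<^bsub>P\<^esub> ?\<Lambda> y" if "x \<in> carrier TF" "y \<in> carrier TF" for x y
    using F.lin_ext_add[OF L] that by (simp add: TF_eq)
  have \<Lambda>_smult: "?\<Lambda> (b \<odot>\<^bsub>TF\<^esub> x) = b \<odot>\<^bsub>P\<^esub> ?\<Lambda> x" if "b \<in> carrier B" "x \<in> carrier TF" for b x
    using F.lin_ext_smult[OF L] that by (simp add: TF_eq)
  have \<Lambda>_d: "?\<Lambda> (d (m, x)) = \<kappa> m x" if "m \<in> carrier M" "x \<in> carrier N" for m x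
    using F.lin_ext_single[OF L, of "(m, x)"] that by simp
  have \<Lambda>_zero: "?\<Lambda> \<zero>\<^bsub>TF\<^esub> = \<zero>\<^bsub>P\<^esub>"
    using F.lin_ext_zero[OF L] by (simp add: TF_eq)
  have \<Lambda>_minus: "?\<Lambda> (x \<ominus>\<^bsub>TF\<^esub> y) = ?\<Lambda> x \<ominus>\<^bsub>P\<^esub> ?\<Lambda> y" if "x \<in> carrier TF" "y \<in> carrier TF" for x y
  proof -
    have "?\<Lambda> x = ?\<Lambda> ((x \<ominus>\<^bsub>TF\<^esub> y) \<oplus>\<^bsub>TF\<^esub> y)" using that by (simp add: TF.minus_eq TF.M.a_assoc TF.l_neg)
    also have "\<dots> = ?\<Lambda> (x \<ominus>\<^bsub>TF\<^esub> y) \<oplus>\<^bsub>P\<^esub> ?\<Lambda> y" using that by (intro \<Lambda>_add) auto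
    finally show ?thesis using that \<Lambda>_closed by (simp add: P.M.minus_eq P.M.a_assoc P.M.r_neg)
  qed
  let ?J = "{x \<in> carrier TF. \<forall>y\<in>carrier TF. ?\<Lambda> (y \<otimes>\<^bsub>TF\<^esub> x) = \<zero>\<^bsub>P\<^esub>}"
  have J: "ideal ?J TF"
  proof (rule idealI[OF TF.ring_axioms])
    show "subgroup ?J (add_monoid TF)"
    proof (rule TF.add.subgroupI)
      fix a assume "a \<in> ?J"
      then have a: "a \<in> carrier TF" "\<And>y. y \<in> carrier TF \<Longrightarrow> ?\<Lambda> (y \<otimes>\<^bsub>TF\<^esub> a) = \<zero>\<^bsub>P\<^esub>" by auto
      have "?\<Lambda> (y \<otimes>\<^bsub>TF\<^esub> \<ominus>\<^bsub>TF\<^esub> a) = \<zero>\<^bsub>P\<^esub>" if "y \<in> carrier TF" for y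
        using a(2)[of "\<ominus>\<^bsub>TF\<^esub> y"] a(1) that by (simp add: TF.r_minus TF.l_minus)
      then show "\<ominus>\<^bsub>TF\<^esub> a \<in> ?J" using a(1) by simp
    qed (auto simp: TF.r_distr \<Lambda>_add \<Lambda>_zero)
  next
    fix a x assume "a \<in> ?J" and x: "x \<in> carrier TF"
    then have a: "a \<in> carrier TF" "\<And>y. y \<in> carrier TF \<Longrightarrow> ?\<Lambda> (y \<otimes>\<^bsub>TF\<^esub> a) = \<zero>\<^bsub>P\<^esub>" by auto
    show "x \<otimes>\<^bsub>TF\<^esub> a \<in> ?J" using a x by (simp flip: TF.m_assoc)
    then show "a \<otimes>\<^bsub>TF\<^esub> x \<in> ?J" using a x by (simp add: TF.m_comm)
  qed
  have rel: "?\<Lambda> (d (p, q) \<otimes>\<^bsub>TF\<^esub> r) = \<zero>\<^bsub>P\<^esub>"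
    if r: "r \<in> tensor_rels B M N" and pq: "p \<in> carrier M" "q \<in> carrier N" for p q r
    using r
  proof (cases rule: tensor_rels_cases)
    case (1 m m' x)
    have "d (p, q) \<otimes>\<^bsub>TF\<^esub> r = d (p \<otimes>\<^bsub>M\<^esub> m \<oplus>\<^bsub>M\<^esub> p \<otimes>\<^bsub>M\<^esub> m', q \<otimes>\<^bsub>N\<^esub> x)
        \<ominus>\<^bsub>TF\<^esub> (d (p \<otimes>\<^bsub>M\<^esub> m, q \<otimes>\<^bsub>N\<^esub> x) \<oplus>\<^bsub>TF\<^esub> d (p \<otimes>\<^bsub>M\<^esub> m', q \<otimes>\<^bsub>N\<^esub> x))"
      using 1 pq by (simp add: TF.minus_eq TF.r_distr TF.r_minus d_closed d_mult M.r_distr)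
    then show ?thesis using 1 pq by (simp add: \<Lambda>_minus \<Lambda>_add \<Lambda>_d d_closed add_left \<kappa> P.M.minus_eq P.M.r_neg)
  next
    case (2 m x x')
    have "d (p, q) \<otimes>\<^bsub>TF\<^esub> r = d (p \<otimes>\<^bsub>M\<^esub> m, q \<otimes>\<^bsub>N\<^esub> x \<oplus>\<^bsub>N\<^esub> q \<otimes>\<^bsub>N\<^esub> x')
        \<ominus>\<^bsub>TF\<^esub> (d (p \<otimes>\<^bsub>M\<^esub> m, q \<otimes>\<^bsub>N\<^esub> x) \<oplus>\<^bsub>TF\<^esub> d (p \<otimes>\<^bsub>M\<^esub> m, q \<otimes>\<^bsub>N\<^esub> x'))"
      using 2 pq by (simp add: TF.minus_eq TF.r_distr TF.r_minus d_closed d_mult N.r_distr)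
    then show ?thesis using 2 pq by (simp add: \<Lambda>_minus \<Lambda>_add \<Lambda>_d d_closed add_right \<kappa> P.M.minus_eq P.M.r_neg)
  next
    case (3 b m x)
    have "d (p, q) \<otimes>\<^bsub>TF\<^esub> r = d (b \<odot>\<^bsub>M\<^esub> (p \<otimes>\<^bsub>M\<^esub> m), q \<otimes>\<^bsub>N\<^esub> x) \<ominus>\<^bsub>TF\<^esub> b \<odot>\<^bsub>TF\<^esub> d (p \<otimes>\<^bsub>M\<^esub> m, q \<otimes>\<^bsub>N\<^esub> x)"
      using 3 pq by (simp add: TF.minus_eq TF.r_distr TF.r_minus d_closed d_mult M.mult_smult_right TF.mult_smult_right)
    then show ?thesis using 3 pq by (simp add: \<Lambda>_minus \<Lambda>_smult \<Lambda>_d d_closed smult_left \<kappa> P.M.minus_eq P.M.r_neg)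
  next
    case (4 b m x)
    have "d (p, q) \<otimes>\<^bsub>TF\<^esub> r = d (p \<otimes>\<^bsub>M\<^esub> m, b \<odot>\<^bsub>N\<^esub> (q \<otimes>\<^bsub>N\<^esub> x)) \<ominus>\<^bsub>TF\<^esub> b \<odot>\<^bsub>TF\<^esub> d (p \<otimes>\<^bsub>M\<^esub> m, q \<otimes>\<^bsub>N\<^esub> x)"
      using 4 pq by (simp add: TF.minus_eq TF.r_distr TF.r_minus d_closed d_mult N.mult_smult_right TF.mult_smult_right)
    then show ?thesis using 4 pq by (simp add: \<Lambda>_minus \<Lambda>_smult \<Lambda>_d d_closed smult_right \<kappa> P.M.minus_eq P.M.r_neg)
  qed
  have "tensor_rels B M N \<subseteq> ?J"
  proof
    fix r assume r: "r \<in> tensor_rels B M N"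
    then have rc: "r \<in> carrier TF" using tensor_rels_closed by auto
    have "?\<Lambda> (y \<otimes>\<^bsub>TF\<^esub> r) = \<zero>\<^bsub>P\<^esub>" if y: "y \<in> carrier TF" for y
      using y[folded TF_eq]
    proof (induction y rule: F.single_induct)
      case zero
      then show ?case using rc by (simp add: TF_eq \<Lambda>_zero)
    next
      case (add y b p)
      obtain m x where p: "p = (m, x)" "m \<in> carrier M" "x \<in> carrier N" using add by auto
      have y: "y \<in> carrier TF" using add by (simp add: TF_eq)
      have "(y \<oplus>\<^bsub>TF\<^esub> b \<odot>\<^bsub>TF\<^esub> d (m, x)) \<otimes>\<^bsub>TF\<^esub> r = y \<otimes>\<^bsub>TF\<^esub> r \<oplus>\<^bsub>TF\<^esub> b \<odot>\<^bsub>TF\<^esub> (d (m, x) \<otimes>\<^bsub>TF\<^esub> r)"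
        using y add p rc by (simp add: TF.l_distr TF.smult_assoc2 d_closed)
      then show ?case
        using add y p rc rel[OF r p(2,3)] by (simp add: TF_eq \<Lambda>_add \<Lambda>_smult d_closed)
    qed
    then show "r \<in> ?J" using rc by simp
  qed
  then have "tensor_ideal B M N \<subseteq> ?J"
    unfolding tensor_ideal_def by (rule TF.genideal_minimal[OF J])
  then have 0: "?\<Lambda> x = \<zero>\<^bsub>P\<^esub>" if "x \<in> tensor_ideal B M N" for x
    using that TF.l_one[of x] by force
  have const: "quot_lift ?\<Lambda> (Q.cls x) = ?\<Lambda> x" if x: "x \<in> carrier TF" for x
  proof -
    have "?\<Lambda> y = ?\<Lambda> x" if y: "y \<in> Q.cls x" for y
    proof -
      obtain i where i: "i \<in> tensor_ideal B M N" "y = i \<oplus>\<^bsub>TF\<^esub> x" using Q.mem_cls[OF y x] by blast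
      show ?thesis unfolding i(2) \<Lambda>_add[OF I.a_Hcarr[OF i(1)] x] 0[OF i(1)]
        using \<Lambda>_closed[OF x] by simp
    qed
    then have "?\<Lambda> ` Q.cls x = {?\<Lambda> x}" using I.a_rcos_self[OF x] by blast
    then show ?thesis by (simp add: quot_lift_def)
  qed
  have carr: "carrier T = Q.cls ` carrier TF" using Q.carrier_quot unfolding T_eq .
  show thesis
  proof (rule that[of "quot_lift ?\<Lambda>"])
    show "quot_lift ?\<Lambda> X \<in> carrier P" if "X \<in> carrier T" for X
      using that unfolding carr by (auto simp: const \<Lambda>_closed)
    show "quot_lift ?\<Lambda> (X \<oplus>\<^bsub>T\<^esub> Y) = quot_lift ?\<Lambda> X \<oplus>\<^bsub>P\<^esub> quot_lift ?\<Lambda> Y" if "X \<in> carrier T" "Y \<in> carrier T" for X Y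
    proof -
      obtain x y where x: "x \<in> carrier TF" "X = Q.cls x" and y: "y \<in> carrier TF" "Y = Q.cls y"
        using \<open>X \<in> carrier T\<close> \<open>Y \<in> carrier T\<close> unfolding carr by blast
      have "X \<oplus>\<^bsub>T\<^esub> Y = Q.cls (x \<oplus>\<^bsub>TF\<^esub> y)" using x y by simp
      then show ?thesis using x y by (simp only: const TF.M.a_closed \<Lambda>_add)
    qed
    show "quot_lift ?\<Lambda> (pure m x) = \<kappa> m x" if "m \<in> carrier M" "x \<in> carrier N" for m x
      using that by (simp add: pure_eq const d_closed \<Lambda>_d)
  qed
qed

text \<open>
  The tensor product is the coproduct of commutative algebras. The homomorphism is given in the form
  \<open>quot_lift (lin_ext \<dots>)\<close> in which the canonical maps are defined.
\<close>

lemma lift_homs: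
  assumes P: "algebra B' P" and g: "g \<in> ring_hom B B'"
    and f: "f \<in> semilinear_hom B g M P" and h: "h \<in> semilinear_hom B g N P"
    and k: "\<And>m x. m \<in> carrier M \<Longrightarrow> x \<in> carrier N \<Longrightarrow> k (m, x) = f m \<otimes>\<^bsub>P\<^esub> h x"
  shows "quot_lift (lin_ext B P g k) \<in> semilinear_hom B g T P"
    and "\<And>m x. m \<in> carrier M \<Longrightarrow> x \<in> carrier N \<Longrightarrow> quot_lift (lin_ext B P g k) (pure m x) = f m \<otimes>\<^bsub>P\<^esub> h x"
proof -
  interpret P: algebra B' P by fact
  interpret f: ring_hom_cring M P f using semilinear_homD(1)[OF f] by unfold_locales
  interpret h: ring_hom_cring N P h using semilinear_homD(1)[OF h] by unfold_locales
  interpret g: ring_hom_cring B B' g using g by unfold_locales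
  have khom: "k \<in> hom (M \<times>\<times> N) P"
    by (auto simp: hom_def k P.m_ac)
  have kone: "k \<one>\<^bsub>M \<times>\<times> N\<^esub> = \<one>\<^bsub>P\<^esub>" by (simp add: k)
  have kc: "k \<in> carrier (M \<times>\<times> N) \<rightarrow> carrier P" by (auto simp: k)
  let ?\<Lambda> = "lin_ext B P g k"
  have \<Lambda>: "?\<Lambda> \<in> semilinear_hom B g TF P"
    using F.lin_ext_hom[OF P g khom kone] by (simp add: TF_eq)
  interpret \<Lambda>: ring_hom_cring TF P ?\<Lambda> using semilinear_homD(1)[OF \<Lambda>] by unfold_locales
  have \<Lambda>_d: "?\<Lambda> (d (m, x)) = f m \<otimes>\<^bsub>P\<^esub> h x" if "m \<in> carrier M" "x \<in> carrier N" for m x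
    using F.lin_ext_single[OF P.module g kc, of "(m, x)"] that by (simp add: k)
  have rel: "?\<Lambda> r = \<zero>\<^bsub>P\<^esub>" if "r \<in> tensor_rels B M N" for r
    using that
    by (cases rule: tensor_rels_cases)
      (simp_all add: TF.minus_eq d_closed \<Lambda>_d semilinear_homD(2)[OF \<Lambda>] semilinear_homD(2)[OF f]
        semilinear_homD(2)[OF h] P.l_distr P.r_distr P.M.r_neg P.smult_assoc2 P.mult_smult_right)
  have 0: "?\<Lambda> x = \<zero>\<^bsub>P\<^esub>" if "x \<in> tensor_ideal B M N" for x
    by (rule ring_hom_vanishes_genideal[OF TF.ring_axioms P.ring_axioms \<Lambda>.homh tensor_rels_closed rel
          that[unfolded tensor_ideal_def]])
  show "quot_lift ?\<Lambda> \<in> semilinear_hom B g T P"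
    using Q.quot_lift_semilinear[OF P.M_cring \<Lambda> 0] unfolding T_eq .
  show "quot_lift ?\<Lambda> (pure m x) = f m \<otimes>\<^bsub>P\<^esub> h x" if "m \<in> carrier M" "x \<in> carrier N" for m x
    unfolding pure_eq using Q.quot_lift_hom(2)[OF P.M_cring \<Lambda>.homh 0 d_closed[OF that]] \<Lambda>_d[OF that] by simp
qed

text \<open>
  The pure tensors \<open>m \<otimes> x = (m \<otimes> 1)(1 \<otimes> x)\<close> span \<open>T\<close> additively.
\<close>

lemma hom_eqI:
  assumes P: "ring P" and u: "u \<in> ring_hom T P" and v: "v \<in> ring_hom T P"
    and 1: "\<And>m. m \<in> carrier M \<Longrightarrow> u (pure m \<one>\<^bsub>N\<^esub>) = v (pure m \<one>\<^bsub>N\<^esub>)"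
    and 2: "\<And>x. x \<in> carrier N \<Longrightarrow> u (pure \<one>\<^bsub>M\<^esub> x) = v (pure \<one>\<^bsub>M\<^esub> x)"
    and X: "X \<in> carrier T"
  shows "u X = v X"
  using X
proof (induction X rule: pure_induct)
  case zero
  then show ?case using ring_hom_zero[OF u T.ring_axioms P] ring_hom_zero[OF v T.ring_axioms P] by simp
next
  case (add X m x)
  have "pure m x = pure m \<one>\<^bsub>N\<^esub> \<otimes>\<^bsub>T\<^esub> pure \<one>\<^bsub>M\<^esub> x" using add by (simp add: pure_mult)
  then have "u (pure m x) = v (pure m x)"
    using add 1 2 by (simp add: ring_hom_mult[OF u] ring_hom_mult[OF v])
  then show ?case using add by (simp add: ring_hom_add[OF u] ring_hom_add[OF v])
qed

text \<open>
  The extension of scalars of \<open>M\<close> along \<open>B \<rightarrow> N\<close> is \<open>T\<close> with scalars in \<open>N\<close> instead of \<open>B\<close>.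
\<close>

abbreviation "E \<equiv> base_change B M N"

lemma E_ops:
  "carrier E = carrier T" "monoid.mult E = monoid.mult T" "one E = one T" "zero E = zero T"
  "ring.add E = ring.add T" "c \<odot>\<^bsub>E\<^esub> X = pure \<one>\<^bsub>M\<^esub> c \<otimes>\<^bsub>T\<^esub> X"
  by (simp_all add: base_change_def Let_def)

lemma ring_hom_E: "ring_hom E P = ring_hom T P" "ring_hom P E = ring_hom P T"
  by (simp_all add: ring_hom_def E_ops)

lemma right_hom: "(\<lambda>x. pure \<one>\<^bsub>M\<^esub> x) \<in> ring_hom N T"
  by (rule ring_hom_memI) (auto simp: pure_mult pure_add_right pure_one)

lemma left_hom: "(\<lambda>m. pure m \<one>\<^bsub>N\<^esub>) \<in> ring_hom M T"
  by (rule ring_hom_memI) (auto simp: pure_mult pure_add_left pure_one)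

lemma algebra_E: "algebra N E"
  by (rule algebra_of_ring_hom[OF N.M_cring T.M_cring right_hom E_ops])

sublocale E: algebra N E by (rule algebra_E)

lemma smult_pure: "c \<in> carrier N \<Longrightarrow> m \<in> carrier M \<Longrightarrow> x \<in> carrier N \<Longrightarrow> c \<odot>\<^bsub>E\<^esub> pure m x = pure m (c \<otimes>\<^bsub>N\<^esub> x)"
  by (simp add: E_ops pure_mult)

lemma smult_one_E: "c \<in> carrier N \<Longrightarrow> c \<odot>\<^bsub>E\<^esub> \<one>\<^bsub>E\<^esub> = pure \<one>\<^bsub>M\<^esub> c"
  by (simp add: E_ops)

lemma left_semilinear: "(\<lambda>m. pure m \<one>\<^bsub>N\<^esub>) \<in> semilinear_hom B (\<lambda>b. b \<odot>\<^bsub>N\<^esub> \<one>\<^bsub>N\<^esub>) M E"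
proof (rule semilinear_homI)
  show "(\<lambda>m. pure m \<one>\<^bsub>N\<^esub>) \<in> ring_hom M E" using left_hom by (simp add: ring_hom_E)
  fix b m assume "b \<in> carrier B" "m \<in> carrier M"
  then show "pure (b \<odot>\<^bsub>M\<^esub> m) \<one>\<^bsub>N\<^esub> = (b \<odot>\<^bsub>N\<^esub> \<one>\<^bsub>N\<^esub>) \<odot>\<^bsub>E\<^esub> pure m \<one>\<^bsub>N\<^esub>"
    by (simp add: smult_pure pure_smult_left pure_smult_right)
qed

lemma E_spanned: "carrier E \<subseteq> add_span E {c \<odot>\<^bsub>E\<^esub> s | c s. c \<in> carrier N \<and> s \<in> (\<lambda>m. pure m \<one>\<^bsub>N\<^esub>) ` carrier M}"
proof
  fix X assume "X \<in> carrier E"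
  then have "X \<in> carrier T" by (simp add: E_ops)
  then show "X \<in> add_span E {c \<odot>\<^bsub>E\<^esub> s | c s. c \<in> carrier N \<and> s \<in> (\<lambda>m. pure m \<one>\<^bsub>N\<^esub>) ` carrier M}"
  proof (induction X rule: pure_induct)
    case zero
    then show ?case using add_span.zero[of E] by (simp add: E_ops)
  next
    case (add X m x)
    have "pure m x = x \<odot>\<^bsub>E\<^esub> pure m \<one>\<^bsub>N\<^esub>" using add by (simp add: smult_pure)
    then have "pure m x \<in> {c \<odot>\<^bsub>E\<^esub> s | c s. c \<in> carrier N \<and> s \<in> (\<lambda>m. pure m \<one>\<^bsub>N\<^esub>) ` carrier M}"
      using add by blast
    from add_span.add[OF add.IH this] show ?case by (simp only: E_ops(5))
  qed
qed

text \<open>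
  The \<open>i\<close>-th coordinate of \<open>\<Sum> m \<otimes> x\<close> with respect to the elements \<open>e\<^sub>i \<otimes> 1\<close> should be \<open>\<Sum> m\<^sub>i x\<close>, where
  \<open>m\<^sub>i\<close> is the \<open>i\<close>-th coordinate of \<open>m\<close>. This expression is bilinear, so it defines a map \<open>lin i\<close> on the tensor
  product. That \<open>X = \<Sum>\<^sub>i e\<^sub>i \<otimes> lin i X\<close> is checked on pure tensors, and the uniqueness of coordinates follows by
  applying \<open>lin j\<close> to a linear combination.
\<close>

lemma E_basis:
  assumes e: "module_basis B M n e"
  shows "module_basis N E n (\<lambda>i. pure (e i) \<one>\<^bsub>N\<^esub>)"
proof -
  have ec: "e i \<in> carrier M" if "i \<in> {1..n}" for i using M.basis_closed[OF e that] .
  note co = M.coord_closed[OF e]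
  have "\<exists>lin. (\<forall>X\<in>carrier T. lin X \<in> carrier N)
      \<and> (\<forall>X\<in>carrier T. \<forall>Y\<in>carrier T. lin (X \<oplus>\<^bsub>T\<^esub> Y) = lin X \<oplus>\<^bsub>N\<^esub> lin Y)
      \<and> (\<forall>m\<in>carrier M. \<forall>x\<in>carrier N. lin (pure m x) = coord B M n e m i \<odot>\<^bsub>N\<^esub> x)"
    if i: "i \<in> {1..n}" for i
  proof -
    obtain lin where "\<And>X. X \<in> carrier T \<Longrightarrow> lin X \<in> carrier N"
      "\<And>X Y. X \<in> carrier T \<Longrightarrow> Y \<in> carrier T \<Longrightarrow> lin (X \<oplus>\<^bsub>T\<^esub> Y) = lin X \<oplus>\<^bsub>N\<^esub> lin Y"
      "\<And>m x. m \<in> carrier M \<Longrightarrow> x \<in> carrier N \<Longrightarrow> lin (pure m x) = coord B M n e m i \<odot>\<^bsub>N\<^esub> x"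
    proof (rule lift_bilinear[where P = N and \<kappa> = "\<lambda>m x. coord B M n e m i \<odot>\<^bsub>N\<^esub> x"])
      show "coord B M n e m i \<odot>\<^bsub>N\<^esub> (b \<odot>\<^bsub>N\<^esub> x) = b \<odot>\<^bsub>N\<^esub> (coord B M n e m i \<odot>\<^bsub>N\<^esub> x)"
        if "b \<in> carrier B" "m \<in> carrier M" "x \<in> carrier N" for b m x
        using that co[OF that(2) i] by (simp add: M.R.m_comm flip: N.smult_assoc1)
    qed (use i co in \<open>auto simp: M.coord_add[OF e] M.coord_smult[OF e] N.smult_l_distr N.smult_r_distr N.smult_assoc1 N.module\<close>)
    then show ?thesis by blast
  qed
  then have "\<exists>lin. \<forall>i\<in>{1..n}. (\<forall>X\<in>carrier T. lin i X \<in> carrier N)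
      \<and> (\<forall>X\<in>carrier T. \<forall>Y\<in>carrier T. lin i (X \<oplus>\<^bsub>T\<^esub> Y) = lin i X \<oplus>\<^bsub>N\<^esub> lin i Y)
      \<and> (\<forall>m\<in>carrier M. \<forall>x\<in>carrier N. lin i (pure m x) = coord B M n e m i \<odot>\<^bsub>N\<^esub> x)"
    by (intro bchoice ballI)
  then obtain lin where lin:
    "\<And>i X. i \<in> {1..n} \<Longrightarrow> X \<in> carrier T \<Longrightarrow> lin i X \<in> carrier N"
    "\<And>i X Y. i \<in> {1..n} \<Longrightarrow> X \<in> carrier T \<Longrightarrow> Y \<in> carrier T \<Longrightarrow> lin i (X \<oplus>\<^bsub>T\<^esub> Y) = lin i X \<oplus>\<^bsub>N\<^esub> lin i Y"
    "\<And>i m x. i \<in> {1..n} \<Longrightarrow> m \<in> carrier M \<Longrightarrow> x \<in> carrier N \<Longrightarrow> lin i (pure m x) = coord B M n e m i \<odot>\<^bsub>N\<^esub> x"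
    by blast
  have lin0: "lin i \<zero>\<^bsub>T\<^esub> = \<zero>\<^bsub>N\<^esub>" if "i \<in> {1..n}" for i
  proof -
    have "lin i \<zero>\<^bsub>T\<^esub> \<oplus>\<^bsub>N\<^esub> lin i \<zero>\<^bsub>T\<^esub> = lin i \<zero>\<^bsub>T\<^esub>"
      unfolding lin(2)[OF that T.M.zero_closed T.M.zero_closed, symmetric] by simp
    then show ?thesis using lin(1)[OF that T.M.zero_closed] by (metis N.M.add.l_cancel_one')
  qed
  have fs: "(\<Oplus>\<^bsub>E\<^esub>i\<in>{1..n}. f i) = (\<Oplus>\<^bsub>T\<^esub>i\<in>{1..n}. f i)" if "\<And>i. i \<in> {1..n} \<Longrightarrow> f i \<in> carrier T" for f
    using that by (intro add_map_finsum[where h = "\<lambda>x. x"]) (auto simp: E_ops E.abelian_group_axioms T.abelian_group_axioms)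
  have lincomb: "(\<Oplus>\<^bsub>E\<^esub>i\<in>{1..n}. c i \<odot>\<^bsub>E\<^esub> pure (e i) \<one>\<^bsub>N\<^esub>) = (\<Oplus>\<^bsub>T\<^esub>i\<in>{1..n}. pure (e i) (c i))"
    if c: "\<And>i. i \<in> {1..n} \<Longrightarrow> c i \<in> carrier N" for c
  proof -
    have p: "c i \<odot>\<^bsub>E\<^esub> pure (e i) \<one>\<^bsub>N\<^esub> = pure (e i) (c i)" if "i \<in> {1..n}" for i
      using c ec that by (simp add: smult_pure)
    have "(\<Oplus>\<^bsub>E\<^esub>i\<in>{1..n}. c i \<odot>\<^bsub>E\<^esub> pure (e i) \<one>\<^bsub>N\<^esub>) = (\<Oplus>\<^bsub>T\<^esub>i\<in>{1..n}. c i \<odot>\<^bsub>E\<^esub> pure (e i) \<one>\<^bsub>N\<^esub>)"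
      using c ec by (intro fs) (auto simp: p)
    also have "\<dots> = (\<Oplus>\<^bsub>T\<^esub>i\<in>{1..n}. pure (e i) (c i))"
      using c ec by (intro T.M.finsum_cong') (auto simp: p)
    finally show ?thesis .
  qed
  have expand: "X = (\<Oplus>\<^bsub>T\<^esub>i\<in>{1..n}. pure (e i) (lin i X))" if "X \<in> carrier T" for X
    using that
  proof (induction X rule: pure_induct)
    case zero
    have "(\<Oplus>\<^bsub>T\<^esub>i\<in>{1..n}. pure (e i) (lin i \<zero>\<^bsub>T\<^esub>)) = \<zero>\<^bsub>T\<^esub>"
    proof (rule T.M.add.finprod_one_eqI)
      fix i assume i: "i \<in> {1..n}"
      have "pure (e i) (\<zero>\<^bsub>B\<^esub> \<odot>\<^bsub>N\<^esub> \<zero>\<^bsub>N\<^esub>) = \<zero>\<^bsub>B\<^esub> \<odot>\<^bsub>T\<^esub> pure (e i) \<zero>\<^bsub>N\<^esub>"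
        using ec[OF i] by (intro pure_smult_right) auto
      then show "pure (e i) (lin i \<zero>\<^bsub>T\<^esub>) = \<zero>\<^bsub>T\<^esub>" using i ec[OF i] lin0 by simp
    qed
    then show ?case by simp
  next
    case (add X m x)
    have "pure m x = pure (\<Oplus>\<^bsub>M\<^esub>i\<in>{1..n}. coord B M n e m i \<odot>\<^bsub>M\<^esub> e i) x"
      using M.coord_expand[OF e] add by simp
    also have "\<dots> = (\<Oplus>\<^bsub>T\<^esub>i\<in>{1..n}. pure (coord B M n e m i \<odot>\<^bsub>M\<^esub> e i) x)"
      using add co ec
      by (intro add_map_finsum[where h = "\<lambda>m. pure m x"]) (auto simp: pure_add_left M.abelian_group_axioms T.abelian_group_axioms)
    also have "\<dots> = (\<Oplus>\<^bsub>T\<^esub>i\<in>{1..n}. pure (e i) (lin i (pure m x)))"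
      using add co ec by (intro T.M.finsum_cong') (auto simp: lin pure_smult_left pure_smult_right)
    finally have p: "pure m x = (\<Oplus>\<^bsub>T\<^esub>i\<in>{1..n}. pure (e i) (lin i (pure m x)))" .
    have "(\<Oplus>\<^bsub>T\<^esub>i\<in>{1..n}. pure (e i) (lin i (X \<oplus>\<^bsub>T\<^esub> pure m x)))
      = (\<Oplus>\<^bsub>T\<^esub>i\<in>{1..n}. pure (e i) (lin i X) \<oplus>\<^bsub>T\<^esub> pure (e i) (lin i (pure m x)))"
      using add(1-3) ec lin(1) by (intro T.M.finsum_cong') (auto simp: lin(2) pure_add_right)
    also have "\<dots> = (\<Oplus>\<^bsub>T\<^esub>i\<in>{1..n}. pure (e i) (lin i X)) \<oplus>\<^bsub>T\<^esub> (\<Oplus>\<^bsub>T\<^esub>i\<in>{1..n}. pure (e i) (lin i (pure m x)))"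
      using add(1-3) ec lin(1) by (intro T.M.finsum_addf) auto
    also have "\<dots> = X \<oplus>\<^bsub>T\<^esub> pure m x" using add.IH p by simp
    finally show ?case ..
  qed
  have uniq: "lin j (\<Oplus>\<^bsub>T\<^esub>i\<in>{1..n}. pure (e i) (c i)) = c j"
    if c: "\<And>i. i \<in> {1..n} \<Longrightarrow> c i \<in> carrier N" and j: "j \<in> {1..n}" for c j
  proof -
    have "lin j (\<Oplus>\<^bsub>T\<^esub>i\<in>{1..n}. pure (e i) (c i)) = (\<Oplus>\<^bsub>N\<^esub>i\<in>{1..n}. lin j (pure (e i) (c i)))"
      using c ec j lin by (intro add_map_finsum) (auto simp: N.abelian_group_axioms T.abelian_group_axioms)
    also have "\<dots> = (\<Oplus>\<^bsub>N\<^esub>i\<in>{1..n}. if j = i then c j else \<zero>\<^bsub>N\<^esub>)"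
      using c ec j by (intro N.M.finsum_cong') (auto simp: lin(3) M.coord_basis[OF e])
    also have "\<dots> = c j" using N.M.add.finprod_singleton[of j "{1..n}" "\<lambda>_. c j"] c j by simp
    finally show ?thesis .
  qed
  show ?thesis
    unfolding module_basis_def
  proof (intro conjI ballI)
    show "(\<lambda>i. pure (e i) \<one>\<^bsub>N\<^esub>) \<in> {1..n} \<rightarrow> carrier E" using ec by (auto simp: E_ops)
    fix X assume X: "X \<in> carrier E"
    then have XT: "X \<in> carrier T" by (simp add: E_ops)
    show "\<exists>!c. coords_of N E n (\<lambda>i. pure (e i) \<one>\<^bsub>N\<^esub>) X c"
    proof (rule ex1I[of _ "\<lambda>i\<in>{1..n}. lin i X"])
      have r: "(\<lambda>i\<in>{1..n}. lin i X) \<in> {1..n} \<rightarrow>\<^sub>E carrier N" using lin(1) XT by auto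
      have "(\<Oplus>\<^bsub>E\<^esub>i\<in>{1..n}. (\<lambda>i\<in>{1..n}. lin i X) i \<odot>\<^bsub>E\<^esub> pure (e i) \<one>\<^bsub>N\<^esub>) = (\<Oplus>\<^bsub>T\<^esub>i\<in>{1..n}. pure (e i) ((\<lambda>i\<in>{1..n}. lin i X) i))"
        using lin(1) XT by (intro lincomb) auto
      also have "\<dots> = (\<Oplus>\<^bsub>T\<^esub>i\<in>{1..n}. pure (e i) (lin i X))"
        using lin(1) XT ec by (intro T.M.finsum_cong') auto
      finally show "coords_of N E n (\<lambda>i. pure (e i) \<one>\<^bsub>N\<^esub>) X (\<lambda>i\<in>{1..n}. lin i X)"
        unfolding coords_of_def using r expand[OF XT] by simp
    next
      fix c assume "coords_of N E n (\<lambda>i. pure (e i) \<one>\<^bsub>N\<^esub>) X c"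
      then have c: "c \<in> {1..n} \<rightarrow>\<^sub>E carrier N" and Xc: "X = (\<Oplus>\<^bsub>E\<^esub>i\<in>{1..n}. c i \<odot>\<^bsub>E\<^esub> pure (e i) \<one>\<^bsub>N\<^esub>)"
        by (auto simp: coords_of_def)
      have cc: "c i \<in> carrier N" if "i \<in> {1..n}" for i using c that by auto
      have "lin i X = c i" if "i \<in> {1..n}" for i
        using uniq[of c i] lincomb[of c] cc that by (simp add: Xc)
      then show "c = (\<lambda>i\<in>{1..n}. lin i X)"
        using c by (intro ext) (auto simp: PiE_def extensional_def)
    qed
  qed
qed

end

lemma tensor_map_hom:
  assumes "algebra B M" "algebra B N" "algebra B M'" "algebra B N'"
    and f: "f \<in> algebra_hom B M M'" and h: "h \<in> algebra_hom B N N'"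
  shows "tensor_map B M' N' f h \<in> semilinear_hom N h (base_change B M N) (base_change B M' N')"
    and "\<And>m x. m \<in> carrier M \<Longrightarrow> x \<in> carrier N \<Longrightarrow>
      tensor_map B M' N' f h (tensor_pure B M N m x) = tensor_pure B M' N' (f m) (h x)"
proof -
  interpret S: tensor_pair B M N using assms(1,2) by (rule tensor_pair.intro)
  interpret S': tensor_pair B M' N' using assms(3,4) by (rule tensor_pair.intro)
  note f' = f[unfolded algebra_hom_eq_semilinear_hom] and h' = h[unfolded algebra_hom_eq_semilinear_hom]
  interpret f: ring_hom_cring M M' f using semilinear_homD(1)[OF f'] by unfold_locales
  interpret h: ring_hom_cring N N' h using semilinear_homD(1)[OF h'] by unfold_locales
  have id: "(\<lambda>b. b) \<in> ring_hom B B" by (auto intro: ring_hom_memI)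
  have 1: "(\<lambda>m. S'.pure (f m) \<one>\<^bsub>N'\<^esub>) \<in> semilinear_hom B (\<lambda>b. b) M S'.T"
    by (rule semilinear_homI, rule ring_hom_memI)
      (auto simp: S'.pure_mult S'.pure_add_left S'.pure_one S'.pure_smult_left semilinear_homD(2)[OF f'])
  have 2: "(\<lambda>x. S'.pure \<one>\<^bsub>M'\<^esub> (h x)) \<in> semilinear_hom B (\<lambda>b. b) N S'.T"
    by (rule semilinear_homI, rule ring_hom_memI)
      (auto simp: S'.pure_mult S'.pure_add_right S'.pure_one S'.pure_smult_right semilinear_homD(2)[OF h'])
  note L = S.lift_homs[OF S'.T.algebra_axioms id 1 2, where k = "\<lambda>(m, x). S'.pure (f m) (h x)", folded tensor_map_def]
  have L1: "tensor_map B M' N' f h \<in> semilinear_hom B (\<lambda>b. b) S.T S'.T"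
    by (rule L(1)) (simp add: S'.pure_mult)
  show L2: "tensor_map B M' N' f h (S.pure m x) = S'.pure (f m) (h x)" if "m \<in> carrier M" "x \<in> carrier N" for m x
    using L(2)[of m x] that by (simp add: S'.pure_mult)
  show "tensor_map B M' N' f h \<in> semilinear_hom N h (base_change B M N) (base_change B M' N')"
  proof (rule semilinear_homI)
    show "tensor_map B M' N' f h \<in> ring_hom S.E S'.E"
      using semilinear_homD(1)[OF L1] by (simp add: S.ring_hom_E S'.ring_hom_E)
    fix c X assume "c \<in> carrier N" "X \<in> carrier S.E"
    then show "tensor_map B M' N' f h (c \<odot>\<^bsub>S.E\<^esub> X) = h c \<odot>\<^bsub>S'.E\<^esub> tensor_map B M' N' f h X"
      using ring_hom_mult[OF semilinear_homD(1)[OF L1]] by (simp add: S.E_ops S'.E_ops L2)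
  qed
qed

section \<open>Tensor powers\<close>

text \<open>
  The tensor power \<open>T\<close> is \<open>B[A\<^sup>n]\<close>, here \<open>TF\<close>, modulo the multilinearity relations; \<open>place i a\<close> is \<open>a\<^sup>(\<^sup>i\<^sup>)\<close>.
\<close>

locale tensor_pow = A: algebra B A
  for B :: "('b, 'k) ring_scheme" and A :: "('b, 'a, 'p) module_scheme" +
  fixes n :: nat
begin

abbreviation "G \<equiv> product_group {1..n} (\<lambda>_. A)"

lemma comm_monoid_G: "comm_monoid G"
  by (rule comm_monoidI) (auto simp: PiE_iff A.m_ac fun_eq_iff extensional_def intro!: restrict_ext)

sublocale F: comm_monoid_algebra B G
  by (intro comm_monoid_algebra.intro A.R_cring comm_monoid_G)

abbreviation "TF \<equiv> power_free B A n"
abbreviation "T \<equiv> tensor_power B A n"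
abbreviation pure where "pure \<equiv> power_pure B A n"
abbreviation place where "place \<equiv> power_place B A n"
abbreviation d where "d \<equiv> single B"
abbreviation tuples where "tuples \<equiv> {1..n} \<rightarrow>\<^sub>E carrier A"

lemma TF_eq: "monoid_algebra B G = TF"
  by (simp add: power_free_def)

sublocale TF: algebra B TF using F.algebra_F unfolding TF_eq .

lemma d_closed: "t \<in> tuples \<Longrightarrow> d t \<in> carrier TF"
  using F.single_closed[of t] by (simp add: TF_eq)

lemma d_mult: "t \<in> tuples \<Longrightarrow> t' \<in> tuples \<Longrightarrow> d t \<otimes>\<^bsub>TF\<^esub> d t' = d (\<lambda>i\<in>{1..n}. t i \<otimes>\<^bsub>A\<^esub> t' i)"
  using F.single_mult[of t t'] by (simp add: TF_eq)

lemma upd_tuple: "t \<in> tuples \<Longrightarrow> i \<in> {1..n} \<Longrightarrow> x \<in> carrier A \<Longrightarrow> t(i := x) \<in> tuples"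
  by (auto simp: PiE_iff extensional_def)

lemma power_rels_cases:
  assumes "r \<in> power_rels B A n"
  obtains t i x y where "r = d (t(i := x \<oplus>\<^bsub>A\<^esub> y)) \<ominus>\<^bsub>TF\<^esub> (d (t(i := x)) \<oplus>\<^bsub>TF\<^esub> d (t(i := y)))"
      "t \<in> tuples" "i \<in> {1..n}" "x \<in> carrier A" "y \<in> carrier A"
    | t i b x where "r = d (t(i := b \<odot>\<^bsub>A\<^esub> x)) \<ominus>\<^bsub>TF\<^esub> b \<odot>\<^bsub>TF\<^esub> d (t(i := x))"
      "t \<in> tuples" "i \<in> {1..n}" "b \<in> carrier B" "x \<in> carrier A"
  using assms unfolding power_rels_def Let_def
  apply (elim UnE CollectE exE conjE)
   apply (rule that(1); assumption)
  apply (rule that(2); assumption)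
  done

lemma power_rels_closed: "power_rels B A n \<subseteq> carrier TF"
proof
  fix r assume "r \<in> power_rels B A n"
  then show "r \<in> carrier TF"
    by (cases rule: power_rels_cases)
      (simp_all add: d_closed upd_tuple del: fun_upd_apply)
qed

sublocale I: ideal "power_ideal B A n" TF
  unfolding power_ideal_def by (rule TF.genideal_ideal[OF power_rels_closed])

sublocale Q: quotient_algebra B TF "power_ideal B A n" ..

lemma T_eq [simp]: "quot_algebra TF (power_ideal B A n) = T"
  by (simp add: tensor_power_def)

sublocale T: algebra B T using Q.algebra_quot unfolding T_eq .

lemma cls_hom: "Q.cls \<in> ring_hom TF T" using Q.cls_hom unfolding T_eq .
lemma cls_smult: "b \<in> carrier B \<Longrightarrow> x \<in> carrier TF \<Longrightarrow> Q.cls (b \<odot>\<^bsub>TF\<^esub> x) = b \<odot>\<^bsub>T\<^esub> Q.cls x"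
  using Q.smult_cls unfolding T_eq by simp

sublocale cls: ring_hom_cring TF T Q.cls using cls_hom by unfold_locales

lemma pure_eq: "pure t = Q.cls (d t)"
  by (simp add: power_pure_def)

lemma cls_eq:
  assumes "x \<ominus>\<^bsub>TF\<^esub> y \<in> power_rels B A n" "x \<in> carrier TF" "y \<in> carrier TF"
  shows "Q.cls x = Q.cls y"
proof -
  have "x \<ominus>\<^bsub>TF\<^esub> y \<in> power_ideal B A n"
    unfolding power_ideal_def using assms(1) TF.genideal_self[OF power_rels_closed] by blast
  then have "Q.cls (x \<ominus>\<^bsub>TF\<^esub> y) = \<zero>\<^bsub>T\<^esub>" using Q.cls_zero by (simp add: T_eq)
  then have "Q.cls x \<oplus>\<^bsub>T\<^esub> \<ominus>\<^bsub>T\<^esub> Q.cls y = \<zero>\<^bsub>T\<^esub>" using assms(2,3) by (simp add: TF.minus_eq)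
  then show ?thesis using assms(2,3) by (metis T.minus_equality T.minus_minus cls.hom_closed T.a_inv_closed)
qed

lemma pure_closed: "t \<in> tuples \<Longrightarrow> pure t \<in> carrier T"
  by (simp add: pure_eq d_closed)

lemma pure_update_add:
  assumes "t \<in> tuples" "i \<in> {1..n}" "x \<in> carrier A" "y \<in> carrier A"
  shows "pure (t(i := x \<oplus>\<^bsub>A\<^esub> y)) = pure (t(i := x)) \<oplus>\<^bsub>T\<^esub> pure (t(i := y))"
proof -
  have "Q.cls (d (t(i := x \<oplus>\<^bsub>A\<^esub> y))) = Q.cls (d (t(i := x)) \<oplus>\<^bsub>TF\<^esub> d (t(i := y)))"
  proof (rule cls_eq)
    show "d (t(i := x \<oplus>\<^bsub>A\<^esub> y)) \<ominus>\<^bsub>TF\<^esub> (d (t(i := x)) \<oplus>\<^bsub>TF\<^esub> d (t(i := y))) \<in> power_rels B A n"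
      unfolding power_rels_def Let_def using assms by blast
  qed (use assms in \<open>simp_all add: d_closed upd_tuple del: fun_upd_apply\<close>)
  then show ?thesis using assms by (simp add: pure_eq d_closed upd_tuple)
qed

lemma pure_update_smult:
  assumes "t \<in> tuples" "i \<in> {1..n}" "b \<in> carrier B" "x \<in> carrier A"
  shows "pure (t(i := b \<odot>\<^bsub>A\<^esub> x)) = b \<odot>\<^bsub>T\<^esub> pure (t(i := x))"
proof -
  have "Q.cls (d (t(i := b \<odot>\<^bsub>A\<^esub> x))) = Q.cls (b \<odot>\<^bsub>TF\<^esub> d (t(i := x)))"
  proof (rule cls_eq)
    show "d (t(i := b \<odot>\<^bsub>A\<^esub> x)) \<ominus>\<^bsub>TF\<^esub> (b \<odot>\<^bsub>TF\<^esub> d (t(i := x))) \<in> power_rels B A n"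
      unfolding power_rels_def Let_def using assms by blast
  qed (use assms in \<open>simp_all add: d_closed upd_tuple del: fun_upd_apply\<close>)
  then show ?thesis using assms by (simp add: pure_eq d_closed upd_tuple cls_smult)
qed

lemma pure_mult: "t \<in> tuples \<Longrightarrow> t' \<in> tuples \<Longrightarrow> pure t \<otimes>\<^bsub>T\<^esub> pure t' = pure (\<lambda>i\<in>{1..n}. t i \<otimes>\<^bsub>A\<^esub> t' i)"
  using cls.hom_mult[of "d t" "d t'"] by (simp add: pure_eq d_closed d_mult)

lemma pure_one: "pure (\<lambda>k\<in>{1..n}. \<one>\<^bsub>A\<^esub>) = \<one>\<^bsub>T\<^esub>"
proof -
  have "\<one>\<^bsub>TF\<^esub> = d (\<lambda>k\<in>{1..n}. \<one>\<^bsub>A\<^esub>)" using F.ops(4) by (simp add: TF_eq)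
  then show ?thesis using cls.hom_one by (simp add: pure_eq)
qed

lemma ones_tuple: "(\<lambda>k\<in>{1..n}. \<one>\<^bsub>A\<^esub>) \<in> tuples" by auto

lemma place_eq: "place i a = pure ((\<lambda>k\<in>{1..n}. \<one>\<^bsub>A\<^esub>)(i := a))"
  by (simp add: power_place_def)

lemma place_hom:
  assumes i: "i \<in> {1..n}"
  shows "place i \<in> algebra_hom B A T"
  unfolding algebra_hom_eq_semilinear_hom
proof (rule semilinear_homI)
  note u = upd_tuple[OF ones_tuple i]
  show "place i \<in> ring_hom A T"
  proof (rule ring_hom_memI)
    fix x y assume xy: "x \<in> carrier A" "y \<in> carrier A"
    have "(\<lambda>k\<in>{1..n}. ((\<lambda>k\<in>{1..n}. \<one>\<^bsub>A\<^esub>)(i := x)) k \<otimes>\<^bsub>A\<^esub> ((\<lambda>k\<in>{1..n}. \<one>\<^bsub>A\<^esub>)(i := y)) k)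
      = (\<lambda>k\<in>{1..n}. \<one>\<^bsub>A\<^esub>)(i := x \<otimes>\<^bsub>A\<^esub> y)"
      using i xy by (auto simp: fun_eq_iff)
    then show "place i (x \<otimes>\<^bsub>A\<^esub> y) = place i x \<otimes>\<^bsub>T\<^esub> place i y"
      using xy by (simp add: place_eq pure_mult u del: fun_upd_apply)
    show "place i (x \<oplus>\<^bsub>A\<^esub> y) = place i x \<oplus>\<^bsub>T\<^esub> place i y"
      unfolding place_eq using xy by (intro pure_update_add ones_tuple i)
  next
    have "(\<lambda>k\<in>{1..n}. \<one>\<^bsub>A\<^esub>)(i := \<one>\<^bsub>A\<^esub>) = (\<lambda>k\<in>{1..n}. \<one>\<^bsub>A\<^esub>)" using i by (auto simp: fun_eq_iff)
    then show "place i \<one>\<^bsub>A\<^esub> = \<one>\<^bsub>T\<^esub>" by (simp only: place_eq pure_one)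
  qed (unfold place_eq, intro pure_closed u)
  fix b x assume "b \<in> carrier B" "x \<in> carrier A"
  then show "place i (b \<odot>\<^bsub>A\<^esub> x) = b \<odot>\<^bsub>T\<^esub> place i x"
    unfolding place_eq by (intro pure_update_smult ones_tuple i)
qed

lemma place_closed [simp]: "i \<in> {1..n} \<Longrightarrow> a \<in> carrier A \<Longrightarrow> place i a \<in> carrier T"
  unfolding place_eq by (intro pure_closed upd_tuple ones_tuple)

text \<open>
  \<open>a\<^sub>1 \<otimes> \<dots> \<otimes> a\<^sub>n = a\<^sub>1\<^sup>(\<^sup>1\<^sup>) \<cdots> a\<^sub>n\<^sup>(\<^sup>n\<^sup>)\<close>: the \<open>B\<close>-algebra \<open>T\<close> is generated by the images of the \<open>n\<close>
  homomorphisms \<open>place i\<close>, of which it is the coproduct.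
\<close>

lemma pure_eq_prod_places:
  assumes t: "t \<in> tuples"
  shows "pure t = (\<Otimes>\<^bsub>T\<^esub>i\<in>{1..n}. place i (t i))"
proof -
  have tc: "t i \<in> carrier A" if "i \<in> {1..n}" for i using t that by auto
  have "(\<Otimes>\<^bsub>T\<^esub>i\<in>J. place i (t i)) = pure (\<lambda>k\<in>{1..n}. if k \<in> J then t k else \<one>\<^bsub>A\<^esub>)"
    if "finite J" "J \<subseteq> {1..n}" for J
    using that
  proof (induction J rule: finite_induct)
    case empty
    have "(\<lambda>k\<in>{1..n}. if k \<in> {} then t k else \<one>\<^bsub>A\<^esub>) = (\<lambda>k\<in>{1..n}. \<one>\<^bsub>A\<^esub>)" by auto
    then show ?case by (simp only: T.finprod_empty pure_one)
  next
    case (insert j J)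
    then have j: "j \<in> {1..n}" and J: "J \<subseteq> {1..n}" by auto
    let ?r = "\<lambda>k\<in>{1..n}. if k \<in> J then t k else \<one>\<^bsub>A\<^esub>"
    have r: "?r \<in> tuples" using tc by auto
    have "(\<Otimes>\<^bsub>T\<^esub>i\<in>insert j J. place i (t i)) = place j (t j) \<otimes>\<^bsub>T\<^esub> pure ?r"
      unfolding insert.IH[OF J, symmetric] using insert.hyps J j tc by (intro T.finprod_insert) (auto simp: subset_iff)
    also have "\<dots> = pure (\<lambda>k\<in>{1..n}. ((\<lambda>k\<in>{1..n}. \<one>\<^bsub>A\<^esub>)(j := t j)) k \<otimes>\<^bsub>A\<^esub> ?r k)"
      unfolding place_eq using tc j r by (intro pure_mult upd_tuple ones_tuple)
    also have "(\<lambda>k\<in>{1..n}. ((\<lambda>k\<in>{1..n}. \<one>\<^bsub>A\<^esub>)(j := t j)) k \<otimes>\<^bsub>A\<^esub> ?r k)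
      = (\<lambda>k\<in>{1..n}. if k \<in> insert j J then t k else \<one>\<^bsub>A\<^esub>)"
      using insert tc j by (auto simp: fun_eq_iff)
    finally show ?case .
  qed
  from this[of "{1..n}"] have "(\<Otimes>\<^bsub>T\<^esub>i\<in>{1..n}. place i (t i)) = pure (\<lambda>k\<in>{1..n}. if k \<in> {1..n} then t k else \<one>\<^bsub>A\<^esub>)"
    by simp
  also have "(\<lambda>k\<in>{1..n}. if k \<in> {1..n} then t k else \<one>\<^bsub>A\<^esub>) = t"
    using t by (auto simp: fun_eq_iff PiE_iff extensional_def)
  finally show ?thesis ..
qed

text \<open>
  \<open>T\<close> is generated over \<open>B\<close> by the elements \<open>place i a\<close>, and semilinearity determines the homomorphism on
  the scalars. For \<open>n = 0\<close> the scalars are everything: \<open>T\<close> is then \<open>B\<close>.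
\<close>

lemma hom_eqI:
  assumes P: "algebra B' P" and u: "u \<in> semilinear_hom B g T P" and v: "v \<in> semilinear_hom B g T P"
    and eq: "\<And>i a. i \<in> {1..n} \<Longrightarrow> a \<in> carrier A \<Longrightarrow> u (place i a) = v (place i a)"
    and X: "X \<in> carrier T"
  shows "u X = v X"
proof -
  interpret P: algebra B' P by fact
  interpret u: ring_hom_cring T P u using semilinear_homD(1)[OF u] by unfold_locales
  interpret v: ring_hom_cring T P v using semilinear_homD(1)[OF v] by unfold_locales
  have pure: "u (pure t) = v (pure t)" if t: "t \<in> tuples" for t
  proof -
    have tc: "t i \<in> carrier A" if "i \<in> {1..n}" for i using t that by auto
    have "u (pure t) = (\<Otimes>\<^bsub>P\<^esub>i\<in>{1..n}. u (place i (t i)))"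
      unfolding pure_eq_prod_places[OF t] using tc by (subst u.hom_finprod) (auto simp: o_def)
    also have "\<dots> = (\<Otimes>\<^bsub>P\<^esub>i\<in>{1..n}. v (place i (t i)))"
      using tc eq by (intro P.finprod_cong') auto
    also have "\<dots> = v (pure t)"
      unfolding pure_eq_prod_places[OF t] using tc by (subst v.hom_finprod) (auto simp: o_def)
    finally show ?thesis .
  qed
  have "u (Q.cls f) = v (Q.cls f)" if "f \<in> carrier TF" for f
    using that[folded TF_eq]
  proof (induction f rule: F.single_induct)
    case zero
    then show ?case by (simp add: TF_eq)
  next
    case (add f b t)
    then have t: "t \<in> tuples" by simp
    have "Q.cls (f \<oplus>\<^bsub>TF\<^esub> b \<odot>\<^bsub>TF\<^esub> d t) = Q.cls f \<oplus>\<^bsub>T\<^esub> b \<odot>\<^bsub>T\<^esub> pure t"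
      using add t by (simp add: TF_eq d_closed cls_smult pure_eq)
    then show ?case
      using add t pure[OF t] pure_closed[OF t]
      by (simp add: TF_eq semilinear_homD(2)[OF u] semilinear_homD(2)[OF v])
  qed
  then show ?thesis using X Q.carrier_quot unfolding T_eq by auto
qed

text \<open>
  The universal property of the coproduct of \<open>n\<close> copies of \<open>A\<close>, again for the maps as they are defined. A product of
  additive maps \<open>\<phi>\<^sub>i(t\<^sub>i)\<close> is multilinear in \<open>t\<close>, which disposes of the relations.
\<close>

lemma lift_homs:
  assumes P: "algebra B' P" and g: "g \<in> ring_hom B B'"
    and \<phi>: "\<And>i. i \<in> {1..n} \<Longrightarrow> \<phi> i \<in> semilinear_hom B g A P"
    and k: "\<And>t. t \<in> tuples \<Longrightarrow> k t = (\<Otimes>\<^bsub>P\<^esub>i\<in>{1..n}. \<phi> i (t i))"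
  shows "quot_lift (lin_ext B P g k) \<in> semilinear_hom B g T P"
    and "\<And>t. t \<in> tuples \<Longrightarrow> quot_lift (lin_ext B P g k) (pure t) = (\<Otimes>\<^bsub>P\<^esub>i\<in>{1..n}. \<phi> i (t i))"
    and "\<And>i a. i \<in> {1..n} \<Longrightarrow> a \<in> carrier A \<Longrightarrow> quot_lift (lin_ext B P g k) (place i a) = \<phi> i a"
proof -
  interpret P: algebra B' P by fact
  interpret g: ring_hom_cring B B' g using g by unfold_locales
  have \<phi>r: "\<phi> i \<in> ring_hom A P" if "i \<in> {1..n}" for i using semilinear_homD(1)[OF \<phi>[OF that]] .
  have \<phi>c: "\<phi> i x \<in> carrier P" if "i \<in> {1..n}" "x \<in> carrier A" for i x using ring_hom_closed[OF \<phi>r] that .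
  have \<phi>t: "\<phi> i (t i) \<in> carrier P" if "i \<in> {1..n}" "t \<in> tuples" for i t using that by (auto intro: \<phi>c)
  have khom: "k \<in> hom G P"
  proof (rule homI)
    fix t assume "t \<in> carrier G"
    then have "t \<in> tuples" by simp
    then show "k t \<in> carrier P" using \<phi>t by (auto simp: k intro!: P.finprod_closed)
  next
    fix t t' assume "t \<in> carrier G" "t' \<in> carrier G"
    then have t: "t \<in> tuples" and t': "t' \<in> tuples" by simp_all
    have tc: "t i \<in> carrier A" "t' i \<in> carrier A" if "i \<in> {1..n}" for i using t t' that by auto
    have m: "(\<lambda>i\<in>{1..n}. t i \<otimes>\<^bsub>A\<^esub> t' i) \<in> tuples" using tc by auto
    have "k (t \<otimes>\<^bsub>G\<^esub> t') = (\<Otimes>\<^bsub>P\<^esub>i\<in>{1..n}. \<phi> i (t i \<otimes>\<^bsub>A\<^esub> t' i))"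
      unfolding mult_product_group k[OF m] using tc by (intro P.finprod_cong') (auto intro!: \<phi>c)
    also have "\<dots> = (\<Otimes>\<^bsub>P\<^esub>i\<in>{1..n}. \<phi> i (t i) \<otimes>\<^bsub>P\<^esub> \<phi> i (t' i))"
      using tc by (intro P.finprod_cong') (auto intro!: \<phi>c simp: ring_hom_mult[OF \<phi>r])
    also have "\<dots> = k t \<otimes>\<^bsub>P\<^esub> k t'"
      unfolding k[OF t] k[OF t'] using tc by (intro P.finprod_multf) (auto intro!: \<phi>c)
    finally show "k (t \<otimes>\<^bsub>G\<^esub> t') = k t \<otimes>\<^bsub>P\<^esub> k t'" .
  qed
  have kone: "k \<one>\<^bsub>G\<^esub> = \<one>\<^bsub>P\<^esub>"
    unfolding one_product_group k[OF ones_tuple]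
    by (intro P.finprod_one_eqI) (auto simp: ring_hom_one[OF \<phi>r])
  have kc: "k \<in> carrier G \<rightarrow> carrier P" using khom by (auto simp: hom_def)
  have kupd: "k (t(i := x)) = \<phi> i x \<otimes>\<^bsub>P\<^esub> (\<Otimes>\<^bsub>P\<^esub>j\<in>{1..n} - {i}. \<phi> j (t j))"
    if t: "t \<in> tuples" and i: "i \<in> {1..n}" and x: "x \<in> carrier A" for t i x
  proof -
    have "k (t(i := x)) = (\<Otimes>\<^bsub>P\<^esub>j\<in>insert i ({1..n} - {i}). \<phi> j ((t(i := x)) j))"
      unfolding k[OF upd_tuple[OF t i x]] using i by (simp add: insert_absorb)
    also have "\<dots> = \<phi> i x \<otimes>\<^bsub>P\<^esub> (\<Otimes>\<^bsub>P\<^esub>j\<in>{1..n} - {i}. \<phi> j ((t(i := x)) j))"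
      using i x \<phi>t[OF _ t] \<phi>c by (subst P.finprod_insert) auto
    also have "(\<Otimes>\<^bsub>P\<^esub>j\<in>{1..n} - {i}. \<phi> j ((t(i := x)) j)) = (\<Otimes>\<^bsub>P\<^esub>j\<in>{1..n} - {i}. \<phi> j (t j))"
      using \<phi>t[OF _ t] by (intro P.finprod_cong') auto
    finally show ?thesis .
  qed
  let ?\<Lambda> = "lin_ext B P g k"
  have \<Lambda>: "?\<Lambda> \<in> semilinear_hom B g TF P"
    using F.lin_ext_hom[OF P g khom kone] by (simp add: TF_eq)
  interpret \<Lambda>: ring_hom_cring TF P ?\<Lambda> using semilinear_homD(1)[OF \<Lambda>] by unfold_locales
  have \<Lambda>_d: "?\<Lambda> (d t) = k t" if "t \<in> tuples" for t
    using F.lin_ext_single[OF P.module g kc, of t] that by simp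
  have rest: "(\<Otimes>\<^bsub>P\<^esub>j\<in>{1..n} - {i}. \<phi> j (t j)) \<in> carrier P" if "t \<in> tuples" for t i
    using \<phi>t[OF _ that] by (intro P.finprod_closed) auto
  have rel: "?\<Lambda> r = \<zero>\<^bsub>P\<^esub>" if "r \<in> power_rels B A n" for r
    using that
  proof (cases rule: power_rels_cases)
    case (1 t i x y)
    note u = upd_tuple[OF 1(2,3)]
    have "?\<Lambda> r = k (t(i := x \<oplus>\<^bsub>A\<^esub> y)) \<oplus>\<^bsub>P\<^esub> \<ominus>\<^bsub>P\<^esub> (k (t(i := x)) \<oplus>\<^bsub>P\<^esub> k (t(i := y)))"
      unfolding 1(1) using 1(4,5) u by (simp add: TF.minus_eq d_closed \<Lambda>_d del: fun_upd_apply)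
    also have "k (t(i := x \<oplus>\<^bsub>A\<^esub> y)) = k (t(i := x)) \<oplus>\<^bsub>P\<^esub> k (t(i := y))"
      using 1 rest[OF 1(2)] \<phi>c by (simp add: kupd ring_hom_add[OF \<phi>r] P.l_distr)
    also have "\<dots> \<oplus>\<^bsub>P\<^esub> \<ominus>\<^bsub>P\<^esub> (k (t(i := x)) \<oplus>\<^bsub>P\<^esub> k (t(i := y))) = \<zero>\<^bsub>P\<^esub>"
      using 1 rest[OF 1(2)] \<phi>c by (intro P.M.r_neg) (simp add: kupd)
    finally show ?thesis .
  next
    case (2 t i b x)
    note u = upd_tuple[OF 2(2,3)]
    have "?\<Lambda> r = k (t(i := b \<odot>\<^bsub>A\<^esub> x)) \<oplus>\<^bsub>P\<^esub> \<ominus>\<^bsub>P\<^esub> (g b \<odot>\<^bsub>P\<^esub> k (t(i := x)))"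
      unfolding 2(1) using 2(4,5) u
      by (simp add: TF.minus_eq d_closed \<Lambda>_d semilinear_homD(2)[OF \<Lambda>] del: fun_upd_apply)
    also have "k (t(i := b \<odot>\<^bsub>A\<^esub> x)) = g b \<odot>\<^bsub>P\<^esub> k (t(i := x))"
      using 2 rest[OF 2(2)] \<phi>c by (simp add: kupd semilinear_homD(2)[OF \<phi>] P.smult_assoc2)
    also have "\<dots> \<oplus>\<^bsub>P\<^esub> \<ominus>\<^bsub>P\<^esub> (g b \<odot>\<^bsub>P\<^esub> k (t(i := x))) = \<zero>\<^bsub>P\<^esub>"
      using 2 rest[OF 2(2)] \<phi>c by (intro P.M.r_neg) (simp add: kupd)
    finally show ?thesis .
  qed
  have 0: "?\<Lambda> x = \<zero>\<^bsub>P\<^esub>" if "x \<in> power_ideal B A n" for x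
    by (rule ring_hom_vanishes_genideal[OF TF.ring_axioms P.ring_axioms \<Lambda>.homh power_rels_closed rel
          that[unfolded power_ideal_def]])
  show "quot_lift ?\<Lambda> \<in> semilinear_hom B g T P"
    using Q.quot_lift_semilinear[OF P.M_cring \<Lambda> 0] unfolding T_eq .
  show *: "quot_lift ?\<Lambda> (pure t) = (\<Otimes>\<^bsub>P\<^esub>i\<in>{1..n}. \<phi> i (t i))" if "t \<in> tuples" for t
    unfolding pure_eq using Q.quot_lift_hom(2)[OF P.M_cring \<Lambda>.homh 0 d_closed[OF that]] \<Lambda>_d[OF that] k[OF that] by simp
  show "quot_lift ?\<Lambda> (place i a) = \<phi> i a" if i: "i \<in> {1..n}" and a: "a \<in> carrier A" for i a
  proof -
    let ?t = "(\<lambda>k\<in>{1..n}. \<one>\<^bsub>A\<^esub>)(i := a)"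
    have "quot_lift ?\<Lambda> (place i a) = k ?t"
      using *[OF upd_tuple[OF ones_tuple i a]] k[OF upd_tuple[OF ones_tuple i a]] by (simp add: place_eq)
    also have "\<dots> = \<phi> i a \<otimes>\<^bsub>P\<^esub> (\<Otimes>\<^bsub>P\<^esub>j\<in>{1..n} - {i}. \<phi> j ((\<lambda>k\<in>{1..n}. \<one>\<^bsub>A\<^esub>) j))"
      by (rule kupd[OF ones_tuple i a])
    also have "(\<Otimes>\<^bsub>P\<^esub>j\<in>{1..n} - {i}. \<phi> j ((\<lambda>k\<in>{1..n}. \<one>\<^bsub>A\<^esub>) j)) = \<one>\<^bsub>P\<^esub>"
      by (intro P.finprod_one_eqI) (auto simp: ring_hom_one[OF \<phi>r])
    finally show ?thesis using \<phi>c[OF i a] by simp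
  qed
qed

end

section \<open>The \<open>S\<^sub>n\<close>-closure\<close>

text \<open>
  \<open>Gal\<close> is \<open>G(A/B)\<close>, and \<open>root i a\<close> is the image of \<open>a\<^sup>(\<^sup>i\<^sup>)\<close> in it: the defining relations say that
  the characteristic polynomial of \<open>a\<close> is the product of the linear factors \<open>x - root i a\<close>.
\<close>

locale Sn_closure = tensor_pow B A n
  for B :: "('b, 'k) ring_scheme" and A :: "('b, 'a, 'p) module_scheme" and n +
  assumes basis_exists: "\<exists>e. module_basis B A n e"
begin

abbreviation "Gal \<equiv> sn_closure B A n"
abbreviation sn_cls where "sn_cls \<equiv> sn_class B A n"

lemma char_coeff_in: "a \<in> carrier A \<Longrightarrow> char_coeff B A n j a \<in> carrier B"
  using basis_exists A.char_coeff_closed by blast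

abbreviation "sn_rels \<equiv> {(char_coeff B A n j a \<odot>\<^bsub>T\<^esub> \<one>\<^bsub>T\<^esub>) \<ominus>\<^bsub>T\<^esub> elem_sym T n (\<lambda>i. place i a) j | a j.
  a \<in> carrier A \<and> j \<in> {1..n}}"

lemma sn_ideal_eq: "sn_ideal B A n = Idl\<^bsub>T\<^esub> sn_rels"
  by (simp add: sn_ideal_def Let_def elem_sym_def)

lemma elem_sym_place: "a \<in> carrier A \<Longrightarrow> elem_sym T n (\<lambda>i. place i a) j \<in> carrier T"
  by (intro T.elem_sym_closed) simp

lemma sn_rels_closed: "sn_rels \<subseteq> carrier T"
  by (auto intro!: T.minus_closed T.smult_closed elem_sym_place char_coeff_in)

sublocale J: ideal "sn_ideal B A n" T
  unfolding sn_ideal_eq by (rule T.genideal_ideal[OF sn_rels_closed])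

sublocale GQ: quotient_algebra B T "sn_ideal B A n" ..

lemma Gal_eq [simp]: "quot_algebra T (sn_ideal B A n) = Gal"
  by (simp add: sn_closure_def)

sublocale Gal: algebra B Gal using GQ.algebra_quot unfolding Gal_eq .

lemma sn_cls_eq: "sn_cls u = GQ.cls u"
  by (simp add: sn_class_def)

lemma sn_cls_hom: "sn_cls \<in> algebra_hom B T Gal"
  using GQ.cls_algebra_hom unfolding Gal_eq sn_class_def .

lemma sn_cls_ring_hom: "sn_cls \<in> ring_hom T Gal"
  using sn_cls_hom by (simp add: algebra_hom_def)

sublocale sn: ring_hom_cring T Gal sn_cls using sn_cls_ring_hom by unfold_locales

lemma sn_cls_smult: "b \<in> carrier B \<Longrightarrow> x \<in> carrier T \<Longrightarrow> sn_cls (b \<odot>\<^bsub>T\<^esub> x) = b \<odot>\<^bsub>Gal\<^esub> sn_cls x"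
  using sn_cls_hom by (simp add: algebra_hom_def)

lemma Gal_carrier: "carrier Gal = sn_cls ` carrier T"
  using GQ.carrier_quot unfolding Gal_eq sn_class_def .

definition "root i a = sn_cls (place i a)"

lemma root_hom: "i \<in> {1..n} \<Longrightarrow> root i \<in> algebra_hom B A Gal"
  using semilinear_hom_comp[OF place_hom[unfolded algebra_hom_eq_semilinear_hom] sn_cls_hom[unfolded algebra_hom_eq_semilinear_hom]]
  unfolding root_def[abs_def] algebra_hom_eq_semilinear_hom by auto

lemma root_closed [simp]: "i \<in> {1..n} \<Longrightarrow> a \<in> carrier A \<Longrightarrow> root i a \<in> carrier Gal"
  by (simp add: root_def)

lemma root_relation:
  assumes a: "a \<in> carrier A" and j: "j \<in> {1..n}"
  shows "char_coeff B A n j a \<odot>\<^bsub>Gal\<^esub> \<one>\<^bsub>Gal\<^esub> = elem_sym Gal n (\<lambda>i. root i a) j"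
proof -
  let ?s = "char_coeff B A n j a \<odot>\<^bsub>T\<^esub> \<one>\<^bsub>T\<^esub>" and ?e = "elem_sym T n (\<lambda>i. place i a) j"
  have c: "?s \<in> carrier T" "?e \<in> carrier T" using a by (auto simp: char_coeff_in elem_sym_place)
  have "?s \<ominus>\<^bsub>T\<^esub> ?e \<in> sn_ideal B A n"
    unfolding sn_ideal_eq using a j T.genideal_self[OF sn_rels_closed] by blast
  then have "sn_cls (?s \<ominus>\<^bsub>T\<^esub> ?e) = \<zero>\<^bsub>Gal\<^esub>" using GQ.cls_zero by (simp add: sn_cls_eq)
  then have "sn_cls ?s \<oplus>\<^bsub>Gal\<^esub> \<ominus>\<^bsub>Gal\<^esub> sn_cls ?e = \<zero>\<^bsub>Gal\<^esub>" using c by (simp add: T.minus_eq)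
  then have "sn_cls ?s = sn_cls ?e"
    using c by (metis Gal.minus_equality Gal.minus_minus sn.hom_closed Gal.a_inv_closed)
  moreover have "sn_cls ?e = elem_sym Gal n (\<lambda>i. root i a) j"
    unfolding root_def using a by (intro sn.hom_elem_sym) simp
  ultimately show ?thesis using a by (simp add: sn_cls_smult char_coeff_in)
qed

text \<open>
  A homomorphism of the tensor power descends to \<open>G(A/B)\<close> if the images of the \<open>a\<^sup>(\<^sup>i\<^sup>)\<close> satisfy the
  relations.
\<close>

lemma sn_lift:
  assumes P: "algebra B' P" and h: "h \<in> semilinear_hom B g T P" and g: "g \<in> ring_hom B B'"
    and rel: "\<And>a j. a \<in> carrier A \<Longrightarrow> j \<in> {1..n} \<Longrightarrow>
      g (char_coeff B A n j a) \<odot>\<^bsub>P\<^esub> \<one>\<^bsub>P\<^esub> = elem_sym P n (\<lambda>i. h (place i a)) j"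
  shows "quot_lift h \<in> semilinear_hom B g Gal P"
    and "\<And>u. u \<in> carrier T \<Longrightarrow> quot_lift h (sn_cls u) = h u"
proof -
  interpret P: algebra B' P by fact
  interpret h: ring_hom_cring T P h using semilinear_homD(1)[OF h] by unfold_locales
  interpret g: ring_hom_cring B B' g using g by unfold_locales
  have "h r = \<zero>\<^bsub>P\<^esub>" if r_rel: "r \<in> sn_rels" for r
  proof -
    obtain a j where r: "r = (char_coeff B A n j a \<odot>\<^bsub>T\<^esub> \<one>\<^bsub>T\<^esub>) \<ominus>\<^bsub>T\<^esub> elem_sym T n (\<lambda>i. place i a) j"
      and a: "a \<in> carrier A" and j: "j \<in> {1..n}" using r_rel by blast
    have "h (elem_sym T n (\<lambda>i. place i a) j) = elem_sym P n (\<lambda>i. h (place i a)) j"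
      using a by (intro h.hom_elem_sym) simp
    then show ?thesis
      unfolding r using a j char_coeff_in[OF a] elem_sym_place[OF a]
      by (simp add: T.minus_eq semilinear_homD(2)[OF h] rel[symmetric] P.M.r_neg)
  qed
  then have 0: "h x = \<zero>\<^bsub>P\<^esub>" if "x \<in> sn_ideal B A n" for x
    using ring_hom_vanishes_genideal[OF T.ring_axioms P.ring_axioms h.homh sn_rels_closed] that
    unfolding sn_ideal_eq by blast
  show "quot_lift h \<in> semilinear_hom B g Gal P"
    using GQ.quot_lift_semilinear[OF P.M_cring h 0] unfolding Gal_eq .
  show "quot_lift h (sn_cls u) = h u" if "u \<in> carrier T" for u
    unfolding sn_cls_eq by (rule GQ.quot_lift_hom(2)[OF P.M_cring h.homh 0 that])
qed

lemma Gal_hom_eqI: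
  assumes P: "algebra B' P" and u: "u \<in> semilinear_hom B g Gal P" and v: "v \<in> semilinear_hom B g Gal P"
    and eq: "\<And>i a. i \<in> {1..n} \<Longrightarrow> a \<in> carrier A \<Longrightarrow> u (root i a) = v (root i a)"
    and X: "X \<in> carrier Gal"
  shows "u X = v X"
proof -
  obtain x where x: "x \<in> carrier T" "X = sn_cls x" using X by (auto simp: Gal_carrier)
  note cls = sn_cls_hom[unfolded algebra_hom_eq_semilinear_hom]
  have "(\<lambda>x. u (sn_cls x)) \<in> semilinear_hom B g T P" "(\<lambda>x. v (sn_cls x)) \<in> semilinear_hom B g T P"
    using semilinear_hom_comp[OF cls u] semilinear_hom_comp[OF cls v] by auto
  from hom_eqI[OF P this _ x(1)] eq show ?thesis by (simp add: x(2) root_def)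
qed

end

text \<open>
  Composed with \<open>f\<close>, the roots of \<open>G(A'/B')\<close> satisfy the relations of \<open>G(A/B)\<close>, provided that \<open>f\<close> is
  compatible with the characteristic polynomials.
\<close>

lemma sn_map_hom:
  assumes A: "Sn_closure B A n" and A': "Sn_closure B' A' n" and g: "g \<in> ring_hom B B'"
    and f: "f \<in> semilinear_hom B g A A'"
    and cc: "\<And>a j. a \<in> carrier A \<Longrightarrow> j \<in> {1..n} \<Longrightarrow> char_coeff B' A' n j (f a) = g (char_coeff B A n j a)"
  shows "sn_map B B' A' n g f \<in> semilinear_hom B g (sn_closure B A n) (sn_closure B' A' n)"
    and "\<And>i a. i \<in> {1..n} \<Longrightarrow> a \<in> carrier A \<Longrightarrow>
      sn_map B B' A' n g f (Sn_closure.root B A n i a) = Sn_closure.root B' A' n i (f a)"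
    and "\<And>t. t \<in> {1..n} \<rightarrow>\<^sub>E carrier A \<Longrightarrow>
      sn_map B B' A' n g f (sn_class B A n (power_pure B A n t))
        = sn_class B' A' n (power_pure B' A' n (\<lambda>i\<in>{1..n}. f (t i)))"
proof -
  interpret S: Sn_closure B A n by fact
  interpret S': Sn_closure B' A' n by fact
  have fr: "f \<in> ring_hom A A'" using semilinear_homD(1)[OF f] .
  have fc: "f a \<in> carrier A'" if "a \<in> carrier A" for a using ring_hom_closed[OF fr that] .
  let ?k = "\<lambda>t. S'.pure (\<lambda>i\<in>{1..n}. f (t i))"
  let ?h = "quot_lift (lin_ext B S'.T g ?k)"
  have \<phi>: "(\<lambda>a. S'.place i (f a)) \<in> semilinear_hom B g A S'.T" if "i \<in> {1..n}" for i
    using semilinear_hom_comp[OF f S'.place_hom[OF that, unfolded algebra_hom_eq_semilinear_hom]] g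
    by (auto simp: ring_hom_def)
  have ft: "(\<lambda>i\<in>{1..n}. f (t i)) \<in> S'.tuples" if "t \<in> S.tuples" for t
    using that by (auto intro!: fc)
  have k: "?k t = (\<Otimes>\<^bsub>S'.T\<^esub>i\<in>{1..n}. S'.place i (f (t i)))" if t: "t \<in> S.tuples" for t
  proof -
    have "?k t = (\<Otimes>\<^bsub>S'.T\<^esub>i\<in>{1..n}. S'.place i ((\<lambda>i\<in>{1..n}. f (t i)) i))"
      using ft[OF t] by (rule S'.pure_eq_prod_places)
    also have "\<dots> = (\<Otimes>\<^bsub>S'.T\<^esub>i\<in>{1..n}. S'.place i (f (t i)))"
      using t by (intro S'.T.finprod_cong') (auto intro!: S'.place_closed fc)
    finally show ?thesis .
  qed
  note L = S.lift_homs[OF S'.T.algebra_axioms g \<phi> k]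
  let ?c = "\<lambda>u. S'.sn_cls (?h u)"
  have c: "?c \<in> semilinear_hom B g S.T S'.Gal"
    using semilinear_hom_comp[OF L(1) S'.sn_cls_hom[unfolded algebra_hom_eq_semilinear_hom]] g
    by (auto simp: ring_hom_def)
  have cp: "?c (S.place i a) = S'.root i (f a)" if "i \<in> {1..n}" "a \<in> carrier A" for i a
    using L(3)[OF _ _ that] by (simp add: S'.root_def)
  have rel: "g (char_coeff B A n j a) \<odot>\<^bsub>S'.Gal\<^esub> \<one>\<^bsub>S'.Gal\<^esub> = elem_sym S'.Gal n (\<lambda>i. ?c (S.place i a)) j"
    if "a \<in> carrier A" "j \<in> {1..n}" for a j
  proof -
    have "g (char_coeff B A n j a) \<odot>\<^bsub>S'.Gal\<^esub> \<one>\<^bsub>S'.Gal\<^esub> = elem_sym S'.Gal n (\<lambda>i. S'.root i (f a)) j"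
      using S'.root_relation[OF fc[OF that(1)] that(2)] cc[OF that] by simp
    also have "\<dots> = elem_sym S'.Gal n (\<lambda>i. ?c (S.place i a)) j"
      using that fc by (intro S'.Gal.elem_sym_cong) (simp_all add: cp)
    finally show ?thesis .
  qed
  note M = S.sn_lift[OF S'.Gal.algebra_axioms c g rel]
  have eq: "sn_map B B' A' n g f = quot_lift ?c" by (simp add: sn_map_def)
  show "sn_map B B' A' n g f \<in> semilinear_hom B g S.Gal S'.Gal" unfolding eq by (rule M(1))
  show "sn_map B B' A' n g f (S.root i a) = S'.root i (f a)" if "i \<in> {1..n}" "a \<in> carrier A" for i a
    unfolding eq S.root_def using M(2)[OF _ _ S.place_closed[OF that]] cp[OF that] by (rule trans)
  show "sn_map B B' A' n g f (S.sn_cls (S.pure t)) = S'.sn_cls (S'.pure (\<lambda>i\<in>{1..n}. f (t i)))"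
    if t: "t \<in> S.tuples" for t
  proof -
    have "?h (S.pure t) = ?k t" using L(2)[OF _ _ t] unfolding k[OF t] by blast
    then show ?thesis unfolding eq using M(2)[OF _ _ S.pure_closed[OF t]] by (metis (no_types, lifting))
  qed
qed

section \<open>Base change\<close>

lemma module_basis_cong:
  assumes "module B M" and eq: "\<And>i. i \<in> {1..n} \<Longrightarrow> e i = e' i" and e: "module_basis B M n e"
  shows "module_basis B M n e'"
proof -
  interpret M: module B M by fact
  have ec: "e i \<in> carrier M" if "i \<in> {1..n}" for i using M.basis_closed[OF e that] .
  have "coords_of B M n e x c \<longleftrightarrow> coords_of B M n e' x c" for x c
  proof -
    have "(\<Oplus>\<^bsub>M\<^esub>i\<in>{1..n}. c i \<odot>\<^bsub>M\<^esub> e i) = (\<Oplus>\<^bsub>M\<^esub>i\<in>{1..n}. c i \<odot>\<^bsub>M\<^esub> e' i)" if "c \<in> {1..n} \<rightarrow>\<^sub>E carrier B"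
      using that ec eq by (intro M.M.finsum_cong') auto
    then show ?thesis unfolding coords_of_def by auto
  qed
  then have "coords_of B M n e = coords_of B M n e'" by (intro ext)
  moreover have "e' \<in> {1..n} \<rightarrow> carrier M" using ec eq by auto
  ultimately show ?thesis using e unfolding module_basis_def by simp
qed

lemma algebra_iso_basis:
  assumes A: "algebra B A" and A': "algebra B A'" and f: "f \<in> algebra_iso B A A'" and e: "module_basis B A n e"
  shows "module_basis B A' n (\<lambda>i. f (e i))"
  unfolding module_basis_def
proof (intro conjI ballI)
  interpret A: algebra B A by fact
  interpret A': algebra B A' by fact
  have hom: "f \<in> ring_hom A A'" and smult: "\<And>b x. b \<in> carrier B \<Longrightarrow> x \<in> carrier A \<Longrightarrow> f (b \<odot>\<^bsub>A\<^esub> x) = b \<odot>\<^bsub>A'\<^esub> f x"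
    and bij: "bij_betw f (carrier A) (carrier A')"
    using f by (auto simp: algebra_iso_def algebra_hom_def)
  interpret f: ring_hom_cring A A' f using hom by unfold_locales
  have ec: "e i \<in> carrier A" if "i \<in> {1..n}" for i using A.basis_closed[OF e that] .
  then show "(\<lambda>i. f (e i)) \<in> {1..n} \<rightarrow> carrier A'" by auto
  fix y assume y: "y \<in> carrier A'"
  then obtain x where x: "x \<in> carrier A" "y = f x" using bij by (auto simp: bij_betw_def)
  have "coords_of B A' n (\<lambda>i. f (e i)) y c \<longleftrightarrow> coords_of B A n e x c" for c
  proof (cases "c \<in> {1..n} \<rightarrow>\<^sub>E carrier B")
    case True
    then have cc: "c i \<in> carrier B" if "i \<in> {1..n}" for i using that by auto
    let ?s = "\<Oplus>\<^bsub>A\<^esub>i\<in>{1..n}. c i \<odot>\<^bsub>A\<^esub> e i"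
    have s: "?s \<in> carrier A" using cc ec by (intro A.finsum_closed) auto
    have "f ?s = (\<Oplus>\<^bsub>A'\<^esub>i\<in>{1..n}. f (c i \<odot>\<^bsub>A\<^esub> e i))"
      using cc ec by (subst f.hom_finsum) (auto simp: o_def)
    also have "\<dots> = (\<Oplus>\<^bsub>A'\<^esub>i\<in>{1..n}. c i \<odot>\<^bsub>A'\<^esub> f (e i))"
      using cc ec by (intro A'.M.finsum_cong') (auto simp: smult)
    finally have "y = (\<Oplus>\<^bsub>A'\<^esub>i\<in>{1..n}. c i \<odot>\<^bsub>A'\<^esub> f (e i)) \<longleftrightarrow> f x = f ?s" by (simp add: x(2))
    also have "\<dots> \<longleftrightarrow> x = ?s" using bij x(1) s by (auto simp: bij_betw_def inj_on_def)
    finally show ?thesis using True by (simp add: coords_of_def)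
  qed (simp add: coords_of_def)
  then show "\<exists>!c. coords_of B A' n (\<lambda>i. f (e i)) y c"
    using e x(1) unfolding module_basis_def by simp
qed

text \<open>
  With \<open>E = A \<otimes> C\<close>, the locale provides the three constructions that occur in the theorem: \<open>AC.E\<close> is \<open>E\<close>,
  \<open>S'.Gal\<close> is \<open>G(E/C)\<close>, and \<open>GC.E\<close> is \<open>G(A/B) \<otimes> C\<close> as an algebra over \<open>C\<close>, while \<open>GC.T\<close> is the same ring
  as an algebra over \<open>B\<close>.
\<close>

locale Sn_base_change = S: Sn_closure B A n + C: algebra B C
  for B :: "('b, 'k) ring_scheme" and A :: "('b, 'a, 'p) module_scheme" and n
    and C :: "('b, 'c, 'q) module_scheme"
begin

sublocale AC: tensor_pair B A C ..
sublocale GC: tensor_pair B S.Gal C ..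

sublocale S': Sn_closure C AC.E n
proof unfold_locales
  show "\<exists>e. module_basis C AC.E n e" using S.basis_exists AC.E_basis by blast
qed

abbreviation "\<eta> \<equiv> \<lambda>b. b \<odot>\<^bsub>C\<^esub> \<one>\<^bsub>C\<^esub>"
abbreviation "\<theta> \<equiv> sn_map B C AC.E n \<eta> (\<lambda>a. AC.pure a \<one>\<^bsub>C\<^esub>)"
abbreviation "\<Phi> \<equiv> sn_base_change_map B A n C"

lemma eta_hom: "\<eta> \<in> ring_hom B C" by (rule C.structure_map_hom)

lemma eta_closed: "\<eta> \<in> carrier B \<rightarrow> carrier C" by auto

lemma char_coeff_base_change:
  assumes "a \<in> carrier A" "j \<in> {1..n}"
  shows "char_coeff C AC.E n j (AC.pure a \<one>\<^bsub>C\<^esub>) = \<eta> (char_coeff B A n j a)"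
proof -
  obtain e where e: "module_basis B A n e" using S.basis_exists by blast
  show ?thesis
    using char_coeff_semilinear[OF S.A.algebra_axioms AC.algebra_E eta_hom AC.left_semilinear e AC.E_basis[OF e] assms(1)] assms(2)
    by auto
qed

lemmas theta = sn_map_hom[OF S.Sn_closure_axioms S'.Sn_closure_axioms eta_hom AC.left_semilinear char_coeff_base_change]

lemma theta_hom: "\<theta> \<in> semilinear_hom B \<eta> S.Gal S'.Gal" by (rule theta(1))
lemma theta_root: "i \<in> {1..n} \<Longrightarrow> a \<in> carrier A \<Longrightarrow> \<theta> (S.root i a) = S'.root i (AC.pure a \<one>\<^bsub>C\<^esub>)"
  using theta(2) by blast
lemma theta_closed: "x \<in> carrier S.Gal \<Longrightarrow> \<theta> x \<in> carrier S'.Gal"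
  using ring_hom_closed[OF semilinear_homD(1)[OF theta_hom]] .

lemma Phi_ring_hom: "\<Phi> \<in> ring_hom GC.T S'.Gal"
  and Phi_pure: "x \<in> carrier S.Gal \<Longrightarrow> c \<in> carrier C \<Longrightarrow> \<Phi> (GC.pure x c) = c \<odot>\<^bsub>S'.Gal\<^esub> \<theta> x"
proof -
  have h: "(\<lambda>c. c \<odot>\<^bsub>S'.Gal\<^esub> \<one>\<^bsub>S'.Gal\<^esub>) \<in> semilinear_hom B \<eta> C S'.Gal"
  proof (rule semilinear_homI[OF S'.Gal.structure_map_hom])
    fix b c assume b: "b \<in> carrier B" and c: "c \<in> carrier C"
    have "b \<odot>\<^bsub>C\<^esub> c = \<eta> b \<otimes>\<^bsub>C\<^esub> c" using b c by (rule C.smult_eq_mult)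
    then show "(b \<odot>\<^bsub>C\<^esub> c) \<odot>\<^bsub>S'.Gal\<^esub> \<one>\<^bsub>S'.Gal\<^esub> = \<eta> b \<odot>\<^bsub>S'.Gal\<^esub> (c \<odot>\<^bsub>S'.Gal\<^esub> \<one>\<^bsub>S'.Gal\<^esub>)"
      using b c by (simp add: S'.Gal.smult_assoc1)
  qed
  have k: "c \<odot>\<^bsub>S'.Gal\<^esub> \<theta> x = \<theta> x \<otimes>\<^bsub>S'.Gal\<^esub> (c \<odot>\<^bsub>S'.Gal\<^esub> \<one>\<^bsub>S'.Gal\<^esub>)" if "x \<in> carrier S.Gal" "c \<in> carrier C" for x c
    using that theta_closed[OF that(1)] by (simp add: S'.Gal.mult_smult_right)
  have eq: "\<Phi> = quot_lift (lin_ext B S'.Gal \<eta> (\<lambda>(x, c). c \<odot>\<^bsub>S'.Gal\<^esub> \<theta> x))"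
    by (simp add: sn_base_change_map_def Let_def)
  note L = GC.lift_homs[OF S'.Gal.algebra_axioms eta_hom theta_hom h, where k = "\<lambda>(x, c). c \<odot>\<^bsub>S'.Gal\<^esub> \<theta> x", folded eq]
  show "\<Phi> \<in> ring_hom GC.T S'.Gal" using L(1) k by (auto simp: semilinear_hom_def)
  show "\<Phi> (GC.pure x c) = c \<odot>\<^bsub>S'.Gal\<^esub> \<theta> x" if "x \<in> carrier S.Gal" "c \<in> carrier C" for x c
    using L(2)[OF _ that] k that by simp
qed

lemma theta_one: "\<theta> \<one>\<^bsub>S.Gal\<^esub> = \<one>\<^bsub>S'.Gal\<^esub>"
  by (rule ring_hom_one[OF semilinear_homD(1)[OF theta_hom]])

lemma Phi_scalar: "c \<in> carrier C \<Longrightarrow> \<Phi> (GC.pure \<one>\<^bsub>S.Gal\<^esub> c) = c \<odot>\<^bsub>S'.Gal\<^esub> \<one>\<^bsub>S'.Gal\<^esub>"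
  by (simp add: Phi_pure theta_one)

lemma Phi_root:
  "i \<in> {1..n} \<Longrightarrow> a \<in> carrier A \<Longrightarrow> \<Phi> (GC.pure (S.root i a) \<one>\<^bsub>C\<^esub>) = S'.root i (AC.pure a \<one>\<^bsub>C\<^esub>)"
  by (simp add: Phi_pure theta_root AC.E_ops)

lemma Phi_hom: "\<Phi> \<in> semilinear_hom C (\<lambda>c. c) GC.E S'.Gal"
proof (rule semilinear_homI)
  show "\<Phi> \<in> ring_hom GC.E S'.Gal" using Phi_ring_hom by (simp add: GC.ring_hom_E)
  fix c X assume c: "c \<in> carrier C" and "X \<in> carrier GC.E"
  then have X: "X \<in> carrier GC.T" by (simp add: GC.E_ops)
  have "\<Phi> (c \<odot>\<^bsub>GC.E\<^esub> X) = (c \<odot>\<^bsub>S'.Gal\<^esub> \<one>\<^bsub>S'.Gal\<^esub>) \<otimes>\<^bsub>S'.Gal\<^esub> \<Phi> X"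
    using c X by (simp add: GC.E_ops ring_hom_mult[OF Phi_ring_hom] Phi_scalar)
  also have "\<dots> = c \<odot>\<^bsub>S'.Gal\<^esub> \<Phi> X"
    using c ring_hom_closed[OF Phi_ring_hom X] by (rule S'.Gal.smult_eq_mult[symmetric])
  finally show "\<Phi> (c \<odot>\<^bsub>GC.E\<^esub> X) = c \<odot>\<^bsub>S'.Gal\<^esub> \<Phi> X" .
qed

text \<open>
  The roots \<open>E \<rightarrow> G(A/B) \<otimes> C\<close>, \<open>a \<otimes> c \<mapsto> a\<^sup>(\<^sup>i\<^sup>) \<otimes> c\<close>, that define the inverse of \<open>\<Phi>\<close>.
\<close>

definition "conjugate i = tensor_map B S.Gal C (S.root i) (\<lambda>c. c)"

lemma conjugate_hom: "i \<in> {1..n} \<Longrightarrow> conjugate i \<in> semilinear_hom C (\<lambda>c. c) AC.E GC.E"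
  and conjugate_pure: "i \<in> {1..n} \<Longrightarrow> a \<in> carrier A \<Longrightarrow> c \<in> carrier C \<Longrightarrow> conjugate i (AC.pure a c) = GC.pure (S.root i a) c"
proof -
  have id: "(\<lambda>c. c) \<in> algebra_hom B C C" by (auto simp: algebra_hom_def intro: ring_hom_memI)
  note T = tensor_map_hom[OF S.A.algebra_axioms C.algebra_axioms S.Gal.algebra_axioms C.algebra_axioms S.root_hom id]
  show "conjugate i \<in> semilinear_hom C (\<lambda>c. c) AC.E GC.E" if "i \<in> {1..n}"
    unfolding conjugate_def using T(1)[OF that] .
  show "conjugate i (AC.pure a c) = GC.pure (S.root i a) c" if "i \<in> {1..n}" "a \<in> carrier A" "c \<in> carrier C"
    unfolding conjugate_def using T(2)[OF that] .
qed

text \<open>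
  The elements \<open>a \<otimes> 1\<close> span \<open>E\<close> over \<open>C\<close>, and for them the relations are the images of those in \<open>G(A/B)\<close>.
\<close>

lemma conjugate_relation:
  assumes \<alpha>: "\<alpha> \<in> carrier AC.E" and j: "j \<in> {1..n}"
  shows "char_coeff C AC.E n j \<alpha> \<odot>\<^bsub>GC.E\<^esub> \<one>\<^bsub>GC.E\<^esub> = elem_sym GC.E n (\<lambda>i. conjugate i \<alpha>) j"
proof -
  obtain e where e: "module_basis B A n e" using S.basis_exists by blast
  interpret l: ring_hom_cring S.Gal GC.E "\<lambda>x. GC.pure x \<one>\<^bsub>C\<^esub>"
    using semilinear_homD(1)[OF GC.left_semilinear] by unfold_locales
  show ?thesis
  proof (rule char_relations_if_spanning[OF AC.algebra_E AC.E_basis[OF e] GC.algebra_E, where S = "(\<lambda>a. AC.pure a \<one>\<^bsub>C\<^esub>) ` carrier A"])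
    show "conjugate i \<in> algebra_hom C AC.E GC.E" if "i \<in> {1..n}" for i
      using conjugate_hom[OF that] by (simp add: algebra_hom_eq_semilinear_hom)
    show "(\<lambda>a. AC.pure a \<one>\<^bsub>C\<^esub>) ` carrier A \<subseteq> carrier AC.E" by (auto simp: AC.E_ops)
    show "carrier AC.E \<subseteq> add_span AC.E {c \<odot>\<^bsub>AC.E\<^esub> s | c s. c \<in> carrier C \<and> s \<in> (\<lambda>a. AC.pure a \<one>\<^bsub>C\<^esub>) ` carrier A}"
      by (rule AC.E_spanned)
    fix s k assume "s \<in> (\<lambda>a. AC.pure a \<one>\<^bsub>C\<^esub>) ` carrier A" and k: "k \<in> {1..n}"
    then obtain a where a: "a \<in> carrier A" and s: "s = AC.pure a \<one>\<^bsub>C\<^esub>" by auto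
    have cc: "char_coeff B A n k a \<in> carrier B" using a by (rule S.char_coeff_in)
    have "char_coeff C AC.E n k s \<odot>\<^bsub>GC.E\<^esub> \<one>\<^bsub>GC.E\<^esub> = \<eta> (char_coeff B A n k a) \<odot>\<^bsub>GC.E\<^esub> \<one>\<^bsub>GC.E\<^esub>"
      unfolding s char_coeff_base_change[OF a k] ..
    also have "\<dots> = GC.pure \<one>\<^bsub>S.Gal\<^esub> (\<eta> (char_coeff B A n k a))" using cc by (intro GC.smult_one_E) simp
    also have "\<dots> = GC.pure (char_coeff B A n k a \<odot>\<^bsub>S.Gal\<^esub> \<one>\<^bsub>S.Gal\<^esub>) \<one>\<^bsub>C\<^esub>"
      using cc by (simp add: GC.pure_smult_left GC.pure_smult_right)
    also have "\<dots> = GC.pure (elem_sym S.Gal n (\<lambda>i. S.root i a) k) \<one>\<^bsub>C\<^esub>"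
      by (simp only: S.root_relation[OF a k])
    also have "\<dots> = elem_sym GC.E n (\<lambda>i. GC.pure (S.root i a) \<one>\<^bsub>C\<^esub>) k"
      using a by (intro l.hom_elem_sym) simp
    also have "\<dots> = elem_sym GC.E n (\<lambda>i. conjugate i s) k"
    proof (rule GC.E.elem_sym_cong)
      fix i assume i: "i \<in> {1..n}"
      show "GC.pure (S.root i a) \<one>\<^bsub>C\<^esub> = conjugate i s" unfolding s using conjugate_pure[OF i a] by simp
      then show "conjugate i s \<in> carrier GC.E" using i a by (simp add: GC.E_ops flip: \<open>GC.pure (S.root i a) \<one>\<^bsub>C\<^esub> = conjugate i s\<close>)
    qed
    finally show "char_coeff C AC.E n k s \<odot>\<^bsub>GC.E\<^esub> \<one>\<^bsub>GC.E\<^esub> = elem_sym GC.E n (\<lambda>i. conjugate i s) k" .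
  qed (rule \<alpha> j)+
qed

lemma Psi_exists:
  obtains \<Psi> where "\<Psi> \<in> semilinear_hom C (\<lambda>c. c) S'.Gal GC.E"
    "\<And>i \<alpha>. i \<in> {1..n} \<Longrightarrow> \<alpha> \<in> carrier AC.E \<Longrightarrow> \<Psi> (S'.root i \<alpha>) = conjugate i \<alpha>"
proof -
  have id: "(\<lambda>c. c) \<in> ring_hom C C" by (auto intro: ring_hom_memI)
  let ?h = "quot_lift (lin_ext C GC.E (\<lambda>c. c) (\<lambda>t. \<Otimes>\<^bsub>GC.E\<^esub>i\<in>{1..n}. conjugate i (t i)))"
  have conjugate_closed: "conjugate i \<alpha> \<in> carrier GC.E" if "i \<in> {1..n}" "\<alpha> \<in> carrier AC.E" for i \<alpha>
    using ring_hom_closed[OF semilinear_homD(1)[OF conjugate_hom]] that by blast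
  have h: "?h \<in> semilinear_hom C (\<lambda>c. c) S'.T GC.E"
    by (rule S'.lift_homs(1)[OF GC.algebra_E id conjugate_hom refl])
  have hp: "?h (S'.place i \<alpha>) = conjugate i \<alpha>" if "i \<in> {1..n}" "\<alpha> \<in> carrier AC.E" for i \<alpha>
    by (rule S'.lift_homs(3)[OF GC.algebra_E id conjugate_hom refl that])
  have rel: "char_coeff C AC.E n j \<alpha> \<odot>\<^bsub>GC.E\<^esub> \<one>\<^bsub>GC.E\<^esub> = elem_sym GC.E n (\<lambda>i. ?h (S'.place i \<alpha>)) j"
    if "\<alpha> \<in> carrier AC.E" "j \<in> {1..n}" for \<alpha> j
    unfolding conjugate_relation[OF that] using that hp conjugate_closed by (intro GC.E.elem_sym_cong) simp_all
  note L = S'.sn_lift[OF GC.algebra_E h id rel]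
  show thesis
  proof (rule that)
    show "quot_lift ?h \<in> semilinear_hom C (\<lambda>c. c) S'.Gal GC.E" by (rule L(1))
    show "quot_lift ?h (S'.root i \<alpha>) = conjugate i \<alpha>" if "i \<in> {1..n}" "\<alpha> \<in> carrier AC.E" for i \<alpha>
      unfolding S'.root_def using L(2)[OF _ _ S'.place_closed[OF that]] hp[OF that] by (rule trans)
  qed
qed

text \<open>
  Both composites with \<open>\<Psi>\<close> are the identity, since they fix the generators: \<open>root i a \<otimes> 1\<close> and \<open>1 \<otimes> c\<close> on one
  side, the roots of \<open>a \<otimes> 1\<close> and of \<open>1 \<otimes> c\<close> on the other.
\<close>

lemma Phi_iso: "\<Phi> \<in> algebra_iso C GC.E S'.Gal"
proof -
  obtain \<Psi> where \<Psi>: "\<Psi> \<in> semilinear_hom C (\<lambda>c. c) S'.Gal GC.E"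
    and \<Psi>_root: "\<And>i \<alpha>. i \<in> {1..n} \<Longrightarrow> \<alpha> \<in> carrier AC.E \<Longrightarrow> \<Psi> (S'.root i \<alpha>) = conjugate i \<alpha>"
    using Psi_exists by blast
  note \<Psi>r = semilinear_homD(1)[OF \<Psi>] and \<Phi>r = semilinear_homD(1)[OF Phi_hom]
  have id_C: "(\<lambda>c. c) \<in> carrier C \<rightarrow> carrier C" by simp
  have \<Psi>\<Phi>: "\<Psi> (\<Phi> X) = X" if X: "X \<in> carrier GC.E" for X
  proof (rule GC.hom_eqI[where u = "\<lambda>X. \<Psi> (\<Phi> X)" and v = "\<lambda>X. X", OF GC.E.ring_axioms])
    show "(\<lambda>X. \<Psi> (\<Phi> X)) \<in> ring_hom GC.T GC.E"
      using ring_hom_trans[OF \<Phi>r \<Psi>r] by (simp add: o_def GC.ring_hom_E)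
    show "(\<lambda>X. X) \<in> ring_hom GC.T GC.E" by (auto simp: GC.ring_hom_E intro: ring_hom_memI)
    show "X \<in> carrier GC.T" using X by (simp add: GC.E_ops)
  next
    fix x assume x: "x \<in> carrier S.Gal"
    show "\<Psi> (\<Phi> (GC.pure x \<one>\<^bsub>C\<^esub>)) = GC.pure x \<one>\<^bsub>C\<^esub>"
    proof (rule S.Gal_hom_eqI[OF GC.algebra_E _ GC.left_semilinear _ x])
      show "(\<lambda>x. \<Psi> (\<Phi> (GC.pure x \<one>\<^bsub>C\<^esub>))) \<in> semilinear_hom B \<eta> S.Gal GC.E"
        using semilinear_hom_comp[OF semilinear_hom_comp[OF GC.left_semilinear Phi_hom eta_closed] \<Psi> eta_closed] .
      fix i a assume ia: "i \<in> {1..n}" "a \<in> carrier A"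
      then show "\<Psi> (\<Phi> (GC.pure (S.root i a) \<one>\<^bsub>C\<^esub>)) = GC.pure (S.root i a) \<one>\<^bsub>C\<^esub>"
        by (simp add: Phi_root \<Psi>_root conjugate_pure AC.E_ops)
    qed
  next
    fix c assume c: "c \<in> carrier C"
    have "\<Psi> (c \<odot>\<^bsub>S'.Gal\<^esub> \<one>\<^bsub>S'.Gal\<^esub>) = c \<odot>\<^bsub>GC.E\<^esub> \<one>\<^bsub>GC.E\<^esub>"
      using c by (simp add: semilinear_homD(2)[OF \<Psi>] ring_hom_one[OF \<Psi>r])
    then show "\<Psi> (\<Phi> (GC.pure \<one>\<^bsub>S.Gal\<^esub> c)) = GC.pure \<one>\<^bsub>S.Gal\<^esub> c"
      using c by (simp add: Phi_scalar GC.smult_one_E)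
  qed
  have \<Phi>_conjugate: "\<Phi> (conjugate i \<alpha>) = S'.root i \<alpha>" if i: "i \<in> {1..n}" and \<alpha>: "\<alpha> \<in> carrier AC.E" for i \<alpha>
  proof (rule AC.hom_eqI[where u = "\<lambda>\<alpha>. \<Phi> (conjugate i \<alpha>)", OF S'.Gal.ring_axioms])
    have root: "S'.root i \<in> algebra_hom C AC.E S'.Gal" using i by (rule S'.root_hom)
    show "(\<lambda>\<alpha>. \<Phi> (conjugate i \<alpha>)) \<in> ring_hom AC.T S'.Gal"
      using ring_hom_trans[OF semilinear_homD(1)[OF conjugate_hom[OF i]] \<Phi>r] by (simp add: o_def AC.ring_hom_E)
    show "S'.root i \<in> ring_hom AC.T S'.Gal"
      using root by (simp add: algebra_hom_def AC.ring_hom_E)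
    show "\<alpha> \<in> carrier AC.T" using \<alpha> by (simp add: AC.E_ops)
    show "\<Phi> (conjugate i (AC.pure a \<one>\<^bsub>C\<^esub>)) = S'.root i (AC.pure a \<one>\<^bsub>C\<^esub>)" if "a \<in> carrier A" for a
      using i that by (simp add: conjugate_pure Phi_root)
    fix c assume c: "c \<in> carrier C"
    have "S.root i \<one>\<^bsub>A\<^esub> = \<one>\<^bsub>S.Gal\<^esub>"
      using S.root_hom[OF i] by (auto simp: algebra_hom_def ring_hom_def)
    moreover have "S'.root i (c \<odot>\<^bsub>AC.E\<^esub> \<one>\<^bsub>AC.E\<^esub>) = c \<odot>\<^bsub>S'.Gal\<^esub> \<one>\<^bsub>S'.Gal\<^esub>"
      using root c by (auto simp: algebra_hom_def ring_hom_def)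
    ultimately show "\<Phi> (conjugate i (AC.pure \<one>\<^bsub>A\<^esub> c)) = S'.root i (AC.pure \<one>\<^bsub>A\<^esub> c)"
      using i c by (simp add: conjugate_pure Phi_scalar AC.smult_one_E)
  qed
  have \<Phi>\<Psi>: "\<Phi> (\<Psi> Y) = Y" if Y: "Y \<in> carrier S'.Gal" for Y
  proof (rule S'.Gal_hom_eqI[where u = "\<lambda>Y. \<Phi> (\<Psi> Y)" and v = "\<lambda>Y. Y" and g = "\<lambda>c. c", OF S'.Gal.algebra_axioms])
    show "(\<lambda>Y. \<Phi> (\<Psi> Y)) \<in> semilinear_hom C (\<lambda>c. c) S'.Gal S'.Gal"
      using semilinear_hom_comp[OF \<Psi> Phi_hom id_C] .
    show "(\<lambda>Y. Y) \<in> semilinear_hom C (\<lambda>c. c) S'.Gal S'.Gal"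
      by (auto simp: semilinear_hom_def intro: ring_hom_memI)
    show "\<Phi> (\<Psi> (S'.root i \<alpha>)) = S'.root i \<alpha>" if "i \<in> {1..n}" "\<alpha> \<in> carrier AC.E" for i \<alpha>
      using that by (simp only: \<Psi>_root \<Phi>_conjugate)
  qed (rule Y)
  have "bij_betw \<Phi> (carrier GC.E) (carrier S'.Gal)"
    by (rule bij_betwI[where g = \<Psi>])
      (use \<Psi>\<Phi> \<Phi>\<Psi> ring_hom_closed[OF \<Phi>r] ring_hom_closed[OF \<Psi>r] in auto)
  then show ?thesis
    using Phi_hom by (simp add: algebra_iso_def algebra_hom_eq_semilinear_hom)
qed

end

text \<open>
  Both composites are homomorphisms that are semilinear over \<open>h\<close>. They send \<open>root i a \<otimes> 1\<close> to
  \<open>root i (f a \<otimes> 1)\<close> and \<open>1 \<otimes> c\<close> to the scalar \<open>h c\<close>.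
\<close>

lemma base_change_map_natural:
  assumes "Sn_base_change B A n C" and "Sn_base_change B A' n C'"
    and f: "f \<in> algebra_iso B A A'" and h: "h \<in> algebra_hom B C C'"
    and X: "X \<in> carrier (base_change B (sn_closure B A n) C)"
  shows "sn_base_change_map B A' n C'
      (tensor_map B (sn_closure B A' n) C' (sn_map B B A' n (\<lambda>b. b) f) h X)
    = sn_map C C' (base_change B A' C') n h (tensor_map B A' C' f h) (sn_base_change_map B A n C X)"
proof -
  interpret L: Sn_base_change B A n C by fact
  interpret R: Sn_base_change B A' n C' by fact
  obtain e where e: "module_basis B A n e" using L.S.basis_exists by blast
  note A = L.S.A.algebra_axioms and A' = R.S.A.algebra_axioms and C = L.C.algebra_axioms and C' = R.C.algebra_axioms
  have fe: "module_basis B A' n (\<lambda>i. f (e i))" by (rule algebra_iso_basis[OF A A' f e])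
  have f': "f \<in> algebra_hom B A A'" using f by (simp add: algebra_iso_def)
  have fr: "f \<in> ring_hom A A'" and hr: "h \<in> ring_hom C C'" using f' h by (auto simp: algebra_hom_def)
  have h1: "h \<one>\<^bsub>C\<^esub> = \<one>\<^bsub>C'\<^esub>" using hr by (rule ring_hom_one)
  have hc: "h c \<in> carrier C'" if "c \<in> carrier C" for c using ring_hom_closed[OF hr that] .
  have fc: "f a \<in> carrier A'" if "a \<in> carrier A" for a using ring_hom_closed[OF fr that] .
  have id: "(\<lambda>b. b) \<in> ring_hom B B" by (auto intro: ring_hom_memI)
  have "char_coeff B A' n j (f a) = char_coeff B A n j a" if "a \<in> carrier A" "j \<in> {1..n}" for a j
    using char_coeff_semilinear[OF A A' id f'[unfolded algebra_hom_eq_semilinear_hom] e fe that(1)] that(2) by auto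
  note s = sn_map_hom[OF L.S.Sn_closure_axioms R.S.Sn_closure_axioms id f'[unfolded algebra_hom_eq_semilinear_hom] this]
  let ?s = "sn_map B B A' n (\<lambda>b. b) f" and ?t = "tensor_map B A' C' f h"
  have s_hom: "?s \<in> algebra_hom B L.S.Gal R.S.Gal" unfolding algebra_hom_eq_semilinear_hom by (rule s(1))
  have s_root: "?s (L.S.root i a) = R.S.root i (f a)" if "i \<in> {1..n}" "a \<in> carrier A" for i a
    by (rule s(2)[OF _ _ that])
  note t = tensor_map_hom[OF A C A' C' f' h]
  let ?T = "tensor_map B R.S.Gal C' ?s h"
  note T = tensor_map_hom[OF L.S.Gal.algebra_axioms C R.S.Gal.algebra_axioms C' s_hom h]
  have t_basis: "module_basis C' R.AC.E n (\<lambda>i. ?t (L.AC.pure (e i) \<one>\<^bsub>C\<^esub>))"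
  proof (rule module_basis_cong[OF R.AC.E.module _ R.AC.E_basis[OF fe]])
    fix i assume "i \<in> {1..n}"
    then show "R.AC.pure (f (e i)) \<one>\<^bsub>C'\<^esub> = ?t (L.AC.pure (e i) \<one>\<^bsub>C\<^esub>)"
      using t(2)[of "e i" "\<one>\<^bsub>C\<^esub>"] L.S.A.basis_closed[OF e] by (simp add: h1)
  qed
  have "char_coeff C' R.AC.E n j (?t \<alpha>) = h (char_coeff C L.AC.E n j \<alpha>)" if "\<alpha> \<in> carrier L.AC.E" "j \<in> {1..n}" for \<alpha> j
    using char_coeff_semilinear[OF L.AC.algebra_E R.AC.algebra_E hr t(1) L.AC.E_basis[OF e] t_basis that(1)] that(2) by auto
  note m = sn_map_hom[OF L.S'.Sn_closure_axioms R.S'.Sn_closure_axioms hr t(1) this]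
  let ?m = "sn_map C C' R.AC.E n h ?t"
  have m_hom: "?m \<in> semilinear_hom C h L.S'.Gal R.S'.Gal" by (rule m(1))
  have m_root: "?m (L.S'.root i \<alpha>) = R.S'.root i (?t \<alpha>)" if "i \<in> {1..n}" "\<alpha> \<in> carrier L.AC.E" for i \<alpha>
    by (rule m(2)[OF _ _ that])
  have hC: "h \<in> carrier C \<rightarrow> carrier C'" and idC: "(\<lambda>c. c) \<in> carrier C \<rightarrow> carrier C" using hc by auto
  have u: "(\<lambda>X. R.\<Phi> (?T X)) \<in> semilinear_hom C h L.GC.E R.S'.Gal"
    using semilinear_hom_comp[OF T(1) R.Phi_hom hC] .
  have v: "(\<lambda>X. ?m (L.\<Phi> X)) \<in> semilinear_hom C h L.GC.E R.S'.Gal"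
    using semilinear_hom_comp[OF L.Phi_hom m_hom idC] .
  show ?thesis
  proof (rule L.GC.hom_eqI[where u = "\<lambda>X. R.\<Phi> (?T X)" and v = "\<lambda>X. ?m (L.\<Phi> X)", OF R.S'.Gal.ring_axioms])
    show "(\<lambda>X. R.\<Phi> (?T X)) \<in> ring_hom L.GC.T R.S'.Gal" "(\<lambda>X. ?m (L.\<Phi> X)) \<in> ring_hom L.GC.T R.S'.Gal"
      using semilinear_homD(1)[OF u] semilinear_homD(1)[OF v] by (simp_all add: L.GC.ring_hom_E)
    show "X \<in> carrier L.GC.T" using X by (simp add: L.GC.E_ops)
  next
    fix x assume x: "x \<in> carrier L.S.Gal"
    show "R.\<Phi> (?T (L.GC.pure x \<one>\<^bsub>C\<^esub>)) = ?m (L.\<Phi> (L.GC.pure x \<one>\<^bsub>C\<^esub>))"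
    proof (rule L.S.Gal_hom_eqI[OF R.S'.Gal.algebra_axioms _ _ _ x])
      show "(\<lambda>x. R.\<Phi> (?T (L.GC.pure x \<one>\<^bsub>C\<^esub>))) \<in> semilinear_hom B (\<lambda>b. h (L.\<eta> b)) L.S.Gal R.S'.Gal"
        using semilinear_hom_comp[OF L.GC.left_semilinear u L.eta_closed] .
      show "(\<lambda>x. ?m (L.\<Phi> (L.GC.pure x \<one>\<^bsub>C\<^esub>))) \<in> semilinear_hom B (\<lambda>b. h (L.\<eta> b)) L.S.Gal R.S'.Gal"
        using semilinear_hom_comp[OF L.GC.left_semilinear v L.eta_closed] .
      fix i a assume ia: "i \<in> {1..n}" "a \<in> carrier A"
      have "R.\<Phi> (?T (L.GC.pure (L.S.root i a) \<one>\<^bsub>C\<^esub>)) = R.\<Phi> (R.GC.pure (R.S.root i (f a)) \<one>\<^bsub>C'\<^esub>)"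
        using T(2)[of "L.S.root i a" "\<one>\<^bsub>C\<^esub>"] ia by (simp add: s_root h1)
      also have "\<dots> = R.S'.root i (R.AC.pure (f a) \<one>\<^bsub>C'\<^esub>)" using ia fc by (intro R.Phi_root) auto
      also have "\<dots> = R.S'.root i (?t (L.AC.pure a \<one>\<^bsub>C\<^esub>))" using t(2)[of a "\<one>\<^bsub>C\<^esub>"] ia by (simp add: h1)
      also have "\<dots> = ?m (L.S'.root i (L.AC.pure a \<one>\<^bsub>C\<^esub>))" using ia by (intro m_root[symmetric]) (auto simp: L.AC.E_ops)
      also have "\<dots> = ?m (L.\<Phi> (L.GC.pure (L.S.root i a) \<one>\<^bsub>C\<^esub>))" using ia by (simp only: L.Phi_root)
      finally show "R.\<Phi> (?T (L.GC.pure (L.S.root i a) \<one>\<^bsub>C\<^esub>)) = ?m (L.\<Phi> (L.GC.pure (L.S.root i a) \<one>\<^bsub>C\<^esub>))" .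
    qed
  next
    fix c assume c: "c \<in> carrier C"
    have s1: "?s \<one>\<^bsub>L.S.Gal\<^esub> = \<one>\<^bsub>R.S.Gal\<^esub>" using s_hom by (auto simp: algebra_hom_def ring_hom_def)
    have "R.\<Phi> (?T (L.GC.pure \<one>\<^bsub>L.S.Gal\<^esub> c)) = h c \<odot>\<^bsub>R.S'.Gal\<^esub> \<one>\<^bsub>R.S'.Gal\<^esub>"
      using T(2)[of "\<one>\<^bsub>L.S.Gal\<^esub>" c] c hc by (simp add: s1 R.Phi_scalar)
    also have "\<dots> = ?m (c \<odot>\<^bsub>L.S'.Gal\<^esub> \<one>\<^bsub>L.S'.Gal\<^esub>)"
      using semilinear_homD(2)[OF m_hom c] ring_hom_one[OF semilinear_homD(1)[OF m_hom]] by simp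
    also have "\<dots> = ?m (L.\<Phi> (L.GC.pure \<one>\<^bsub>L.S.Gal\<^esub> c))" using c by (simp only: L.Phi_scalar)
    finally show "R.\<Phi> (?T (L.GC.pure \<one>\<^bsub>L.S.Gal\<^esub> c)) = ?m (L.\<Phi> (L.GC.pure \<one>\<^bsub>L.S.Gal\<^esub> c))" .
  qed
qed

theorem theorem1:
  fixes B :: "('b, 'k) ring_scheme"
    and A :: "('b, 'a, 'p) module_scheme"
    and C :: "('b, 'c, 'q) module_scheme"
    and n :: nat
  assumes "cring B" and "ring_of_rank B A n" and "algebra B C"
  shows "algebra C (base_change B (sn_closure B A n) C)
    \<and> ring_of_rank C (base_change B A C) n
    \<and> algebra C (sn_closure C (base_change B A C) n)
    \<and> sn_base_change_map B A n C
        \<in> algebra_iso C (base_change B (sn_closure B A n) C) (sn_closure C (base_change B A C) n)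
    \<and> (\<forall>x\<in>{1..n} \<rightarrow>\<^sub>E carrier A. \<forall>c\<in>carrier C.
        sn_base_change_map B A n C
          (tensor_pure B (sn_closure B A n) C (sn_class B A n (power_pure B A n x)) c)
        = c \<odot>\<^bsub>sn_closure C (base_change B A C) n\<^esub>
            sn_class C (base_change B A C) n
              (power_pure C (base_change B A C) n (\<lambda>i\<in>{1..n}. tensor_pure B A C (x i) \<one>\<^bsub>C\<^esub>)))
    \<and> (\<forall>(A' :: ('b, 'a2, 'p2) module_scheme) (C' :: ('b, 'c2, 'q2) module_scheme) f h.
        ring_of_rank B A' n \<longrightarrow> algebra B C' \<longrightarrow> f \<in> algebra_iso B A A' \<longrightarrow> h \<in> algebra_hom B C C' \<longrightarrow>
        (\<forall>X\<in>carrier (base_change B (sn_closure B A n) C).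
          sn_base_change_map B A' n C'
            (tensor_map B (sn_closure B A' n) C' (sn_map B B A' n (\<lambda>b. b) f) h X)
          = sn_map C C' (base_change B A' C') n h (tensor_map B A' C' f h)
              (sn_base_change_map B A n C X)))"
proof -
  have loc: "Sn_base_change B A n C" if "ring_of_rank B A n" "algebra B C"
    for A :: "('b, 'x, 'y) module_scheme" and C :: "('b, 'z, 'w) module_scheme"
    using that by (auto simp: ring_of_rank_def intro!: Sn_base_change.intro Sn_closure.intro
        tensor_pow.intro Sn_closure_axioms.intro)
  interpret L: Sn_base_change B A n C using assms(2,3) by (rule loc)
  have pure_formula: "L.\<Phi> (L.GC.pure (L.S.sn_cls (L.S.pure x)) c)
      = c \<odot>\<^bsub>L.S'.Gal\<^esub> L.S'.sn_cls (L.S'.pure (\<lambda>i\<in>{1..n}. L.AC.pure (x i) \<one>\<^bsub>C\<^esub>))"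
    if "x \<in> {1..n} \<rightarrow>\<^sub>E carrier A" "c \<in> carrier C" for x c
    using L.Phi_pure[of "L.S.sn_cls (L.S.pure x)" c] L.theta(3)[of x] L.S.pure_closed[of x] that by simp
  have rank: "ring_of_rank C L.AC.E n"
    using L.AC.algebra_E L.S'.basis_exists by (simp add: ring_of_rank_def)
  show ?thesis
  proof (intro conjI ballI allI impI)
    fix A' :: "('b, 'a2, 'p2) module_scheme" and C' :: "('b, 'c2, 'q2) module_scheme" and f h X
    assume "ring_of_rank B A' n" "algebra B C'" and fh: "f \<in> algebra_iso B A A'" "h \<in> algebra_hom B C C'"
      and X: "X \<in> carrier (base_change B (sn_closure B A n) C)"
    then show "sn_base_change_map B A' n C'
        (tensor_map B (sn_closure B A' n) C' (sn_map B B A' n (\<lambda>b. b) f) h X)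
      = sn_map C C' (base_change B A' C') n h (tensor_map B A' C' f h) (sn_base_change_map B A n C X)"
      using base_change_map_natural[OF L.Sn_base_change_axioms loc fh X] by blast
  qed (fact L.GC.algebra_E rank L.S'.Gal.algebra_axioms L.Phi_iso | rule pure_formula; assumption)+
qed

end
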